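(* Let $p,q$ be positive integers and suppose that $(X,Y)\sim\mathcal N_{p+q}(\mu,\Sigma)$, where $X\in\mathbb{R}^p$, $Y\in\mathbb{R}^q$ and $$\Sigma=\begin{pmatrix}\Sigma_X&\Sigma_{XY}\\ \Sigma_{YX}&\Sigma_Y\end{pmatrix}$$ with $\Sigma_X\in\mathbb{R}^{p\times p}$ and $\Sigma_Y\in\mathbb{R}^{q\times q}$ nonsingular and $\Sigma_{XY}\in\mathbb{R}^{p\times q}$. Let $\Lambda=\Sigma_Y^{-1/2}\Sigma_{YX}\Sigma_X^{-1}\Sigma_{XY}\Sigma_Y^{-1/2}\in\mathbb{R}^{q\times q}$. Then $$\widetilde{\mathcal V}^2(X,Y)=4\pi\,\frac{c_{p-1}}{c_p}\,\frac{c_{q-1}}{c_q}\Bigl({}_3F_2\bigl(\tfrac12,-\tfrac12,-\tfrac12;\tfrac12p,\tfrac12q;\Lambda\bigr)-2\,{}_3F_2\bigl(\tfrac12,-\tfrac12,-\tfrac12;\tfrac12p,\tfrac12q;\tfrac14\Lambda\bigr)+1\Bigr).$$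
   Context: $|\cdot|_p$ and $\langle\cdot,\cdot\rangle_p$ denote the Euclidean norm and scalar product on $\mathbb{R}^p$; $c_p=\pi^{(p+1)/2}/\Gamma((p+1)/2)$ (for integers $p\ge0$); $(\alpha)_k=\alpha(\alpha+1)\cdots(\alpha+k-1)$ is the rising factorial, with $(\alpha)_0=1$. For jointly distributed random vectors $X\in\mathbb{R}^p$, $Y\in\mathbb{R}^q$ let $f_{X,Y}(s,t)=\mathbb{E}\exp[\mathrm{i}\langle s,X\rangle_p+\mathrm{i}\langle t,Y\rangle_q]$, $f_X(s)=f_{X,Y}(s,0)$, $f_Y(t)=f_{X,Y}(0,t)$. The distance covariance $\mathcal V(X,Y)\ge0$ is defined by $$\mathcal V^2(X,Y)=\frac{1}{c_pc_q}\int_{\mathbb{R}^{p+q}}\frac{|f_{X,Y}(s,t)-f_X(s)f_Y(t)|^2}{|s|_p^{p+1}|t|_q^{q+1}}\,ds\,dt .$$ For $X,Y$ with finite second moments and nonsingular covariance matrices $\Sigma_X,\Sigma_Y$, the affinely invariant distance covariance $\widetilde{\mathcal V}(X,Y)\ge0$ is defined by $\widetilde{\mathcal V}^2(X,Y)=\mathcal V^2(\Sigma_X^{-1/2}X,\Sigma_Y^{-1/2}Y)$, where inverse square roots are those of positive definite matrices. $\mathcal N_{p+q}(\mu,\Sigma)$ is the multivariate normal distribution with mean $\mu\in\mathbb{R}^{p+q}$ and covariance matrix $\Sigma\in\mathbb{R}^{(p+q)\times(p+q)}$; $\Sigma_{YX}=\Sigma_{XY}'$, where $'$ denotes transpose.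 Generalized hypergeometric functions of matrix argument. A partition $\kappa=(k_1,\ldots,k_q)$ is a vector of integers $k_1\ge\cdots\ge k_q\ge0$, with weight $|\kappa|=k_1+\cdots+k_q$. Its partitional rising factorial is, for $\alpha\in\mathbb{C}$, $(\alpha)_\kappa=\prod_{j=1}^q\bigl(\alpha-\tfrac12(j-1)\bigr)_{k_j}$. $C_\kappa$ denotes the zonal polynomial on symmetric matrices in $\mathbb{R}^{q\times q}$ in the standard normalization $\sum_{|\kappa|=k}C_\kappa(S)=(\operatorname{tr}S)^k$; it is a symmetric homogeneous polynomial of degree $|\kappa|$ in the eigenvalues of its argument. Let $\alpha_1,\ldots,\alpha_l,\beta_1,\ldots,\beta_m\in\mathbb{C}$, where $-\beta_i+\tfrac12(j-1)$ is not a nonnegative integer, for all $i=1,\ldots,m$ and $j=1,\ldots,q$. Then, for a symmetric matrix $S\in\mathbb{R}^{q\times q}$, the ${}_lF_m$ generalized hypergeometric function of matrix argument is defined as $${}_lF_m(\alpha_1,\ldots,\alpha_l;\beta_1,\ldots,\beta_m;S)=\sum_{k=0}^\infty\frac1{k!}\sum_{|\kappa|=k}\frac{(\alpha_1)_\kappa\cdots(\alpha_l)_\kappa}{(\beta_1)_\kappa\cdots(\beta_m)_\kappa}\,C_\kappa(S).$$ *)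

theory Defs
  imports "HOL-Probability.Probability"
begin

section \<open>Random vectors and the multivariate normal distribution\<close>

text \<open>The normal law on the real line with mean \<open>m\<close> and variance \<open>v\<close>; a point mass for \<open>v = 0\<close>.\<close>

definition normal_law :: "real \<Rightarrow> real \<Rightarrow> real measure" where
  "normal_law m v =
     (if v = 0 then return borel m else density lborel (\<lambda>x. ennreal (normal_density m (sqrt v) x)))"

text \<open>\<open>Z \<sim> N(\<mu>, \<Sigma>)\<close>, possibly singular: every linear combination \<open>a \<bullet> Z\<close> is normal, with mean
  \<open>a \<bullet> \<mu>\<close> and variance \<open>a' \<Sigma> a\<close>.\<close>

definition multivariate_normal ::
    "'a measure \<Rightarrow> ('a \<Rightarrow> real^'n) \<Rightarrow> real^'n \<Rightarrow> real^'n^'n \<Rightarrow> bool" where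
  "multivariate_normal M Z \<mu> \<Sigma> \<longleftrightarrow>
     Z \<in> borel_measurable M \<and>
     transpose \<Sigma> = \<Sigma> \<and>
     (\<forall>a. 0 \<le> a \<bullet> (\<Sigma> *v a)) \<and>
     (\<forall>a. distr M borel (\<lambda>\<omega>. a \<bullet> Z \<omega>) = normal_law (a \<bullet> \<mu>) (a \<bullet> (\<Sigma> *v a)))"

definition join_vec :: "real^'p \<Rightarrow> real^'q \<Rightarrow> real^('p + 'q)" where
  "join_vec x y = (\<chi> k. case k of Inl i \<Rightarrow> x $ i | Inr j \<Rightarrow> y $ j)"

definition block_matrix ::
    "real^'p^'p \<Rightarrow> real^'q^'p \<Rightarrow> real^'p^'q \<Rightarrow> real^'q^'q \<Rightarrow> real^('p + 'q)^('p + 'q)" where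
  "block_matrix A B C D =
     (\<chi> k l. case k of
        Inl i \<Rightarrow> (case l of Inl i' \<Rightarrow> A $ i $ i' | Inr j' \<Rightarrow> B $ i $ j')
      | Inr j \<Rightarrow> (case l of Inl i' \<Rightarrow> C $ j $ i' | Inr j' \<Rightarrow> D $ j $ j'))"

definition covariance_matrix :: "'a measure \<Rightarrow> ('a \<Rightarrow> real^'n) \<Rightarrow> real^'n^'n" where
  "covariance_matrix M X =
     (\<chi> i j. LINT \<omega>|M. (X \<omega> $ i - (LINT \<eta>|M. X \<eta> $ i)) * (X \<omega> $ j - (LINT \<eta>|M. X \<eta> $ j)))"

section \<open>Inverse square roots of positive definite matrices\<close>

definition positive_definite :: "real^'n^'n \<Rightarrow> bool" where
  "positive_definite A \<longleftrightarrow> transpose A = A \<and> (\<forall>x. x \<noteq> 0 \<longrightarrow> 0 < x \<bullet> (A *v x))"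

text \<open>Meaningful for positive definite \<open>A\<close>, where existence and uniqueness hold.\<close>

definition inv_sqrt_matrix :: "real^'n^'n \<Rightarrow> real^'n^'n" where
  "inv_sqrt_matrix A = (THE B. positive_definite B \<and> B ** B = matrix_inv A)"

section \<open>Distance covariance\<close>

definition dcov_const :: "nat \<Rightarrow> real" where
  "dcov_const p = pi powr ((real p + 1) / 2) / Gamma ((real p + 1) / 2)"

definition joint_char ::
    "'a measure \<Rightarrow> ('a \<Rightarrow> real^'p) \<Rightarrow> ('a \<Rightarrow> real^'q) \<Rightarrow> real^'p \<Rightarrow> real^'q \<Rightarrow> complex" where
  "joint_char M X Y s t =
     (LINT \<omega>|M. exp (\<i> * complex_of_real (s \<bullet> X \<omega>) + \<i> * complex_of_real (t \<bullet> Y \<omega>)))"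

text \<open>The Bochner integral below is \<open>0\<close> when the (nonnegative) integrand is not integrable; the integral
  is finite as soon as \<open>X\<close> and \<open>Y\<close> have finite first moments.  The points with \<open>s = 0\<close> or \<open>t = 0\<close>,
  where division by zero occurs, form a null set.\<close>

definition dcov :: "'a measure \<Rightarrow> ('a \<Rightarrow> real^'p) \<Rightarrow> ('a \<Rightarrow> real^'q) \<Rightarrow> real" where
  "dcov M X Y = sqrt (1 / (dcov_const CARD('p) * dcov_const CARD('q)) *
     (LINT (s, t)|(lborel :: ((real^'p) \<times> (real^'q)) measure).
        (cmod (joint_char M X Y s t - joint_char M X Y s 0 * joint_char M X Y 0 t))\<^sup>2 /
        (norm s ^ (CARD('p) + 1) * norm t ^ (CARD('q) + 1))))"

definition affine_dcov :: "'a measure \<Rightarrow> ('a \<Rightarrow> real^'p) \<Rightarrow> ('a \<Rightarrow> real^'q) \<Rightarrow> real" where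
  "affine_dcov M X Y =
     dcov M (\<lambda>\<omega>. inv_sqrt_matrix (covariance_matrix M X) *v X \<omega>)
            (\<lambda>\<omega>. inv_sqrt_matrix (covariance_matrix M Y) *v Y \<omega>)"

section \<open>Zonal polynomials\<close>

definition partitions_of :: "nat \<Rightarrow> nat \<Rightarrow> nat list set" where
  "partitions_of q k = {\<kappa>. length \<kappa> = q \<and> sorted_wrt (\<ge>) \<kappa> \<and> sum_list \<kappa> = k}"

text \<open>A polynomial in \<open>y $ i\<close> (\<open>i :: 'q\<close>) is given by its coefficients, indexed by exponent vectors
  \<open>a :: 'q \<Rightarrow> nat\<close>.\<close>

definition exponents :: "nat \<Rightarrow> ('q::finite \<Rightarrow> nat) set" where
  "exponents k = {a. (\<Sum>i\<in>UNIV. a i) = k}"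

definition symmetric_form :: "nat \<Rightarrow> (('q \<Rightarrow> nat) \<Rightarrow> real) \<Rightarrow> (real^'q \<Rightarrow> real) \<Rightarrow> bool" where
  "symmetric_form k c f \<longleftrightarrow>
     (\<forall>a \<pi>. bij \<pi> \<longrightarrow> c (a \<circ> \<pi>) = c a) \<and>
     (\<forall>y. f y = (\<Sum>a\<in>exponents k. c a * (\<Prod>i\<in>UNIV. y $ i ^ a i)))"

definition rearranges :: "('q::finite \<Rightarrow> nat) \<Rightarrow> nat list \<Rightarrow> bool" where
  "rearranges a \<kappa> \<longleftrightarrow> image_mset a (mset_set UNIV) = mset \<kappa>"

text \<open>The decreasing rearrangement of \<open>a\<close> is below \<open>\<kappa>\<close> in the dominance order; the sum of the \<open>j\<close>
  largest entries of \<open>a\<close> is the maximum of \<open>\<Sum>i\<in>J. a i\<close> over the sets \<open>J\<close> with \<open>j\<close> elements.\<close>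

definition dominated :: "('q::finite \<Rightarrow> nat) \<Rightarrow> nat list \<Rightarrow> bool" where
  "dominated a \<kappa> \<longleftrightarrow> (\<forall>J. (\<Sum>i\<in>J. a i) \<le> sum_list (take (card J) \<kappa>))"

definition partial_deriv :: "'q \<Rightarrow> (real^'q \<Rightarrow> real) \<Rightarrow> real^'q \<Rightarrow> real" where
  "partial_deriv i f y = deriv (\<lambda>x. f (\<chi> j. if j = i then x else y $ j)) (y $ i)"

definition laplace_beltrami :: "(real^'q \<Rightarrow> real) \<Rightarrow> real^'q \<Rightarrow> real" where
  "laplace_beltrami f y =
     (\<Sum>i\<in>UNIV. (y $ i)\<^sup>2 * partial_deriv i (partial_deriv i f) y) +
     (\<Sum>i\<in>UNIV. \<Sum>j\<in>UNIV - {i}. (y $ i)\<^sup>2 / (y $ i - y $ j) * partial_deriv i f y)"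

text \<open>The definition of the zonal polynomials of degree \<open>k\<close> as functions of the eigenvalues (R. J.
  Muirhead, Aspects of Multivariate Statistical Theory, Definition 7.2.1): symmetric homogeneous
  polynomials with leading monomial \<open>y\<^sup>\<kappa>\<close>, eigenfunctions of the Laplace-Beltrami operator (which is
  singular where two coordinates agree), adding up to the \<open>k\<close>-th power of the trace.  Lower terms are
  understood in the dominance order.  In the lexicographic order these conditions would not
  determine the family: \<open>(4,1,1)\<close> and \<open>(3,3)\<close> have the same eigenvalue.\<close>

definition zonal_family :: "nat \<Rightarrow> (nat list \<Rightarrow> real^'q \<Rightarrow> real) \<Rightarrow> bool" where
  "zonal_family k C \<longleftrightarrow>
     (\<forall>\<kappa>\<in>partitions_of CARD('q) k.
        (\<exists>c. symmetric_form k c (C \<kappa>) \<and>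
             (\<forall>a\<in>exponents k. rearranges a \<kappa> \<longrightarrow> c a \<noteq> 0) \<and>
             (\<forall>a\<in>exponents k. c a \<noteq> 0 \<longrightarrow> dominated a \<kappa>)) \<and>
        (\<exists>r. \<forall>y. inj (\<lambda>i. y $ i) \<longrightarrow> laplace_beltrami (C \<kappa>) y = r * C \<kappa> y)) \<and>
     (\<forall>y. (\<Sum>\<kappa>\<in>partitions_of CARD('q) k. C \<kappa> y) = (\<Sum>i\<in>UNIV. y $ i) ^ k)"

text \<open>The values on \<open>partitions_of CARD('q) k\<close> of a \<open>zonal_family\<close> of degree \<open>k\<close> exist and are unique.\<close>

definition zonal_eig :: "nat list \<Rightarrow> real^'q \<Rightarrow> real" where
  "zonal_eig \<kappa> = (SOME C. zonal_family (sum_list \<kappa>) C) \<kappa>"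

text \<open>\<open>y\<close> lists the eigenvalues of the symmetric matrix \<open>S\<close> with multiplicity.\<close>

definition eigenvalue_vec :: "real^'q^'q \<Rightarrow> real^'q \<Rightarrow> bool" where
  "eigenvalue_vec S y \<longleftrightarrow>
     (\<exists>Q. orthogonal_matrix Q \<and> S = Q ** (\<chi> i j. if i = j then y $ i else 0) ** transpose Q)"

definition zonal :: "nat list \<Rightarrow> real^'q^'q \<Rightarrow> real" where
  "zonal \<kappa> S = zonal_eig \<kappa> (SOME y. eigenvalue_vec S y)"

section \<open>Hypergeometric functions of matrix argument\<close>

definition part_pochhammer :: "'f::real_normed_field \<Rightarrow> nat list \<Rightarrow> 'f" where
  "part_pochhammer \<alpha> \<kappa> = (\<Prod>j<length \<kappa>. pochhammer (\<alpha> - of_nat j / 2) (\<kappa> ! j))"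

text \<open>Real or complex parameters.  A term with a vanishing denominator counts as \<open>0\<close>.  This convention
  matters when some \<open>(\<beta>)\<^sub>\<kappa>\<close> and some \<open>(\<alpha>)\<^sub>\<kappa>\<close> vanish together: for \<open>\<alpha> = 1/2\<close>, \<open>(1/2)\<^sub>\<kappa> = 0\<close> unless \<open>\<kappa>\<close>
  has at most one nonzero part, whereas \<open>(p/2)\<^sub>\<kappa> = 0\<close> as soon as the part number \<open>p + 1\<close> of \<open>\<kappa>\<close> is
  nonzero.\<close>

definition hypergeometric_matrix ::
    "'f::real_normed_field list \<Rightarrow> 'f list \<Rightarrow> real^'q^'q \<Rightarrow> 'f" where
  "hypergeometric_matrix \<alpha>s \<beta>s S =
     (\<Sum>k. 1 / fact k *
        (\<Sum>\<kappa>\<in>partitions_of CARD('q) k.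
           (\<Prod>\<alpha>\<leftarrow>\<alpha>s. part_pochhammer \<alpha> \<kappa>) / (\<Prod>\<beta>\<leftarrow>\<beta>s. part_pochhammer \<beta> \<kappa>) *
           of_real (zonal \<kappa> S)))"

end

theory Submission
  imports Defs "HOL-Combinatorics.Permutations"
begin

text \<open>Let \<open>R\<close> be the cross-covariance of the standardized vectors, so that \<open>\<Lambda> = R' R\<close>.  Their characteristic
  function is explicit, and with \<open>u = s \<bullet> R t\<close> the integrand of the squared distance covariance is
  \<open>exp (-|s|^2 - |t|^2) (exp (-u) - 1)^2 / (|s|^(p+1) |t|^(q+1))\<close>.  Averaging it over the reflection of \<open>s\<close>
  replaces \<open>(exp (-u) - 1)^2\<close> by its even part, the power series with the terms
  \<open>(4^k - 2) / (2k)! u^(2k)\<close> for \<open>k \<ge> 1\<close>.  These are nonnegative, so the integral may be taken term by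
  term.  On a function that is homogeneous of degree \<open>2k\<close> the singular weights only change a Gaussian
  integral by a quotient of values of the Gamma function (\<open>nn_integral_radial\<close>).  The Gaussian integral of
  \<open>u^(2k)\<close> over \<open>s\<close> gives a multiple of \<open>(t \<bullet> \<Lambda> t)^k\<close>, and the one over \<open>t\<close> then gives a multiple of
  \<open>Z\<^sub>k(y) = \<Sum> \<Prod> (1/2)\<^sub>a\<^sub>i / a\<^sub>i! y\<^sub>i^a\<^sub>i\<close>, summed over the exponent vectors \<open>a\<close> of weight \<open>k\<close>, where \<open>y\<close> lists
  the eigenvalues of \<open>\<Lambda>\<close> (\<open>row_form\<close>, \<open>nn_integral_gaussian_quadratic\<close>).  The factor \<open>4^k - 2\<close> makes the sum
  over \<open>k\<close> a series in \<open>\<Lambda>\<close> minus twice the same series in \<open>\<Lambda>/4\<close>, and the missing term for \<open>k = 0\<close>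
  accounts for the summand \<open>1\<close>.

  In the hypergeometric functions the factor \<open>(1/2)\<^sub>\<kappa>\<close> vanishes when \<open>\<kappa>\<close> has two nonzero parts.  Hence
  both sides agree as soon as the zonal polynomial of the partition \<open>(k)\<close> is
  \<open>k! / (1/2)\<^sub>k Z\<^sub>k\<close> (\<open>zonal_eig_row\<close>).  Zonal polynomials are given by characteristic properties, so this takes
  two arguments: a family with these properties exists, and in every such family the member of \<open>(k)\<close> is
  the one above.

  Existence: the Cherednik operators with the parameter of the zonal case are triangular on monomials,
  and their joint eigenvalues separate exponent vectors.  By induction on \<open>k\<close>, the \<open>k\<close>-th power of the
  trace is a sum of joint eigenforms, one for each exponent vector of weight \<open>k\<close>: the relations of the
  operators with adjacent transpositions (\<open>cherednik_at_adjacent\<close>) and with a map that raises the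
  degree (\<open>cherednik_raise\<close>) show that such decompositions survive permutations of the variables and the step
  from \<open>k\<close> to \<open>k + 1\<close>.  No component is zero (\<open>component_nonzero\<close>).  The components that belong
  to the rearrangements of \<open>\<kappa>\<close> add up to a symmetric form with the leading monomial \<open>y^\<kappa>\<close>, and it is
  an eigenfunction of the Laplace-Beltrami operator, because on symmetric forms this operator differs from the
  sum of the squares of the Cherednik operators by a constant (\<open>sum_cherednik_squares\<close>).

  Uniqueness for \<open>(k)\<close>: at a coordinate vector all other members of a zonal family vanish by
  dominance, so that the member of \<open>(k)\<close> is \<open>1\<close> there.  The form \<open>Z\<^sub>k\<close> is an eigenfunction of the
  Laplace-Beltrami operator as well, and the eigenvalue of \<open>(k)\<close> is strictly larger than that of every
  other partition of \<open>k\<close>, which makes symmetric eigenforms with a nonzero value at the coordinate vectors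
  proportional (\<open>symmetric_eigenform_unique\<close>).\<close>

section \<open>Forms in several variables\<close>

definition monom_at :: "('q::finite \<Rightarrow> nat) \<Rightarrow> real^'q \<Rightarrow> real" where
  "monom_at a y = (\<Prod>i\<in>UNIV. y $ i ^ a i)"

definition form :: "nat \<Rightarrow> (('q::finite \<Rightarrow> nat) \<Rightarrow> real) \<Rightarrow> real^'q \<Rightarrow> real" where
  "form k c y = (\<Sum>a\<in>exponents k. c a * monom_at a y)"

definition is_form :: "nat \<Rightarrow> (real^'q::finite \<Rightarrow> real) \<Rightarrow> bool" where
  "is_form k f \<longleftrightarrow> (\<exists>c. f = form k c)"

text \<open>Points where no two coordinates agree: there the divided differences in the Cherednik operators and in the
  Laplace-Beltrami operator are meaningful, and a form that vanishes at all of these points is zero.\<close>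

abbreviation generic :: "real^'q \<Rightarrow> bool" where
  "generic y \<equiv> inj (\<lambda>i. y $ i)"

text \<open>An arbitrary enumeration of the index type: the Cherednik operators depend on a linear order of the
  variables.\<close>

definition idx :: "'q::finite \<Rightarrow> nat" where
  "idx = (SOME f. bij_betw f UNIV {..<CARD('q)})"

lemma bij_idx: "bij_betw (idx :: 'q::finite \<Rightarrow> nat) UNIV {..<CARD('q)}"
proof -
  have "\<exists>f::'q \<Rightarrow> nat. bij_betw f UNIV {..<CARD('q)}"
    using ex_bij_betw_finite_nat[of "UNIV :: 'q set"] by (simp add: atLeast0LessThan)
  then show ?thesis
    unfolding idx_def by (rule someI_ex)
qed

lemma idx_less: "idx (i::'q::finite) < CARD('q)"
  using bij_idx bij_betwE by fastforce

lemma idx_eq_iff [simp]: "idx i = idx j \<longleftrightarrow> i = j"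
  using bij_idx by (metis UNIV_I bij_betw_imp_inj_on inj_on_eq_iff)

lemma finite_exponents [simp]: "finite (exponents k :: ('q::finite \<Rightarrow> nat) set)"
proof (rule finite_subset)
  show "(exponents k :: ('q \<Rightarrow> nat) set) \<subseteq> PiE UNIV (\<lambda>_. {..k})"
    by (auto simp: exponents_def intro: member_le_sum)
qed (auto intro: finite_PiE)

lemma exponents_le: "a \<in> exponents k \<Longrightarrow> a i \<le> k" for a :: "'q::finite \<Rightarrow> nat"
  by (auto simp: exponents_def intro: member_le_sum)

lemma base_digits_unique:
  fixes a b :: "nat \<Rightarrow> nat"
  assumes "\<And>i. i < n \<Longrightarrow> a i < N" "\<And>i. i < n \<Longrightarrow> b i < N"
    and "(\<Sum>i<n. a i * N ^ i) = (\<Sum>i<n. b i * N ^ i)" and "i < n"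
  shows "a i = b i"
  using assms
proof (induction n arbitrary: a b i)
  case (Suc n)
  have split: "(\<Sum>i<Suc n. c i * N ^ i) = c 0 + N * (\<Sum>i<n. c (Suc i) * N ^ i)" for c
    unfolding sum.lessThan_Suc_shift by (simp add: sum_distrib_left algebra_simps)
  have lt: "a 0 < N" "b 0 < N"
    using Suc.prems by auto
  have eq: "a 0 + N * (\<Sum>i<n. a (Suc i) * N ^ i) = b 0 + N * (\<Sum>i<n. b (Suc i) * N ^ i)"
    using Suc.prems(3) unfolding split .
  then have "(a 0 + N * (\<Sum>i<n. a (Suc i) * N ^ i)) mod N = (b 0 + N * (\<Sum>i<n. b (Suc i) * N ^ i)) mod N"
    by simp
  then have 0: "a 0 = b 0"
    using lt by simp
  with eq lt have eq': "(\<Sum>i<n. a (Suc i) * N ^ i) = (\<Sum>i<n. b (Suc i) * N ^ i)"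
    by auto
  show ?case
  proof (cases i)
    case (Suc j)
    then show ?thesis
      using Suc.IH[of "\<lambda>i. a (Suc i)" "\<lambda>i. b (Suc i)" j] Suc.prems eq' by auto
  qed (use 0 in simp)
qed simp

text \<open>Kronecker substitution: with \<open>y\<^sub>i = t^(N^idx i)\<close> distinct monomials of degree \<open>k\<close> become distinct powers
  of \<open>t\<close>, and the point is generic for \<open>t > 1\<close>.  The form turns into a polynomial in \<open>t\<close> with infinitely many
  zeros.\<close>

lemma form_eq_0_imp_coeff_eq_0:
  fixes c :: "('q::finite \<Rightarrow> nat) \<Rightarrow> real"
  assumes zero: "\<And>y. generic y \<Longrightarrow> form k c y = 0" and a: "a \<in> exponents k"
  shows "c a = 0"
proof -
  \<comment> \<open>A base that exceeds all exponents, so that \<open>code\<close> reads exponent vectors as digits.\<close>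
  define N where "N = k + 2"
  define code :: "('q \<Rightarrow> nat) \<Rightarrow> nat" where "code = (\<lambda>a. \<Sum>i\<in>UNIV. a i * N ^ idx i)"
  have inj: "inj_on code (exponents k)"
  proof (rule inj_onI)
    fix a b :: "'q \<Rightarrow> nat"
    assume ab: "a \<in> exponents k" "b \<in> exponents k" "code a = code b"
    define j where "j = inv_into (UNIV :: 'q set) idx"
    have j: "bij_betw j {..<CARD('q)} UNIV" "\<And>n. n < CARD('q) \<Longrightarrow> idx (j n) = n" "\<And>i. j (idx i) = i"
      using bij_betw_inv_into[OF bij_idx[where 'q = 'q]] bij_betw_inv_into_right[OF bij_idx[where 'q = 'q]]
        bij_betw_inv_into_left[OF bij_idx[where 'q = 'q]]
      by (simp_all add: j_def)
    have code: "code d = (\<Sum>n<CARD('q). d (j n) * N ^ n)" for d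
      unfolding code_def using sum.reindex_bij_betw[OF j(1), of "\<lambda>i. d i * N ^ idx i"] j(2)
      by simp
    have "a (j n) = b (j n)" if "n < CARD('q)" for n
      by (rule base_digits_unique[of "CARD('q)" "\<lambda>n. a (j n)" N "\<lambda>n. b (j n)"])
         (use that ab exponents_le[of a k] exponents_le[of b k] in
          \<open>auto simp: code N_def less_Suc_eq_le intro: le_imp_less_Suc le_SucI\<close>)
    then have "a i = b i" for i
      using j(3)[of i] idx_less[of i] by metis
    then show "a = b" by auto
  qed
  define p where "p = (\<Sum>b\<in>exponents k. monom (c b) (code b))"
  have "poly p t = 0" if "t > 1" for t :: real
  proof -
    define y :: "real^'q" where "y = (\<chi> i. t ^ (N ^ idx i))"
    have "generic y"
    proof (rule injI)
      fix i j assume "y $ i = y $ j"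
      then have "N ^ idx i = N ^ idx j"
        using that by (simp add: y_def)
      then show "i = j"
        by (simp add: N_def)
    qed
    moreover have "monom_at b y = t ^ code b" for b
      by (simp add: monom_at_def y_def code_def power_sum power_mult[symmetric] mult.commute)
    ultimately show ?thesis
      using zero[of y] by (simp add: p_def form_def poly_sum poly_monom)
  qed
  then have "{1<..} \<subseteq> {t. poly p t = 0}"
    by auto
  then have "infinite {t. poly p t = 0}"
    using infinite_Ioi[of "1::real"] finite_subset by blast
  then have "p = 0"
    using poly_roots_finite by blast
  then have "0 = coeff p (code a)"
    by simp
  also have "\<dots> = (\<Sum>b\<in>exponents k. if b = a then c b else 0)"
    unfolding p_def coeff_sum
    by (intro sum.cong refl) (use inj a in \<open>auto simp: inj_on_def\<close>)
  also have "\<dots> = c a"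
    using a by simp
  finally show ?thesis by simp
qed

lemma form_diff: "form k c y - form k d y = form k (\<lambda>a. c a - d a) y"
  by (simp add: form_def sum_subtractf algebra_simps)

lemma form_add: "form k c y + form k d y = form k (\<lambda>a. c a + d a) y"
  by (simp add: form_def sum.distrib algebra_simps)

lemma form_scale: "r * form k c y = form k (\<lambda>a. r * c a) y"
  by (simp add: form_def sum_distrib_left algebra_simps)

lemma form_sum: "(\<Sum>i\<in>A. form k (c i) y) = form k (\<lambda>a. \<Sum>i\<in>A. c i a) y"
  by (simp add: form_def sum_distrib_right sum.swap[of _ _ A])

lemma form_coeff_unique:
  assumes "\<And>y. generic y \<Longrightarrow> form k c y = form k d y" and "a \<in> exponents k"
  shows "c a = d a"
proof -
  have "(\<lambda>a. c a - d a) a = 0"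
    by (rule form_eq_0_imp_coeff_eq_0[OF _ assms(2)])
       (use assms(1) in \<open>simp add: form_diff[symmetric]\<close>)
  then show ?thesis by simp
qed

lemma form_cong: "(\<And>a. a \<in> exponents k \<Longrightarrow> c a = d a) \<Longrightarrow> form k c = form k d"
  by (auto simp: form_def intro!: ext sum.cong)

lemma is_form_eqI:
  assumes "is_form k f" "is_form k g" "\<And>y. generic y \<Longrightarrow> f y = g y"
  shows "f = g"
  using assms form_coeff_unique form_cong unfolding is_form_def by metis

lemma is_form_form [simp]: "is_form k (form k c)"
  by (auto simp: is_form_def)

lemma is_form_add: "is_form k f \<Longrightarrow> is_form k g \<Longrightarrow> is_form k (\<lambda>y. f y + g y)"
  by (auto simp: is_form_def form_add)

lemma is_form_scale: "is_form k f \<Longrightarrow> is_form k (\<lambda>y. r * f y)"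
  by (auto simp: is_form_def form_scale)

lemma is_form_0: "is_form k (\<lambda>y. 0)"
  unfolding is_form_def by (rule exI[of _ "\<lambda>_. 0"]) (simp add: form_def fun_eq_iff)

lemma is_form_sum: "(\<And>i. i \<in> A \<Longrightarrow> is_form k (f i)) \<Longrightarrow> is_form k (\<lambda>y. \<Sum>i\<in>A. f i y)"
  by (induction A rule: infinite_finite_induct) (auto intro: is_form_0 is_form_add)

lemma monom_at_eq_form:
  "a \<in> exponents k \<Longrightarrow> monom_at a = form k (\<lambda>b. if b = a then 1 else 0)"
  by (auto simp: form_def if_distrib[of "\<lambda>x. x * _"] cong: if_cong)

lemma is_form_monom: "a \<in> exponents k \<Longrightarrow> is_form k (monom_at a)"
  by (auto simp: monom_at_eq_form)

lemma is_form_induct [consumes 1, case_names zero add scale monom]: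
  assumes "is_form k f" and "P (\<lambda>y. 0)"
    and "\<And>f g. is_form k f \<Longrightarrow> is_form k g \<Longrightarrow> P f \<Longrightarrow> P g \<Longrightarrow> P (\<lambda>y. f y + g y)"
    and "\<And>r f. is_form k f \<Longrightarrow> P f \<Longrightarrow> P (\<lambda>y. r * f y)"
    and "\<And>a. a \<in> exponents k \<Longrightarrow> P (monom_at a)"
  shows "P f"
proof -
  obtain c where c: "f = form k c"
    using assms(1) by (auto simp: is_form_def)
  have "is_form k (\<lambda>y. \<Sum>a\<in>A. c a * monom_at a y) \<and> P (\<lambda>y. \<Sum>a\<in>A. c a * monom_at a y)"
    if "finite A" "A \<subseteq> exponents k" for A
    using that
  proof (induction A rule: finite_induct)
    case (insert a A)
    then show ?case
      using assms(3)[of "\<lambda>y. c a * monom_at a y" "\<lambda>y. \<Sum>a\<in>A. c a * monom_at a y"]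
        assms(4)[of "monom_at a" "c a"] assms(5)[of a]
        is_form_add[of k "\<lambda>y. c a * monom_at a y" "\<lambda>y. \<Sum>a\<in>A. c a * monom_at a y"]
      by (simp add: is_form_monom is_form_scale)
  qed (use assms(2) is_form_0 in auto)
  from this[of "exponents k"] show ?thesis
    by (simp add: c form_def[abs_def])
qed

section \<open>Permuting the variables\<close>

definition permute :: "('q \<Rightarrow> 'q) \<Rightarrow> real^'q::finite \<Rightarrow> real^'q" where
  "permute \<pi> y = (\<chi> i. y $ \<pi> i)"

lemma permute_nth [simp]: "permute \<pi> y $ i = y $ \<pi> i"
  by (simp add: permute_def)

lemma permute_permute [simp]: "permute \<pi> (permute \<rho> y) = permute (\<rho> \<circ> \<pi>) y"
  by (simp add: permute_def vec_eq_iff)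

lemma permute_id [simp]: "permute id y = y" "permute (\<lambda>x. x) y = y"
  by (simp_all add: permute_def vec_eq_iff)

lemma generic_permute: "generic y \<Longrightarrow> inj \<pi> \<Longrightarrow> generic (permute \<pi> y)"
  by (auto simp: inj_def)

lemma generic_nth_eq_iff: "generic y \<Longrightarrow> y $ i = y $ j \<longleftrightarrow> i = j"
  by (auto simp: inj_def)

lemma monom_at_permute:
  assumes "bij \<pi>"
  shows "monom_at (a \<circ> \<pi>) (permute \<pi> y) = monom_at a y"
  unfolding monom_at_def
  using prod.reindex_bij_betw[of \<pi> UNIV UNIV "\<lambda>i. y $ i ^ a i"] assms by (simp add: bij_betw_def)

lemma exponents_comp: "bij \<pi> \<Longrightarrow> a \<circ> \<pi> \<in> exponents k \<longleftrightarrow> a \<in> exponents k"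
  for a :: "'q::finite \<Rightarrow> nat"
  unfolding exponents_def
  using sum.reindex_bij_betw[of \<pi> UNIV UNIV a] by (simp add: bij_betw_def)

lemma form_permute:
  assumes "bij \<pi>"
  shows "form k c (permute \<pi> y) = form k (\<lambda>a. c (a \<circ> \<pi>)) y"
proof -
  have "bij_betw (\<lambda>a. a \<circ> \<pi>) (exponents k) (exponents k)"
  proof (rule bij_betwI[where g = "\<lambda>a. a \<circ> inv \<pi>"])
    show "(\<lambda>a. a \<circ> inv \<pi>) \<in> exponents k \<rightarrow> exponents k"
      using exponents_comp[OF bij_imp_bij_inv[OF assms]] by blast
    show "(\<lambda>a. a \<circ> \<pi>) \<in> exponents k \<rightarrow> exponents k"
      using exponents_comp[OF assms] by blast
  qed (use assms in \<open>auto simp: comp_assoc bij_is_surj bij_is_inj surj_iff[THEN iffD1] inj_iff[THEN iffD1]\<close>)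
  from sum.reindex_bij_betw[OF this, of "\<lambda>a. c a * monom_at a (permute \<pi> y)"]
  show ?thesis
    by (simp add: form_def monom_at_permute[OF assms])
qed

lemma is_form_permute: "is_form k f \<Longrightarrow> bij \<pi> \<Longrightarrow> is_form k (\<lambda>y. f (permute \<pi> y))"
  by (auto simp: is_form_def form_permute)

abbreviation sw :: "'q \<Rightarrow> 'q \<Rightarrow> 'q \<Rightarrow> 'q" where
  "sw \<equiv> Transposition.transpose"

definition adjacent :: "'q::finite \<Rightarrow> 'q \<Rightarrow> bool" where
  "adjacent i j \<longleftrightarrow> idx j = Suc (idx i)"

text \<open>Adjacent transpositions generate the symmetric group: \<open>(i j)\<close> is the conjugate of \<open>(i l)\<close> by \<open>(l j)\<close>,
  where \<open>l\<close> comes immediately before \<open>j\<close>.\<close>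

lemma transpose_adjacent_induct:
  fixes P :: "('q::finite \<Rightarrow> 'q) \<Rightarrow> bool"
  assumes "P id" and comp: "\<And>\<pi> \<rho>. bij \<pi> \<Longrightarrow> bij \<rho> \<Longrightarrow> P \<pi> \<Longrightarrow> P \<rho> \<Longrightarrow> P (\<pi> \<circ> \<rho>)"
    and adj: "\<And>i j. adjacent i j \<Longrightarrow> P (sw i j)"
    and "bij \<pi>"
  shows "P \<pi>"
proof -
  have le: "P (sw i j)" if "idx j = idx i + n" for i j and n :: nat
    using that
  proof (induction n arbitrary: i j)
    case 0
    then show ?case using \<open>P id\<close> by (simp add: id_def)
  next
    case (Suc n)
    have "idx i + n < CARD('q)"
      using Suc.prems idx_less[of j] by simp
    then obtain l :: 'q where l: "idx l = idx i + n"
      using bij_idx by (metis (mono_tags) bij_betw_imp_surj_on imageE lessThan_iff)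
    show ?case
    proof (cases "n = 0")
      case True
      then show ?thesis using adj[of i j] Suc.prems by (simp add: adjacent_def)
    next
      case False
      have lj: "adjacent l j"
        using l Suc.prems by (simp add: adjacent_def)
      have neq: "i \<noteq> l" "l \<noteq> j" "i \<noteq> j"
        using False l Suc.prems by auto
      have eq: "sw i j = sw l j \<circ> (sw i l \<circ> sw l j)"
        using neq by (auto simp: fun_eq_iff Transposition.transpose_def)
      show ?thesis
        unfolding eq using Suc.IH[OF l] adj[OF lj] by (intro comp bij_comp) auto
    qed
  qed
  have tr: "P (sw i j)" for i j
  proof (cases "idx i \<le> idx j")
    case True
    then show ?thesis using le[of j i "idx j - idx i"] by simp
  next
    case False
    then show ?thesis using le[of i j "idx i - idx j"] by (simp add: transpose_commute)
  qed
  have "\<pi> permutes UNIV"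
    using \<open>bij \<pi>\<close> by (intro bij_imp_permutes) (simp_all add: bij_betw_def)
  from this finite show ?thesis
  proof (rule permutes_induct)
    show "P (sw a b \<circ> p)" if "P p" "p permutes UNIV" for a b p
      using permutes_bij[OF that(2)] that(1) by (intro comp tr) auto
  qed (rule \<open>P id\<close>)
qed

section \<open>Partial derivatives of forms\<close>

abbreviation upd :: "real^'q::finite \<Rightarrow> 'q \<Rightarrow> real \<Rightarrow> real^'q" where
  "upd y i x \<equiv> (\<chi> j. if j = i then x else y $ j)"

lemma monom_at_upd:
  "monom_at a (upd y i x) = x ^ a i * (\<Prod>j\<in>UNIV - {i}. y $ j ^ a j)"
  unfolding monom_at_def by (subst prod.remove[of _ i]) (auto intro!: prod.cong)

lemma monom_at_remove: "monom_at a y = y $ i ^ a i * (\<Prod>j\<in>UNIV - {i}. y $ j ^ a j)"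
  unfolding monom_at_def by (subst prod.remove[of _ i]) auto

lemma monom_at_upd_deriv:
  "((\<lambda>x. monom_at a (upd y i x)) has_real_derivative
     (real (a i) * z ^ (a i - 1) * (\<Prod>j\<in>UNIV - {i}. y $ j ^ a j))) (at z)"
  unfolding monom_at_upd by (auto intro!: derivative_eq_intros)

lemma form_differentiable:
  assumes "is_form k f"
  shows "(\<lambda>x. f (upd y i x)) field_differentiable (at z)"
proof -
  obtain c where c: "f = form k c"
    using assms by (auto simp: is_form_def)
  have "((\<lambda>x. \<Sum>a\<in>exponents k. c a * monom_at a (upd y i x)) has_real_derivative
     (\<Sum>a\<in>exponents k. c a * (real (a i) * z ^ (a i - 1) * (\<Prod>j\<in>UNIV - {i}. y $ j ^ a j)))) (at z)"
    by (intro DERIV_sum DERIV_cmult monom_at_upd_deriv)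
  then show ?thesis
    unfolding c form_def[abs_def] field_differentiable_def by blast
qed

lemma partial_deriv_add:
  assumes "is_form k f" "is_form l g"
  shows "partial_deriv i (\<lambda>y. f y + g y) y = partial_deriv i f y + partial_deriv i g y"
  unfolding partial_deriv_def by (intro deriv_add form_differentiable[OF assms(1)] form_differentiable[OF assms(2)])

lemma partial_deriv_scale:
  assumes "is_form k f"
  shows "partial_deriv i (\<lambda>y. r * f y) y = r * partial_deriv i f y"
  unfolding partial_deriv_def by (intro deriv_cmult form_differentiable[OF assms(1)])

lemma partial_deriv_zero: "partial_deriv i (\<lambda>y. 0) y = 0"
  by (simp add: partial_deriv_def)

lemma euler_monom: "y $ i * partial_deriv i (monom_at a) y = real (a i) * monom_at a y"
proof -
  have "partial_deriv i (monom_at a) y = real (a i) * (y $ i) ^ (a i - 1) * (\<Prod>j\<in>UNIV - {i}. y $ j ^ a j)"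
    unfolding partial_deriv_def by (intro DERIV_imp_deriv monom_at_upd_deriv)
  then show ?thesis
    by (cases "a i") (simp_all add: monom_at_remove[of a y i])
qed

lemma partial_deriv_permute:
  assumes "bij \<pi>"
  shows "partial_deriv (\<pi> i) (\<lambda>y. f (permute \<pi> y)) y = partial_deriv i f (permute \<pi> y)"
proof -
  have "permute \<pi> (upd y (\<pi> i) x) = upd (permute \<pi> y) i x" for x
    using bij_is_inj[OF assms] by (auto simp: vec_eq_iff inj_eq)
  then show ?thesis
    by (simp add: partial_deriv_def)
qed

lemma upd_self: "upd y i (y $ i) = y"
  by (simp add: vec_eq_iff)

lemma partial_deriv_mult_var:
  assumes "is_form k f"
  shows "partial_deriv i (\<lambda>y. y $ j * f y) y = y $ j * partial_deriv i f y + (if i = j then f y else 0)"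
proof (cases "i = j")
  case True
  have "deriv (\<lambda>x. x * f (upd y i x)) (y $ i) = y $ i * deriv (\<lambda>x. f (upd y i x)) (y $ i) + f y"
    by (subst deriv_mult) (auto intro: form_differentiable[OF assms] simp: upd_self)
  then show ?thesis
    using True by (simp add: partial_deriv_def)
next
  case False
  have "deriv (\<lambda>x. y $ j * f (upd y i x)) (y $ i) = y $ j * deriv (\<lambda>x. f (upd y i x)) (y $ i)"
    by (intro deriv_cmult form_differentiable[OF assms])
  then show ?thesis
    using False by (simp add: partial_deriv_def)
qed

section \<open>Cherednik operators\<close>

text \<open>The Cherednik operators of type A with the Jack parameter of the zonal case.  Where two coordinates agree
  the quotient is \<open>0\<close> by convention; eigenvalue equations are therefore asserted at generic points.\<close>

definition cherednik :: "'q::finite \<Rightarrow> (real^'q \<Rightarrow> real) \<Rightarrow> real^'q \<Rightarrow> real" where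
  "cherednik i f y = y $ i * partial_deriv i f y
     + (\<Sum>j\<in>UNIV - {i}. y $ i * (f y - f (permute (sw i j) y)) / (y $ i - y $ j)) / 2
     + (\<Sum>j | idx i < idx j. f (permute (sw i j) y)) / 2"

lemma cherednik_add:
  assumes "is_form k f" "is_form l g"
  shows "cherednik i (\<lambda>y. f y + g y) y = cherednik i f y + cherednik i g y"
proof -
  have *: "y $ i * (f y + g y - (f (permute (sw i j) y) + g (permute (sw i j) y))) / (y $ i - y $ j)
     = y $ i * (f y - f (permute (sw i j) y)) / (y $ i - y $ j)
     + y $ i * (g y - g (permute (sw i j) y)) / (y $ i - y $ j)" for j
    by (simp add: add_divide_distrib[symmetric] algebra_simps)
  show ?thesis
    unfolding cherednik_def partial_deriv_add[OF assms] * sum.distrib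
    by (simp add: algebra_simps add_divide_distrib)
qed

lemma cherednik_scale:
  assumes "is_form k f"
  shows "cherednik i (\<lambda>y. r * f y) y = r * cherednik i f y"
proof -
  have *: "y $ i * (r * f y - r * f (permute (sw i j) y)) / (y $ i - y $ j)
     = r * (y $ i * (f y - f (permute (sw i j) y)) / (y $ i - y $ j))" for j
    by (simp add: algebra_simps)
  show ?thesis
    unfolding cherednik_def partial_deriv_scale[OF assms] * sum_distrib_left[symmetric]
    by (simp add: algebra_simps)
qed

lemma cherednik_zero: "cherednik i (\<lambda>y. 0) y = 0"
  by (simp add: cherednik_def partial_deriv_zero)

lemma cherednik_sum:
  assumes "\<And>a. a \<in> A \<Longrightarrow> is_form k (f a)"
  shows "cherednik i (\<lambda>y. \<Sum>a\<in>A. f a y) y = (\<Sum>a\<in>A. cherednik i (f a) y)"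
  using assms
proof (induction A rule: infinite_finite_induct)
  case (insert a A)
  then show ?case
    using cherednik_add[of k "f a" k "\<lambda>y. \<Sum>a\<in>A. f a y" i y] by (simp add: is_form_sum)
qed (simp_all add: cherednik_zero)

text \<open>Conjugation by \<open>\<pi>\<close> turns every ingredient of the operator of \<open>i\<close> into that of the operator of \<open>\<pi> i\<close>,
  except for the last sum: its range depends on the order of the variables.\<close>

lemma cherednik_at_permute:
  assumes "bij \<pi>"
  shows "cherednik i f (permute \<pi> y) = cherednik (\<pi> i) (\<lambda>y. f (permute \<pi> y)) y
     + ((\<Sum>m\<in>\<pi> ` {m. idx i < idx m}. f (permute \<pi> (permute (sw (\<pi> i) m) y)))
      - (\<Sum>m | idx (\<pi> i) < idx m. f (permute \<pi> (permute (sw (\<pi> i) m) y)))) / 2"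
proof -
  have inj: "inj \<pi>" using assms by (rule bij_is_inj)
  have bij: "bij_betw \<pi> (UNIV - {i}) (UNIV - {\<pi> i})"
    using inj_on_subset[OF inj] image_set_diff[OF inj, of UNIV "{i}"] bij_is_surj[OF assms]
    by (simp add: bij_betw_def)
  have sw: "permute (sw i m) (permute \<pi> y) = permute \<pi> (permute (sw (\<pi> i) (\<pi> m)) y)" for m
    using inj by (auto simp: vec_eq_iff Transposition.transpose_def inj_eq)
  have eq1: "(\<Sum>j\<in>UNIV - {i}. y $ \<pi> i * (f (permute \<pi> y) - f (permute (sw i j) (permute \<pi> y))) / (y $ \<pi> i - y $ \<pi> j))
     = (\<Sum>j\<in>UNIV - {\<pi> i}. y $ \<pi> i * (f (permute \<pi> y) - f (permute \<pi> (permute (sw (\<pi> i) j) y))) / (y $ \<pi> i - y $ j))"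
    unfolding sw
    by (rule sum.reindex_bij_betw[OF bij,
        of "\<lambda>j. y $ \<pi> i * (f (permute \<pi> y) - f (permute \<pi> (permute (sw (\<pi> i) j) y))) / (y $ \<pi> i - y $ j)"])
  have eq2: "(\<Sum>j | idx i < idx j. f (permute (sw i j) (permute \<pi> y)))
     = (\<Sum>m\<in>\<pi> ` {m. idx i < idx m}. f (permute \<pi> (permute (sw (\<pi> i) m) y)))"
    unfolding sw sum.reindex[OF inj_on_subset[OF inj subset_UNIV]] o_def by (rule refl)
  show ?thesis
    unfolding cherednik_def eq2 partial_deriv_permute[OF assms] permute_nth eq1
    by (simp add: field_simps)
qed

text \<open>For adjacent indices the ranges of the last sum differ by the reflection \<open>(i j)\<close> alone, and applying this
  reflection twice gives back the value of \<open>f\<close> itself.  This is the cross relation of the degenerate affine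
  Hecke algebra.\<close>

lemma cherednik_at_adjacent:
  fixes i j :: "'q::finite"
  assumes "adjacent i j"
  shows "cherednik l f (permute (sw i j) y) = cherednik (sw i j l) (\<lambda>y. f (permute (sw i j) y)) y
     + (if l = i then f y / 2 else if l = j then - f y / 2 else 0)"
proof -
  have ij: "idx j = Suc (idx i)" "i \<noteq> j"
    using assms by (auto simp: adjacent_def)
  have inv: "permute (sw i j) (permute (sw i j) y) = y" "permute (sw i j) (permute (sw j i) y) = y"
    by (auto simp: vec_eq_iff transpose_commute[of j i])
  have "idx i < idx m \<longleftrightarrow> idx m = idx j \<or> idx j < idx m" for m :: 'q
    using ij(1) by linarith
  then have above: "{m. idx i < idx m} = insert j {m. idx j < idx m}"
    by auto
  have "sw i j m = m" if "idx j < idx m" for m :: 'q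
    using ij(1) that by (auto simp: Transposition.transpose_def)
  then have fixed: "sw i j ` {m. idx j < idx m} = {m. idx j < idx m}"
    by simp
  have *: "cherednik l f (permute (sw i j) y) = cherednik (sw i j l) (\<lambda>y. f (permute (sw i j) y)) y
     + ((\<Sum>m\<in>sw i j ` {m. idx l < idx m}. f (permute (sw i j) (permute (sw (sw i j l) m) y)))
      - (\<Sum>m | idx (sw i j l) < idx m. f (permute (sw i j) (permute (sw (sw i j l) m) y)))) / 2"
    by (rule cherednik_at_permute) simp
  have i_notin: "i \<notin> {m. idx j < idx m}" "j \<notin> {m. idx j < idx m}" and fin: "finite {m::'q. idx j < idx m}"
    using ij(1) by auto
  consider "l = i" | "l = j" | "l \<noteq> i" "l \<noteq> j" by blast
  then show ?thesis
  proof cases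
    case 1
    have "sw i j ` {m. idx l < idx m} = insert i {m. idx j < idx m}"
      using 1 above fixed by simp
    then show ?thesis
      unfolding * using 1 i_notin fin
      by (simp add: inv del: permute_permute)
  next
    case 2
    have ji: "j \<noteq> i" using ij by auto
    from above fixed show ?thesis
      unfolding * using 2 i_notin fin ji
      by (simp add: inv del: permute_permute)
  next
    case 3
    have ne: "idx l \<noteq> idx i" "idx l \<noteq> idx j" using 3 by auto
    have "idx l < idx (sw i j m) \<longleftrightarrow> idx l < idx m" for m
      using ij ne by (auto simp: Transposition.transpose_def simp del: idx_eq_iff)
    then have "sw i j ` {m. idx l < idx m} = {m. idx l < idx m}"
      by (auto simp: in_transpose_image_iff)
    then show ?thesis
      unfolding * using 3 by simp
  qed
qed

section \<open>Raising the degree by one\<close>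

definition last_index :: "'q::finite" where
  "last_index = (THE i. Suc (idx i) = CARD('q))"

definition next_index :: "'q::finite \<Rightarrow> 'q" where
  "next_index i = (THE j. idx j = Suc (idx i) mod CARD('q))"

lemma ex1_idx: "n < CARD('q) \<Longrightarrow> \<exists>!i::'q::finite. idx i = n"
  using bij_idx[where 'q = 'q] by (metis (mono_tags) bij_betw_imp_surj_on idx_eq_iff imageE lessThan_iff)

lemma idx_last: "Suc (idx (last_index :: 'q::finite)) = CARD('q)"
proof -
  have "\<exists>!i::'q. idx i = CARD('q) - 1"
    by (rule ex1_idx) simp
  then have "\<exists>!i::'q. Suc (idx i) = CARD('q)"
    by (simp add: Suc_diff_1 eq_diff_iff nat_eq_iff) (metis One_nat_def Suc_pred diff_Suc_1 zero_less_card_finite)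
  then show ?thesis
    unfolding last_index_def by (rule theI')
qed

lemma idx_next: "idx (next_index i :: 'q::finite) = Suc (idx i) mod CARD('q)"
  unfolding next_index_def by (rule theI', rule ex1_idx) simp

lemma idx_less_last: "i \<noteq> last_index \<Longrightarrow> idx (i::'q::finite) < idx (last_index :: 'q)"
  using idx_less[of i] idx_last[where 'q = 'q] idx_eq_iff[of i last_index] by linarith

lemma not_idx_last_less [simp]: "\<not> idx (last_index :: 'q::finite) < idx (j :: 'q)"
  using idx_less_last[of j] by (cases "j = last_index") auto

lemma idx_next_other: "i \<noteq> last_index \<Longrightarrow> idx (next_index i) = Suc (idx i)"
  for i :: "'q::finite"
  using idx_less_last[of i] idx_last[where 'q = 'q] by (simp add: idx_next)

lemma idx_next_last: "idx (next_index (last_index :: 'q::finite)) = 0"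
  by (simp add: idx_next idx_last)

lemma idx_less_next: "i \<noteq> last_index \<Longrightarrow> idx (next_index i) < idx (next_index j) \<longleftrightarrow> idx i < idx j \<and> j \<noteq> last_index"
  for i j :: "'q::finite"
  using idx_next_other[of i] idx_next_other[of j] idx_next_last[where 'q = 'q] by (cases "j = last_index") auto

lemma idx_next_last_less: "idx (next_index (last_index :: 'q::finite)) < idx (next_index j) \<longleftrightarrow> j \<noteq> (last_index :: 'q)"
  using idx_next_other[of j] idx_next_last[where 'q = 'q] by (cases "j = last_index") auto

lemma bij_next: "bij (next_index :: 'q::finite \<Rightarrow> 'q)"
proof -
  have "inj (next_index :: 'q \<Rightarrow> 'q)"
  proof (rule injI)
    fix i j :: 'q assume "next_index i = next_index j"
    then have "idx (next_index i) = idx (next_index j)" by simp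
    then show "i = j"
      using idx_next_other[of i] idx_next_other[of j] idx_next_last[where 'q = 'q]
      by (metis idx_eq_iff nat.inject nat.distinct(1))
  qed
  then show ?thesis
    using finite_UNIV_inj_surj[of "next_index :: 'q \<Rightarrow> 'q"] by (simp add: bij_def)
qed

abbreviation prev_index :: "'q::finite \<Rightarrow> 'q" where
  "prev_index \<equiv> inv next_index"

lemma prev_next [simp]: "prev_index (next_index i) = i"
  by (simp add: bij_is_inj[OF bij_next])

lemma next_prev [simp]: "next_index (prev_index i) = i"
  by (simp add: bij_is_surj[OF bij_next] surj_f_inv_f)

lemma bij_prev: "bij (prev_index :: 'q::finite \<Rightarrow> 'q)"
  by (rule bij_imp_bij_inv[OF bij_next])

text \<open>The operator of Knop and Sahi that produces nonsymmetric Jack polynomials of the next degree.\<close>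

definition raise :: "(real^'q::finite \<Rightarrow> real) \<Rightarrow> real^'q \<Rightarrow> real" where
  "raise f y = y $ last_index * f (permute prev_index y)"

text \<open>The product rule.  Besides the product of \<open>y $ last_index\<close> with the operator, the divided differences contribute
  the values of \<open>g\<close> at reflected points: all of them for the last index, and one for any other index.\<close>

lemma cherednik_mult_last:
  fixes i :: "'q::finite"
  assumes f: "is_form k g" and y: "generic y"
  shows "cherednik i (\<lambda>y. y $ last_index * g y) y =
    (if i = last_index
     then y $ i * (g y + cherednik i g y + (\<Sum>j\<in>UNIV - {i}. g (permute (sw i j) y)) / 2)
     else y $ last_index * (cherednik i g y - g (permute (sw i last_index) y) / 2))"
proof (cases "i = last_index")
  case True
  have none: "{j::'q. idx i < idx j} = {}"
    using True by simp
  have "(\<Sum>j\<in>UNIV - {i}. y $ i * (y $ i * g y - y $ j * g (permute (sw i j) y)) / (y $ i - y $ j))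
     = (\<Sum>j\<in>UNIV - {i}. y $ i * (y $ i * (g y - g (permute (sw i j) y)) / (y $ i - y $ j)) + y $ i * g (permute (sw i j) y))"
  proof (rule sum.cong)
    fix j assume "j \<in> UNIV - {i}"
    then have "y $ i - y $ j \<noteq> 0"
      using y by (auto simp: generic_nth_eq_iff)
    then show "y $ i * (y $ i * g y - y $ j * g (permute (sw i j) y)) / (y $ i - y $ j)
      = y $ i * (y $ i * (g y - g (permute (sw i j) y)) / (y $ i - y $ j)) + y $ i * g (permute (sw i j) y)"
      by (simp add: field_simps)
  qed simp
  also have "\<dots> = y $ i * (\<Sum>j\<in>UNIV - {i}. y $ i * (g y - g (permute (sw i j) y)) / (y $ i - y $ j))
      + y $ i * (\<Sum>j\<in>UNIV - {i}. g (permute (sw i j) y))"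
    by (simp add: sum.distrib sum_distrib_left)
  finally have eq: "(\<Sum>j\<in>UNIV - {i}. y $ i * (y $ i * g y - y $ j * g (permute (sw i j) y)) / (y $ i - y $ j)) = \<dots>" .
  show ?thesis
    using True unfolding cherednik_def partial_deriv_mult_var[OF f] none
    by (simp add: eq[unfolded True]) (simp add: algebra_simps)
next
  case False
  let ?w = "last_index :: 'q"
  have y0: "y $ i - y $ ?w \<noteq> 0"
    using y False by (auto simp: generic_nth_eq_iff)
  have "(\<Sum>j\<in>UNIV - {i}. y $ i * (y $ ?w * g y - y $ sw i j ?w * g (permute (sw i j) y)) / (y $ i - y $ j))
     = (\<Sum>j\<in>UNIV - {i}. y $ ?w * (y $ i * (g y - g (permute (sw i j) y)) / (y $ i - y $ j))
          - (if j = ?w then y $ i * g (permute (sw i ?w) y) else 0))"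
  proof (rule sum.cong)
    fix j assume j: "j \<in> UNIV - {i}"
    then have "y $ i - y $ j \<noteq> 0"
      using y by (auto simp: generic_nth_eq_iff)
    then show "y $ i * (y $ ?w * g y - y $ sw i j ?w * g (permute (sw i j) y)) / (y $ i - y $ j)
      = y $ ?w * (y $ i * (g y - g (permute (sw i j) y)) / (y $ i - y $ j))
          - (if j = ?w then y $ i * g (permute (sw i ?w) y) else 0)"
      using False by (cases "j = ?w") (auto simp: field_simps)
  qed simp
  also have "\<dots> = y $ ?w * (\<Sum>j\<in>UNIV - {i}. y $ i * (g y - g (permute (sw i j) y)) / (y $ i - y $ j))
      - y $ i * g (permute (sw i ?w) y)"
    using False by (simp add: sum_subtractf sum_distrib_left)
  finally have eq1: "(\<Sum>j\<in>UNIV - {i}. y $ i * (y $ ?w * g y - y $ sw i j ?w * g (permute (sw i j) y)) / (y $ i - y $ j)) = \<dots>" .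
  have "(\<Sum>j | idx i < idx j. y $ sw i j ?w * g (permute (sw i j) y))
     = (\<Sum>j | idx i < idx j. y $ ?w * g (permute (sw i j) y)
         + (if j = ?w then (y $ i - y $ ?w) * g (permute (sw i ?w) y) else 0))"
    using False by (intro sum.cong) (auto simp: algebra_simps)
  also have "\<dots> = y $ ?w * (\<Sum>j | idx i < idx j. g (permute (sw i j) y))
      + (y $ i - y $ ?w) * g (permute (sw i ?w) y)"
    using False idx_less_last[of i] by (simp add: sum.distrib sum_distrib_left)
  finally have eq2: "(\<Sum>j | idx i < idx j. y $ sw i j ?w * g (permute (sw i j) y)) = \<dots>" .
  show ?thesis
    using False unfolding cherednik_def partial_deriv_mult_var[OF f] permute_nth eq1 eq2
    by (simp add: field_simps)
qed

text \<open>The reflected values in \<open>cherednik_mult_last\<close> are exactly those by which the cyclic shift of the variables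
  changes the last sum of the operator, so that they cancel.\<close>

lemma cherednik_raise:
  fixes i :: "'q::finite"
  assumes f: "is_form k f" and y: "generic y"
  shows "cherednik i (raise f) y =
    y $ last_index * (cherednik (next_index i) f (permute prev_index y)
      + (if i = last_index then f (permute prev_index y) else 0))"
proof -
  let ?w = "last_index :: 'q"
  define g where "g = (\<lambda>y. f (permute prev_index y))"
  have g: "is_form k g"
    unfolding g_def by (intro is_form_permute f bij_prev)
  have eq: "cherednik (next_index i) f (permute prev_index y) = cherednik i g y
     + ((\<Sum>m\<in>prev_index ` {m. idx (next_index i) < idx m}. g (permute (sw i m) y))
      - (\<Sum>m | idx i < idx m. g (permute (sw i m) y))) / 2"
    using cherednik_at_permute[OF bij_prev, of "next_index i" f y] by (simp add: g_def)
  have mem: "m \<in> prev_index ` {m. idx (next_index i) < idx m} \<longleftrightarrow> idx (next_index i) < idx (next_index m)" for m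
    by (metis (mono_tags, lifting) image_iff mem_Collect_eq next_prev prev_next)
  have raise: "raise f = (\<lambda>y. y $ ?w * g y)"
    by (simp add: raise_def g_def fun_eq_iff)
  show ?thesis
  proof (cases "i = ?w")
    case True
    have "prev_index ` {m. idx (next_index i) < idx m} = UNIV - {i}"
    proof (rule set_eqI)
      show "m \<in> prev_index ` {m. idx (next_index i) < idx m} \<longleftrightarrow> m \<in> UNIV - {i}" for m
        unfolding mem using True idx_next_last_less[of m] by simp
    qed
    moreover have "{m::'q. idx i < idx m} = {}"
      using True by simp
    ultimately show ?thesis
      unfolding raise eq cherednik_mult_last[OF g y] using True by (simp add: g_def algebra_simps)
  next
    case False
    have "idx (next_index i) < idx (next_index m) \<longleftrightarrow> idx i < idx m \<and> m \<noteq> ?w" for m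
      using idx_less_next[OF False] .
    then have "prev_index ` {m. idx (next_index i) < idx m} = {m. idx i < idx m} - {?w}"
      using mem by blast
    then have diff: "(\<Sum>m\<in>prev_index ` {m. idx (next_index i) < idx m}. g (permute (sw i m) y))
      - (\<Sum>m | idx i < idx m. g (permute (sw i m) y)) = - g (permute (sw i ?w) y)"
      using idx_less_last[OF False] by (simp add: sum_diff1)
    show ?thesis
      unfolding raise eq diff cherednik_mult_last[OF g y] using False by (simp add: g_def)
  qed
qed

section \<open>Spectra\<close>

text \<open>The number of these indices is the rank of \<open>i\<close> when the entries of \<open>\<eta>\<close> are sorted increasingly and equal
  entries are counted from the last index to the first.\<close>

definition below :: "('q::finite \<Rightarrow> nat) \<Rightarrow> 'q \<Rightarrow> 'q set" where
  "below \<eta> i = {j. \<eta> j < \<eta> i \<or> \<eta> j = \<eta> i \<and> idx i < idx j}"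

text \<open>The eigenvalues of the Cherednik operators on the nonsymmetric Jack polynomial with leading exponent \<open>\<eta>\<close>.\<close>

definition spectrum :: "('q::finite \<Rightarrow> nat) \<Rightarrow> 'q \<Rightarrow> real" where
  "spectrum \<eta> i = real (\<eta> i) + real (card (below \<eta> i)) / 2"

lemma below_trans: "j \<in> below \<eta> i \<Longrightarrow> l \<in> below \<eta> j \<Longrightarrow> l \<in> below \<eta> i"
  by (auto simp: below_def)

lemma below_irrefl [simp]: "i \<notin> below \<eta> i"
  by (auto simp: below_def)

lemma below_total: "i \<noteq> j \<Longrightarrow> i \<in> below \<eta> j \<or> j \<in> below \<eta> i"
  using idx_eq_iff[of i j] unfolding below_def mem_Collect_eq by linarith

lemma card_below_less:
  assumes "j \<in> below \<eta> i"
  shows "card (below \<eta> j) < card (below \<eta> i)"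
proof (rule psubset_card_mono)
  show "below \<eta> j \<subset> below \<eta> i"
    using assms below_trans[OF assms] below_irrefl[of j \<eta>] by blast
qed simp

text \<open>The ranks differ by at least one, which contributes \<open>1/2\<close>, and the entries by at least one unless they are
  equal.\<close>

lemma spectrum_gap:
  assumes "j \<in> below \<eta> i"
  shows "spectrum \<eta> j + (if \<eta> j = \<eta> i then 1 / 2 else 3 / 2) \<le> spectrum \<eta> i"
proof -
  have "real (card (below \<eta> j)) + 1 \<le> real (card (below \<eta> i))"
    using card_below_less[OF assms] by linarith
  moreover have "\<eta> j = \<eta> i \<or> real (\<eta> j) + 1 \<le> real (\<eta> i)"
    using assms by (auto simp: below_def)
  ultimately show ?thesis
    by (auto simp: spectrum_def)
qed

lemma spectrum_less_iff: "spectrum \<eta> j < spectrum \<eta> i \<longleftrightarrow> j \<in> below \<eta> i"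
proof
  show "j \<in> below \<eta> i \<Longrightarrow> spectrum \<eta> j < spectrum \<eta> i"
    using spectrum_gap[of j \<eta> i] by (auto split: if_splits)
  show "j \<in> below \<eta> i" if "spectrum \<eta> j < spectrum \<eta> i"
  proof (rule ccontr)
    assume "j \<notin> below \<eta> i"
    then have "i = j \<or> i \<in> below \<eta> j"
      using below_total by blast
    then show False
      using that spectrum_gap[of i \<eta> j] by (auto split: if_splits)
  qed
qed

text \<open>The order of the eigenvalues is the order of the ranks, so the spectrum determines the ranks and thereby
  the exponents.\<close>

lemma exponent_of_spectrum:
  "real (\<eta> i) = spectrum \<eta> i - real (card {j. spectrum \<eta> j < spectrum \<eta> i}) / 2"
  by (simp add: spectrum_less_iff) (simp add: spectrum_def)

lemma spectrum_inj:
  assumes "spectrum \<eta> = spectrum \<mu>"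
  shows "\<eta> = \<mu>"
proof
  fix i
  have "real (\<eta> i) = spectrum \<mu> i - real (card {j. spectrum \<mu> j < spectrum \<mu> i}) / 2"
    using exponent_of_spectrum[of \<eta> i] unfolding assms .
  also have "\<dots> = real (\<mu> i)"
    by (rule exponent_of_spectrum[symmetric])
  finally have "real (\<eta> i) = real (\<mu> i)" .
  then show "\<eta> i = \<mu> i" by (simp only: of_nat_eq_iff)
qed

lemma spectrum_neq: "i \<noteq> j \<Longrightarrow> spectrum \<eta> i \<noteq> spectrum \<eta> j"
  using below_total[of i j \<eta>] spectrum_less_iff[of \<eta> i j] spectrum_less_iff[of \<eta> j i] by linarith

lemma spectrum_gap_abs:
  assumes "\<eta> i \<noteq> \<eta> j"
  shows "1 / 2 < \<bar>spectrum \<eta> i - spectrum \<eta> j\<bar>"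
proof -
  have "i \<noteq> j" using assms by auto
  then show ?thesis
    using below_total[of i j \<eta>] spectrum_gap[of i \<eta> j] spectrum_gap[of j \<eta> i] assms by auto
qed

lemma idx_less_swap:
  assumes "adjacent i j" "{l, m} \<noteq> {i, j}"
  shows "idx (sw i j l) < idx (sw i j m) \<longleftrightarrow> idx l < idx m"
proof -
  have ij: "idx j = Suc (idx i)" "i \<noteq> j" using assms(1) by (auto simp: adjacent_def)
  have l: "l = i \<or> l = j \<or> idx l \<noteq> idx i \<and> idx l \<noteq> idx j" by auto
  have m: "m = i \<or> m = j \<or> idx m \<noteq> idx i \<and> idx m \<noteq> idx j" by auto
  consider "l = m" | "l = i" "m \<noteq> i" "m \<noteq> j" | "l = j" "m \<noteq> i" "m \<noteq> j"
    | "m = i" "l \<noteq> i" "l \<noteq> j" | "m = j" "l \<noteq> i" "l \<noteq> j" | "l \<noteq> i" "l \<noteq> j" "m \<noteq> i" "m \<noteq> j"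
    using assms(2) by auto
  then show ?thesis
  proof cases
    case 2 then have "sw i j l = j" "sw i j m = m" by auto
    then show ?thesis using 2 ij(1) m by (simp del: idx_eq_iff) linarith
  next
    case 3 then have "sw i j l = i" "sw i j m = m" by auto
    then show ?thesis using 3 ij(1) m by (simp del: idx_eq_iff) linarith
  next
    case 4 then have "sw i j l = l" "sw i j m = j" by auto
    then show ?thesis using 4 ij(1) l by (simp del: idx_eq_iff) linarith
  next
    case 5 then have "sw i j l = l" "sw i j m = i" by auto
    then show ?thesis using 5 ij(1) l by (simp del: idx_eq_iff) linarith
  qed auto
qed

lemma below_swap:
  assumes "adjacent i j" "\<eta> i \<noteq> \<eta> j"
  shows "below (\<eta> \<circ> sw i j) l = sw i j ` below \<eta> (sw i j l)"
proof -
  have "m \<in> below (\<eta> \<circ> sw i j) l \<longleftrightarrow> sw i j m \<in> below \<eta> (sw i j l)" for m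
  proof (cases "\<eta> (sw i j m) = \<eta> (sw i j l)")
    case True
    then have "{l, m} \<noteq> {i, j}"
      using assms(2) by (auto simp: doubleton_eq_iff)
    from idx_less_swap[OF assms(1) this] True show ?thesis
      by (simp add: below_def)
  qed (simp add: below_def)
  then show ?thesis
    by (simp add: set_eq_iff in_transpose_image_iff)
qed

lemma card_sw_image [simp]: "card (sw i j ` A) = card A"
  by (rule card_image) (metis inj_onI transpose_involutory)

lemma spectrum_swap:
  assumes "adjacent i j" "\<eta> i \<noteq> \<eta> j"
  shows "spectrum (\<eta> \<circ> sw i j) = spectrum \<eta> \<circ> sw i j"
  by (rule ext) (simp add: spectrum_def below_swap[OF assms])

text \<open>A spectrum that is swapped at two equal exponents is not a spectrum.  This is what makes the corrected form in
  \<open>eigenform_swap\<close> vanish for equal exponents.\<close>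

lemma spectrum_neq_swap:
  assumes "i \<noteq> j" "\<eta> i = \<eta> j"
  shows "spectrum \<mu> \<noteq> spectrum \<eta> \<circ> sw i j"
proof
  assume eq: "spectrum \<mu> = spectrum \<eta> \<circ> sw i j"
  have "\<mu> l = \<eta> l" for l
  proof -
    have "{m. spectrum \<eta> (sw i j m) < spectrum \<eta> (sw i j l)} = sw i j ` {m. spectrum \<eta> m < spectrum \<eta> (sw i j l)}"
      by (auto simp: in_transpose_image_iff)
    then have "real (\<mu> l) = spectrum \<eta> (sw i j l) - real (card {m. spectrum \<eta> m < spectrum \<eta> (sw i j l)}) / 2"
      using exponent_of_spectrum[of \<mu> l] by (simp add: eq)
    then have "real (\<mu> l) = real (\<eta> (sw i j l))"
      using exponent_of_spectrum[of \<eta> "sw i j l"] by simp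
    then show ?thesis
      using assms(2) by (auto simp: Transposition.transpose_def split: if_splits)
  qed
  then have "\<mu> = \<eta>" by auto
  then have "spectrum \<eta> i = spectrum \<eta> j"
    using fun_cong[OF eq, of i] by simp
  then show False
    using spectrum_neq[OF assms(1)] by blast
qed

definition raise_exp :: "('q::finite \<Rightarrow> nat) \<Rightarrow> 'q \<Rightarrow> nat" where
  "raise_exp \<eta> i = \<eta> (next_index i) + (if i = last_index then 1 else 0)"

text \<open>The ranks move along with the entries.  The first entry is already ranked above all its equals; once it has been
  increased and moved to the end it is ranked below the entries with which it has drawn level.\<close>

lemma spectrum_raise:
  fixes \<eta> :: "'q::finite \<Rightarrow> nat"
  shows "spectrum (raise_exp \<eta>) i = spectrum \<eta> (next_index i) + (if i = last_index then 1 else 0)"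
proof -
  have mem: "j \<in> below (raise_exp \<eta>) i \<longleftrightarrow> next_index j \<in> below \<eta> (next_index i)" for j
  proof (cases "i = last_index")
    case True
    have "\<not> idx i < idx j"
      using True by simp
    then show ?thesis
      using True idx_next_last_less[of j] by (auto simp: below_def raise_exp_def)
  next
    case False
    then show ?thesis
      using idx_less_next[OF False, of j] idx_less_last[OF False] by (auto simp: below_def raise_exp_def)
  qed
  then have "below (raise_exp \<eta>) i = next_index -` below \<eta> (next_index i)"
    by auto
  moreover have "card (next_index -` below \<eta> (next_index i)) = card (below \<eta> (next_index i))"
    by (rule card_vimage_inj[OF bij_is_inj[OF bij_next]]) (simp add: bij_is_surj[OF bij_next])
  ultimately show ?thesis
    by (simp add: spectrum_def raise_exp_def)
qed

lemma raise_exp_exponents: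
  assumes "\<eta> \<in> exponents k"
  shows "raise_exp \<eta> \<in> exponents (Suc k)"
proof -
  have "(\<Sum>i\<in>UNIV. \<eta> (next_index i)) = (\<Sum>i\<in>UNIV. \<eta> i)"
    by (rule sum.reindex_bij_betw[OF bij_next])
  then show ?thesis
    using assms by (simp add: exponents_def raise_exp_def sum.distrib)
qed

section \<open>Triangularity\<close>

text \<open>The dominance order of the decreasing rearrangements, phrased without sorting.\<close>

definition dom :: "('q::finite \<Rightarrow> nat) \<Rightarrow> ('q \<Rightarrow> nat) \<Rightarrow> bool" where
  "dom b a \<longleftrightarrow> (\<forall>J. \<exists>J'. card J' = card J \<and> (\<Sum>i\<in>J. b i) \<le> (\<Sum>i\<in>J'. a i))"

definition sqnorm :: "('q::finite \<Rightarrow> nat) \<Rightarrow> nat" where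
  "sqnorm a = (\<Sum>i\<in>UNIV. (a i)\<^sup>2)"

definition moment :: "('q::finite \<Rightarrow> nat) \<Rightarrow> nat" where
  "moment a = (\<Sum>i\<in>UNIV. idx i * a i)"

text \<open>The order in which the Cherednik operators are triangular.  Moving units from a larger entry to a smaller
  one decreases the sum of squares as long as it does not merely exchange the two, and among the rearrangements of one vector those with large entries at early indices
  are higher.\<close>

definition lower :: "('q::finite \<Rightarrow> nat) \<Rightarrow> ('q \<Rightarrow> nat) \<Rightarrow> bool" where
  "lower b a \<longleftrightarrow> dom b a \<and> (sqnorm b < sqnorm a \<or> sqnorm b = sqnorm a \<and> moment a < moment b)"

lemma dom_refl: "dom a a"
  by (auto simp: dom_def)

lemma dom_trans: "dom a b \<Longrightarrow> dom b c \<Longrightarrow> dom a c"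
  unfolding dom_def by (metis order_trans)

lemma lower_trans: "lower a b \<Longrightarrow> lower b c \<Longrightarrow> lower a c"
  unfolding lower_def using dom_trans[of a b c] by auto

lemma lower_irrefl: "\<not> lower a a"
  by (simp add: lower_def)

lemma sqnorm_comp: "bij \<pi> \<Longrightarrow> sqnorm (a \<circ> \<pi>) = sqnorm a"
  unfolding sqnorm_def using sum.reindex_bij_betw[of \<pi> UNIV UNIV "\<lambda>i. (a i)\<^sup>2"] by (simp add: bij_betw_def)

lemma dom_comp: "bij \<pi> \<Longrightarrow> dom (a \<circ> \<pi>) a"
  unfolding dom_def
proof
  fix J :: "'a set" assume "bij \<pi>"
  then have "inj_on \<pi> J" by (meson bij_is_inj inj_on_subset subset_UNIV)
  then show "\<exists>J'. card J' = card J \<and> (\<Sum>i\<in>J. (a \<circ> \<pi>) i) \<le> (\<Sum>i\<in>J'. a i)"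
    by (intro exI[of _ "\<pi> ` J"]) (simp add: card_image sum.reindex)
qed

lemma moment_swap:
  assumes "i \<noteq> j"
  shows "int (moment (a \<circ> sw i j)) = int (moment a) + (int (idx i) - int (idx j)) * (int (a j) - int (a i))"
proof -
  have split: "(\<Sum>l\<in>UNIV. f l) = f i + f j + (\<Sum>l\<in>UNIV - {i, j}. f l)" for f :: "'a \<Rightarrow> nat"
    using assms by (subst sum.subset_diff[of "{i, j}"]) auto
  have "(\<Sum>l\<in>UNIV - {i, j}. idx l * a (sw i j l)) = (\<Sum>l\<in>UNIV - {i, j}. idx l * a l)"
    by (intro sum.cong) auto
  then show ?thesis
    unfolding moment_def split by (simp add: algebra_simps)
qed

lemma lower_swap:
  assumes "idx i < idx j" "a j < a i"
  shows "lower (a \<circ> sw i j) a"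
proof -
  have "i \<noteq> j" using assms by auto
  moreover have "(int (idx i) - int (idx j)) * (int (a j) - int (a i)) > 0"
    using assms by (intro mult_neg_neg) auto
  ultimately have "moment a < moment (a \<circ> sw i j)"
    using moment_swap[of i j a] by linarith
  then show ?thesis
    by (simp add: lower_def dom_comp sqnorm_comp)
qed

definition move :: "('q \<Rightarrow> nat) \<Rightarrow> 'q \<Rightarrow> 'q \<Rightarrow> nat \<Rightarrow> 'q \<Rightarrow> nat" where
  "move a i j r = a(i := a i - r, j := a j + r)"

text \<open>If \<open>J\<close> contains only one of \<open>i\<close> and \<open>j\<close>, its entry there is at most \<open>a i\<close>, so the set with \<open>i\<close> in place
  of \<open>j\<close> has at least the same total.\<close>

lemma dom_move:
  assumes "i \<noteq> j" "r \<le> a i - a j" "a j \<le> a i"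
  shows "dom (move a i j r) a"
  unfolding dom_def
proof
  fix J :: "'a set"
  let ?b = "move a i j r"
  have cong: "sum ?b K = sum a K" if "i \<notin> K" "j \<notin> K" for K
    using that by (intro sum.cong) (auto simp: move_def)
  have rem: "sum f K = f l + sum f (K - {l})" if "l \<in> K" for l and f :: "'a \<Rightarrow> nat" and K
    using that by (subst sum.remove[of K l]) auto
  have b: "?b i = a i - r" "?b j = a j + r" "r \<le> a i"
    using assms by (auto simp: move_def)
  show "\<exists>J'. card J' = card J \<and> sum ?b J \<le> sum a J'"
  proof (cases "j \<in> J \<and> i \<notin> J")
    case True
    have "sum ?b J = a j + r + sum a (J - {j})"
      using True b rem[of j J ?b] cong[of "J - {j}"] by simp
    also have "\<dots> \<le> sum a (insert i (J - {j}))"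
      using True assms by (subst sum.insert) auto
    finally show ?thesis
      using True by (intro exI[of _ "insert i (J - {j})"]) (simp add: card_Suc_Diff1 del: card_Diff_insert card_Diff_singleton)
  next
    case False
    have "sum ?b J \<le> sum a J"
    proof (cases "i \<in> J")
      case i: True
      show ?thesis
      proof (cases "j \<in> J")
        case True
        then have "sum ?b J = a i + a j + sum a (J - {i} - {j})"
          using i b assms(1) rem[of i J ?b] rem[of j "J - {i}" ?b] cong[of "J - {i} - {j}"] by simp
        then show ?thesis
          using i True assms(1) rem[of i J a] rem[of j "J - {i}" a] by simp
      next
        case False
        then show ?thesis
          using i b rem[of i J ?b] rem[of i J a] cong[of "J - {i}"] by simp
      qed
    next
      case i: False
      then show ?thesis
        using False cong[of J] by simp
    qed
    then show ?thesis by blast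
  qed
qed

lemma sum_remove2:
  fixes f :: "'q::finite \<Rightarrow> 'b::comm_monoid_add"
  assumes "i \<noteq> j"
  shows "(\<Sum>l\<in>UNIV. f l) = f i + f j + (\<Sum>l\<in>UNIV - {i, j}. f l)"
  using assms by (subst sum.subset_diff[of "{i, j}"]) (auto simp: add.commute)

lemma prod_remove2:
  fixes f :: "'q::finite \<Rightarrow> 'b::comm_monoid_mult"
  assumes "i \<noteq> j"
  shows "(\<Prod>l\<in>UNIV. f l) = f i * f j * (\<Prod>l\<in>UNIV - {i, j}. f l)"
  using assms by (subst prod.subset_diff[of "{i, j}"]) (auto simp: mult.commute)

lemma move_exponents:
  assumes "i \<noteq> j" "r \<le> a i" "a \<in> exponents k"
  shows "move a i j r \<in> exponents k"
proof -
  have "(\<Sum>l\<in>UNIV - {i, j}. move a i j r l) = (\<Sum>l\<in>UNIV - {i, j}. a l)"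
    by (intro sum.cong) (auto simp: move_def)
  moreover have "move a i j r i = a i - r" "move a i j r j = a j + r"
    using assms(1) by (auto simp: move_def)
  ultimately show ?thesis
    using assms sum_remove2[OF assms(1), of a] sum_remove2[OF assms(1), of "move a i j r"]
    by (simp add: exponents_def)
qed

lemma sqnorm_move:
  assumes "i \<noteq> j" "0 < r" "r < a i - a j"
  shows "sqnorm (move a i j r) < sqnorm a"
proof -
  have eq: "(\<Sum>l\<in>UNIV - {i, j}. (move a i j r l)\<^sup>2) = (\<Sum>l\<in>UNIV - {i, j}. (a l)\<^sup>2)"
    by (intro sum.cong) (auto simp: move_def)
  have b: "move a i j r i = a i - r" "move a i j r j = a j + r"
    using assms(1) by (auto simp: move_def)
  obtain d where d: "a i = a j + r + d" "d > 0"
    using assms(2,3) by (metis add.assoc less_imp_add_positive less_diff_conv add.commute)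
  have "(a i - r)\<^sup>2 + (a j + r)\<^sup>2 < (a i)\<^sup>2 + (a j)\<^sup>2"
    using assms(2) d by (simp add: power2_eq_square algebra_simps)
  then show ?thesis
    unfolding sqnorm_def sum_remove2[OF assms(1)] eq b by simp
qed

lemma lower_move:
  assumes "i \<noteq> j" "0 < r" "r < a i - a j"
  shows "lower (move a i j r) a"
  using dom_move[of i j r a] sqnorm_move[OF assms] assms by (simp add: lower_def)

definition triangular :: "nat \<Rightarrow> ('q::finite \<Rightarrow> nat) \<Rightarrow> real \<Rightarrow> (real^'q \<Rightarrow> real) \<Rightarrow> bool" where
  "triangular k a r F \<longleftrightarrow> (\<exists>m. (\<forall>y. generic y \<longrightarrow> F y = form k m y) \<and> m a = r \<and>
     (\<forall>b\<in>exponents k. b \<noteq> a \<longrightarrow> m b \<noteq> 0 \<longrightarrow> lower b a))"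

lemma triangular_add:
  assumes "triangular k a r F" "triangular k a s G"
  shows "triangular k a (r + s) (\<lambda>y. F y + G y)"
proof -
  obtain m n where "\<forall>y. generic y \<longrightarrow> F y = form k m y" "m a = r"
      "\<forall>b\<in>exponents k. b \<noteq> a \<longrightarrow> m b \<noteq> 0 \<longrightarrow> lower b a"
      "\<forall>y. generic y \<longrightarrow> G y = form k n y" "n a = s"
      "\<forall>b\<in>exponents k. b \<noteq> a \<longrightarrow> n b \<noteq> 0 \<longrightarrow> lower b a"
    using assms unfolding triangular_def by blast
  then show ?thesis
    unfolding triangular_def by (intro exI[of _ "\<lambda>b. m b + n b"]) (auto simp: form_add)
qed

lemma triangular_scale:
  assumes "triangular k a r F"
  shows "triangular k a (s * r) (\<lambda>y. s * F y)"
proof -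
  obtain m where "\<forall>y. generic y \<longrightarrow> F y = form k m y" "m a = r"
      "\<forall>b\<in>exponents k. b \<noteq> a \<longrightarrow> m b \<noteq> 0 \<longrightarrow> lower b a"
    using assms unfolding triangular_def by blast
  then show ?thesis
    unfolding triangular_def by (intro exI[of _ "\<lambda>b. s * m b"]) (auto simp: form_scale)
qed

lemma triangular_zero: "triangular k a 0 (\<lambda>y. 0)"
  unfolding triangular_def by (intro exI[of _ "\<lambda>b. 0"]) (auto simp: form_def)

lemma triangular_sum:
  assumes "finite I" "\<And>i. i \<in> I \<Longrightarrow> triangular k a (r i) (F i)"
  shows "triangular k a (\<Sum>i\<in>I. r i) (\<lambda>y. \<Sum>i\<in>I. F i y)"
  using assms by (induction I rule: finite_induct) (auto intro: triangular_zero triangular_add)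

lemma triangular_cong:
  "triangular k a r F \<Longrightarrow> (\<And>y. generic y \<Longrightarrow> G y = F y) \<Longrightarrow> r = s \<Longrightarrow> triangular k a s G"
  unfolding triangular_def by auto

lemma triangular_self: "a \<in> exponents k \<Longrightarrow> triangular k a 1 (monom_at a)"
  unfolding triangular_def by (intro exI[of _ "\<lambda>b. if b = a then 1 else 0"]) (auto simp: monom_at_eq_form)

lemma triangular_lower:
  assumes "b \<in> exponents k" "lower b a"
  shows "triangular k a 0 (monom_at b)"
  using assms lower_irrefl[of a]
  unfolding triangular_def by (intro exI[of _ "\<lambda>c. if c = b then 1 else 0"]) (auto simp: monom_at_eq_form)

lemma monom_at_permute_sw: "monom_at a (permute (sw i j) y) = monom_at (a \<circ> sw i j) y"
  using monom_at_permute[of "sw i j" "a \<circ> sw i j" y] by (simp add: comp_assoc)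

text \<open>A geometric sum in which one unit after the other moves from \<open>i\<close> to \<open>j\<close>.\<close>

lemma divided_difference_monom:
  assumes "i \<noteq> j" "a j \<le> a i"
  shows "y $ i * (monom_at a y - monom_at (a \<circ> sw i j) y)
    = (y $ i - y $ j) * (\<Sum>r<a i - a j. monom_at (move a i j r) y)"
proof -
  define R where "R = (\<Prod>l\<in>UNIV - {i, j}. y $ l ^ a l)"
  define d n where "d = a i - a j" and "n = a j"
  have ai: "a i = n + d" "a j = n"
    using assms(2) by (auto simp: d_def n_def)
  have 1: "monom_at a y = y $ i ^ (n + d) * y $ j ^ n * R"
    unfolding monom_at_def prod_remove2[OF assms(1)] R_def by (simp add: ai)
  have "(\<Prod>l\<in>UNIV - {i, j}. y $ l ^ a (sw i j l)) = R"
    unfolding R_def by (intro prod.cong) auto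
  then have 2: "monom_at (a \<circ> sw i j) y = y $ i ^ n * y $ j ^ (n + d) * R"
    unfolding monom_at_def prod_remove2[OF assms(1)] by (simp add: ai)
  have 3: "monom_at (move a i j r) y = y $ i ^ n * y $ j ^ n * R * (y $ i * (y $ i ^ (d - Suc r) * y $ j ^ r))"
    if "r < d" for r
  proof -
    have "(\<Prod>l\<in>UNIV - {i, j}. y $ l ^ move a i j r l) = R"
      unfolding R_def by (intro prod.cong) (auto simp: move_def)
    moreover have "y $ i ^ (n + d - r) = y $ i ^ n * (y $ i * y $ i ^ (d - Suc r))"
      using that by (simp flip: power_add power_Suc add: Suc_diff_Suc)
    ultimately show ?thesis
      unfolding monom_at_def prod_remove2[OF assms(1)] using assms(1)
      by (simp add: move_def ai power_add)
  qed
  define S where "S = (\<Sum>r<d. y $ i ^ (d - Suc r) * y $ j ^ r)"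
  have key: "y $ i ^ d - y $ j ^ d = (y $ i - y $ j) * S"
    using power_diff_sumr2[of "y $ j" d "y $ i"] by (simp add: S_def algebra_simps)
  have sum: "(\<Sum>r<d. monom_at (move a i j r) y) = y $ i ^ n * y $ j ^ n * R * (y $ i * S)"
    by (simp add: 3 S_def sum_distrib_left)
  have "y $ i * (monom_at a y - monom_at (a \<circ> sw i j) y)
      = y $ i ^ n * y $ j ^ n * R * y $ i * (y $ i ^ d - y $ j ^ d)"
    unfolding 1 2 by (simp add: power_add algebra_simps)
  then show ?thesis
    unfolding d_def[symmetric] sum key by (simp add: algebra_simps)
qed

text \<open>The inner terms of the geometric sum are lower than \<open>y^a\<close>; the first one is \<open>y^a\<close> itself if \<open>a j < a i\<close>, and
  the swapped monomial if \<open>a i < a j\<close>.  In the latter case the swapped monomial is higher than \<open>y^a\<close> if \<open>i\<close> comes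
  before \<open>j\<close>, and then the reflection in the second summand cancels it.\<close>

lemma triangular_pair:
  assumes "i \<noteq> j" "a \<in> exponents k"
  shows "triangular k a (of_bool (j \<in> below a i))
    (\<lambda>y. y $ i * (monom_at a y - monom_at (a \<circ> sw i j) y) / (y $ i - y $ j)
       + (if idx i < idx j then monom_at (a \<circ> sw i j) y else 0))"
    (is "triangular _ _ _ ?P")
proof -
  let ?a' = "a \<circ> sw i j"
  have a': "?a' \<in> exponents k" "?a' i = a j" "?a' j = a i" "?a' \<circ> sw i j = a"
    using assms by (auto simp: exponents_comp comp_assoc)
  have idx_neq: "idx i < idx j \<or> idx j < idx i"
    using assms(1) idx_eq_iff[of i j] by linarith
  have y: "y $ i - y $ j \<noteq> 0" if "generic y" for y
    using that assms(1) by (auto simp: generic_nth_eq_iff)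
  have swap: "triangular k a 0 (\<lambda>y. if idx i < idx j then monom_at ?a' y else 0)" if "a j < a i"
    using triangular_lower[OF a'(1) lower_swap[of i j a]] that triangular_zero by (cases "idx i < idx j") simp_all
  consider "a j < a i" | "a j = a i" | "a i < a j" by linarith
  then show ?thesis
  proof cases
    case 1
    have "triangular k a (\<Sum>r<a i - a j. if r = 0 then 1 else 0) (\<lambda>y. \<Sum>r<a i - a j. monom_at (move a i j r) y)"
    proof (rule triangular_sum)
      fix r assume r: "r \<in> {..<a i - a j}"
      show "triangular k a (if r = 0 then 1 else 0) (monom_at (move a i j r))"
      proof (cases "r = 0")
        case True
        then show ?thesis using triangular_self[OF assms(2)] by (simp add: move_def)
      next
        case False
        then show ?thesis
          using r assms by (auto intro!: triangular_lower move_exponents lower_move)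
      qed
    qed simp
    from triangular_add[OF this swap[OF 1]] show ?thesis
    proof (rule triangular_cong)
      fix y :: "real^'a" assume "generic y"
      then show "?P y = (\<Sum>r<a i - a j. monom_at (move a i j r) y) + (if idx i < idx j then monom_at ?a' y else 0)"
        using 1 y divided_difference_monom[of i j a y] assms(1) by simp
    qed (use 1 in \<open>simp add: below_def\<close>)
  next
    case 2
    then have "?a' = a"
      by (auto simp: fun_eq_iff Transposition.transpose_def)
    then show ?thesis
      using 2 triangular_self[OF assms(2)] triangular_zero by (auto simp: below_def)
  next
    case 3
    have move0: "move ?a' i j 0 = ?a'"
      by (auto simp: move_def fun_eq_iff Transposition.transpose_def)
    define s :: real where "s = (if idx i < idx j then 0 else 1)"
    have tri0: "triangular k a 0 (\<lambda>y. s * monom_at ?a' y)"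
    proof (cases "idx i < idx j")
      case True
      then show ?thesis by (simp add: s_def triangular_zero)
    next
      case False
      then have "lower ?a' a"
        using lower_swap[of j i a] 3 idx_neq by (simp add: transpose_commute)
      from triangular_scale[OF triangular_lower[OF a'(1) this], of s] show ?thesis by simp
    qed
    have "triangular k a (\<Sum>r\<in>{..<a j - a i} - {0}. 0) (\<lambda>y. \<Sum>r\<in>{..<a j - a i} - {0}. monom_at (move ?a' i j r) y)"
    proof (rule triangular_sum)
      fix r assume r: "r \<in> {..<a j - a i} - {0}"
      have lt: "r < ?a' i - ?a' j" "0 < r" using r a' by auto
      have "sqnorm (move ?a' i j r) < sqnorm a" "dom (move ?a' i j r) a"
        using sqnorm_move[of i j r ?a'] dom_move[of i j r ?a'] dom_comp[of "sw i j" a] dom_trans lt assms(1) 3 a'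
        by (auto simp: sqnorm_comp)
      then show "triangular k a 0 (monom_at (move ?a' i j r))"
        using lt assms(1) a' by (intro triangular_lower move_exponents) (auto simp: lower_def)
    qed simp
    from triangular_scale[OF triangular_add[OF tri0 this], of "-1"] show ?thesis
    proof (rule triangular_cong)
      fix y :: "real^'a" assume gen: "generic y"
      have "(\<Sum>r<a j - a i. monom_at (move ?a' i j r) y)
          = monom_at ?a' y + (\<Sum>r\<in>{..<a j - a i} - {0}. monom_at (move ?a' i j r) y)"
        using 3 by (subst sum.remove[of _ 0]) (simp_all add: move0)
      moreover have "y $ i * (monom_at a y - monom_at ?a' y) / (y $ i - y $ j)
          = - (\<Sum>r<a j - a i. monom_at (move ?a' i j r) y)"
        using divided_difference_monom[of i j ?a' y] a' assms(1) 3 y[OF gen] by (simp add: field_simps)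
      ultimately show "?P y = - 1 * (s * monom_at ?a' y + (\<Sum>r\<in>{..<a j - a i} - {0}. monom_at (move ?a' i j r) y))"
        by (simp add: s_def)
    qed (use 3 in \<open>simp add: below_def\<close>)
  qed
qed

lemma triangular_cherednik:
  assumes "a \<in> exponents k"
  shows "triangular k a (spectrum a i) (cherednik i (monom_at a))"
proof -
  have "triangular k a (real (a i) * 1 + 1/2 * (\<Sum>j\<in>UNIV - {i}. of_bool (j \<in> below a i)))
     (\<lambda>y. real (a i) * monom_at a y + 1/2 * (\<Sum>j\<in>UNIV - {i}. y $ i * (monom_at a y - monom_at (a \<circ> sw i j) y) / (y $ i - y $ j)
       + (if idx i < idx j then monom_at (a \<circ> sw i j) y else 0)))"
    by (intro triangular_add triangular_scale triangular_sum triangular_pair triangular_self assms) auto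
  then show ?thesis
  proof (rule triangular_cong)
    have "(\<Sum>j\<in>UNIV - {i}. of_bool (j \<in> below a i)) = real (card (below a i))"
      by (subst sum_of_bool_eq) (auto intro!: arg_cong[where f = card])
    then show "real (a i) * 1 + 1/2 * (\<Sum>j\<in>UNIV - {i}. of_bool (j \<in> below a i)) = spectrum a i"
      by (simp add: spectrum_def)
    fix y :: "real^'a" assume "generic y"
    have "(\<Sum>j | idx i < idx j. monom_at (a \<circ> sw i j) y)
       = (\<Sum>j\<in>UNIV - {i}. if idx i < idx j then monom_at (a \<circ> sw i j) y else 0)"
      by (rule sum.mono_neutral_cong_left) auto
    then show "cherednik i (monom_at a) y = real (a i) * monom_at a y + 1/2 * (\<Sum>j\<in>UNIV - {i}. y $ i * (monom_at a y - monom_at (a \<circ> sw i j) y) / (y $ i - y $ j)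
       + (if idx i < idx j then monom_at (a \<circ> sw i j) y else 0))"
      unfolding cherednik_def euler_monom monom_at_permute_sw sum.distrib by (simp add: algebra_simps add_divide_distrib)
  qed
qed

section \<open>Joint eigenforms\<close>

definition eigenform :: "nat \<Rightarrow> ('q::finite \<Rightarrow> real) \<Rightarrow> (real^'q \<Rightarrow> real) \<Rightarrow> bool" where
  "eigenform k u f \<longleftrightarrow> is_form k f \<and> (\<forall>i y. generic y \<longrightarrow> cherednik i f y = u i * f y)"

text \<open>The matrix of the operator in the basis of monomials of degree \<open>k\<close>.\<close>

definition cherednik_coeffs ::
    "nat \<Rightarrow> 'q::finite \<Rightarrow> (('q \<Rightarrow> nat) \<Rightarrow> ('q \<Rightarrow> nat) \<Rightarrow> real) \<Rightarrow> bool" where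
  "cherednik_coeffs k i m \<longleftrightarrow> (\<forall>a\<in>exponents k. m a a = spectrum a i)
     \<and> (\<forall>a\<in>exponents k. \<forall>b\<in>exponents k. b \<noteq> a \<longrightarrow> m a b \<noteq> 0 \<longrightarrow> lower b a)
     \<and> (\<forall>c y. generic y \<longrightarrow> cherednik i (form k c) y = form k (\<lambda>b. \<Sum>a\<in>exponents k. c a * m a b) y)"

lemma cherednik_coeffsD:
  assumes "cherednik_coeffs k i m"
  shows "a \<in> exponents k \<Longrightarrow> m a a = spectrum a i"
    and "a \<in> exponents k \<Longrightarrow> b \<in> exponents k \<Longrightarrow> b \<noteq> a \<Longrightarrow> m a b \<noteq> 0 \<Longrightarrow> lower b a"
    and "generic y \<Longrightarrow> cherednik i (form k c) y = form k (\<lambda>b. \<Sum>a\<in>exponents k. c a * m a b) y"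
  using assms unfolding cherednik_coeffs_def by blast+

lemma ex_cherednik_coeffs: "\<exists>m. cherednik_coeffs k i m"
proof -
  have "\<forall>a\<in>exponents k. \<exists>m. (\<forall>y. generic y \<longrightarrow> cherednik i (monom_at a) y = form k m y) \<and> m a = spectrum a i \<and>
     (\<forall>b\<in>exponents k. b \<noteq> a \<longrightarrow> m b \<noteq> 0 \<longrightarrow> lower b a)"
    using triangular_cherednik[of _ k i] unfolding triangular_def by blast
  from bchoice[OF this] obtain m where
    m: "\<And>a y. a \<in> exponents k \<Longrightarrow> generic y \<Longrightarrow> cherednik i (monom_at a) y = form k (m a) y"
       "\<And>a. a \<in> exponents k \<Longrightarrow> m a a = spectrum a i"
       "\<And>a b. a \<in> exponents k \<Longrightarrow> b \<in> exponents k \<Longrightarrow> b \<noteq> a \<Longrightarrow> m a b \<noteq> 0 \<Longrightarrow> lower b a"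
    by blast
  have *: "cherednik i (form k c) y = form k (\<lambda>b. \<Sum>a\<in>exponents k. c a * m a b) y" if "generic y" for c y
  proof -
    have "cherednik i (\<lambda>y. \<Sum>a\<in>exponents k. c a * monom_at a y) y
        = (\<Sum>a\<in>exponents k. cherednik i (\<lambda>y. c a * monom_at a y) y)"
      by (rule cherednik_sum[where k = k]) (simp add: is_form_scale is_form_monom)
    also have "\<dots> = (\<Sum>a\<in>exponents k. c a * form k (m a) y)"
      by (rule sum.cong) (simp_all add: cherednik_scale[OF is_form_monom] m(1) that)
    finally have "cherednik i (\<lambda>y. \<Sum>a\<in>exponents k. c a * monom_at a y) y = \<dots>" .
    then have "cherednik i (\<lambda>y. \<Sum>a\<in>exponents k. c a * monom_at a y) y
        = form k (\<lambda>b. \<Sum>a\<in>exponents k. c a * m a b) y"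
      by (simp only: form_scale form_sum)
    moreover have "form k c = (\<lambda>y. \<Sum>a\<in>exponents k. c a * monom_at a y)"
      by (simp add: fun_eq_iff form_def)
    ultimately show ?thesis
      by simp
  qed
  show ?thesis
    unfolding cherednik_coeffs_def using m(2,3) * by (intro exI[of _ m]) auto
qed

lemma maximal_exponent:
  fixes c :: "('q::finite \<Rightarrow> nat) \<Rightarrow> real"
  assumes "a \<in> exponents k" "c a \<noteq> 0"
  shows "\<exists>b\<in>exponents k. c b \<noteq> 0 \<and> (a = b \<or> lower a b) \<and> (\<forall>a'\<in>exponents k. lower b a' \<longrightarrow> c a' = 0)"
proof -
  define A where "A = {b\<in>exponents k. c b \<noteq> 0 \<and> (a = b \<or> lower a b)}"
  have fin: "finite A" by (simp add: A_def)
  have "a \<in> A" using assms by (simp add: A_def)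
  define R where "R = {(b', b). b \<in> A \<and> b' \<in> A \<and> lower b b'}"
  have "trans R" "irrefl R"
    using lower_trans lower_irrefl by (auto simp: R_def trans_def irrefl_def)
  then have "acyclic R" by (simp add: acyclic_irrefl)
  moreover have "finite R"
    by (rule finite_subset[of _ "A \<times> A"]) (use fin in \<open>auto simp: R_def\<close>)
  ultimately have "wf R" by (rule finite_acyclic_wf[rotated])
  then obtain b where b: "b \<in> A" "\<And>b'. (b', b) \<in> R \<Longrightarrow> b' \<notin> A"
    using \<open>a \<in> A\<close> by (metis wfE_min)
  have top: "c a' = 0" if "a' \<in> exponents k" "lower b a'" for a'
  proof (rule ccontr)
    assume "c a' \<noteq> 0"
    moreover have "lower a a'"
      using b(1) that(2) lower_trans by (auto simp: A_def)
    ultimately have a': "a' \<in> A" using that(1) by (simp add: A_def)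
    have "(a', b) \<in> R"
      unfolding R_def using a' b(1) that(2) by blast
    from b(2)[OF this] a' show False by contradiction
  qed
  from b(1) top show ?thesis unfolding A_def by blast
qed

text \<open>At a maximal exponent of the support, triangularity leaves only the diagonal entry of the operator, so that the
  eigenvalues are the spectrum of this exponent.\<close>

lemma eigenform_leading:
  fixes c :: "('q::finite \<Rightarrow> nat) \<Rightarrow> real"
  assumes "eigenform k u (form k c)" "a \<in> exponents k" "c a \<noteq> 0"
  obtains b where "b \<in> exponents k" "c b \<noteq> 0" "u = spectrum b" "a = b \<or> lower a b"
proof -
  obtain b where bE: "b \<in> exponents k" "c b \<noteq> 0" and above: "a = b \<or> lower a b"
    and top: "\<And>a'. a' \<in> exponents k \<Longrightarrow> lower b a' \<Longrightarrow> c a' = 0"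
    using maximal_exponent[of a k c, OF assms(2,3)] by blast
  have "u i = spectrum b i" for i
  proof -
    obtain m where "cherednik_coeffs k i m"
      using ex_cherednik_coeffs[of k i] by (rule exE)
    note m = cherednik_coeffsD[OF this]
    have "form k (\<lambda>b. \<Sum>a\<in>exponents k. c a * m a b) y = form k (\<lambda>b. u i * c b) y" if "generic y" for y
      using m(3)[OF that, of c] assms(1) that by (simp add: eigenform_def form_scale)
    from form_coeff_unique[OF this bE(1)]
    have "u i * c b = (\<Sum>a\<in>exponents k. c a * m a b)" by simp
    also have "\<dots> = (\<Sum>a\<in>exponents k. if a = b then c b * spectrum b i else 0)"
    proof (rule sum.cong)
      fix a' :: "'q \<Rightarrow> nat" assume a': "a' \<in> exponents k"
      show "c a' * m a' b = (if a' = b then c b * spectrum b i else 0)"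
        using m(1)[OF a'] m(2)[OF a' bE(1)] top[OF a'] by auto
    qed simp
    also have "\<dots> = c b * spectrum b i"
      using bE(1) by simp
    finally show ?thesis using bE(2) by simp
  qed
  then have "u = spectrum b" by auto
  then show ?thesis
    using that[of b] bE above by blast
qed

lemma eigenform_is_form: "eigenform k u f \<Longrightarrow> is_form k f"
  by (simp add: eigenform_def)

lemma eigenform_eq: "eigenform k u f \<Longrightarrow> generic y \<Longrightarrow> cherednik i f y = u i * f y"
  by (simp add: eigenform_def)

lemma eigenform_add: "eigenform k u f \<Longrightarrow> eigenform k u g \<Longrightarrow> eigenform k u (\<lambda>y. f y + g y)"
  unfolding eigenform_def by (auto simp: is_form_add cherednik_add algebra_simps)

lemma eigenform_scale: "eigenform k u f \<Longrightarrow> eigenform k u (\<lambda>y. r * f y)"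
  unfolding eigenform_def by (auto simp: is_form_scale cherednik_scale)

lemma eigenform_zero: "eigenform k u (\<lambda>y. 0)"
  unfolding eigenform_def by (auto simp: is_form_0 cherednik_zero)

lemma form_zero_iff: "form k c = (\<lambda>y. 0) \<longleftrightarrow> (\<forall>a\<in>exponents k. c a = 0)"
  for c :: "('q::finite \<Rightarrow> nat) \<Rightarrow> real"
proof
  assume "form k c = (\<lambda>y. 0)"
  then show "\<forall>a\<in>exponents k. c a = 0"
    using form_eq_0_imp_coeff_eq_0[of k c] by auto
qed (auto simp: form_def)

lemma eigenform_nonzero_spectrum:
  fixes f :: "real^'q::finite \<Rightarrow> real"
  assumes "eigenform k u f" "f \<noteq> (\<lambda>y. 0)"
  obtains b where "b \<in> exponents k" "u = spectrum b"
proof -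
  obtain c where c: "f = form k c"
    using assms by (auto simp: eigenform_def is_form_def)
  then obtain a where "a \<in> exponents k" "c a \<noteq> 0"
    using assms(2) form_zero_iff[of k c] by auto
  then show ?thesis
    using eigenform_leading[of k u c a] assms(1) that unfolding c by metis
qed

text \<open>By \<open>cherednik_at_adjacent\<close>, the swapped form misses being an eigenform only by \<open>f/2\<close> at \<open>i\<close> and \<open>-f/2\<close> at
  \<open>j\<close>; the multiple of \<open>f\<close> corrects both.\<close>

lemma eigenform_swap:
  assumes ij: "adjacent i j" and f: "eigenform k u f" and neq: "u i \<noteq> u j"
  shows "eigenform k (u \<circ> sw i j) (\<lambda>y. f (permute (sw i j) y) + 1 / (2 * (u j - u i)) * f y)"
proof -
  define g where "g = (\<lambda>y. f (permute (sw i j) y))"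
  have isf: "is_form k f" "is_form k g"
    using f by (auto simp: g_def eigenform_def intro: is_form_permute)
  have "i \<noteq> j" using ij by (auto simp: adjacent_def)
  have g: "cherednik l g y = u (sw i j l) * g y
      + (if l = i then f y / 2 else if l = j then - f y / 2 else 0)" if y: "generic y" for l y
  proof -
    have gen: "generic (permute (sw i j) y)"
      using y by (intro generic_permute) (auto intro: bij_is_inj)
    have "cherednik l g y = cherednik (sw i j l) f (permute (sw i j) y)
       - (if sw i j l = i then f y / 2 else if sw i j l = j then - f y / 2 else 0)"
      using cherednik_at_adjacent[OF ij, of "sw i j l" f y] by (simp add: g_def)
    also have "cherednik (sw i j l) f (permute (sw i j) y) = u (sw i j l) * g y"
      using eigenform_eq[OF f gen] by (simp add: g_def)
    finally show ?thesis
      using \<open>i \<noteq> j\<close> by (auto simp: Transposition.transpose_def split: if_splits)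
  qed
  define c where "c = 1 / (2 * (u j - u i))"
  have c: "c * u j = c * u i + 1 / 2"
    using neq by (simp add: c_def field_simps)
  have "eigenform k (u \<circ> sw i j) (\<lambda>y. g y + c * f y)"
    unfolding eigenform_def
  proof (intro conjI allI impI)
    show "is_form k (\<lambda>y. g y + c * f y)"
      using isf by (intro is_form_add is_form_scale)
    fix l and y :: "real^'a" assume y: "generic y"
    have "cherednik l (\<lambda>y. g y + c * f y) y = cherednik l g y + c * (u l * f y)"
      using cherednik_add[OF isf(2) is_form_scale[OF isf(1)], where i = l and y = y]
        cherednik_scale[OF isf(1), where i = l and y = y] eigenform_eq[OF f y, of l] by simp
    also have "\<dots> = u (sw i j l) * (g y + c * f y)
        + ((if l = i then 1 / 2 else if l = j then - 1 / 2 else 0) + c * u l - c * u (sw i j l)) * f y"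
      unfolding g[OF y] by (simp add: algebra_simps)
    also have "(if l = i then 1 / 2 else if l = j then - 1 / 2 else 0) + c * u l - c * u (sw i j l) = 0"
      using c \<open>i \<noteq> j\<close> by (auto simp: Transposition.transpose_def)
    finally show "cherednik l (\<lambda>y. g y + c * f y) y = (u \<circ> sw i j) l * (g y + c * f y)"
      by simp
  qed
  then show ?thesis by (simp add: g_def c_def)
qed

lemma eigenform_swap_spectrum:
  assumes "adjacent i j" "eigenform k (spectrum \<eta>) f"
  shows "\<eta> i \<noteq> \<eta> j \<Longrightarrow> eigenform k (spectrum (\<eta> \<circ> sw i j))
            (\<lambda>y. f (permute (sw i j) y) + 1 / (2 * (spectrum \<eta> j - spectrum \<eta> i)) * f y)"
    and "\<eta> i = \<eta> j \<Longrightarrow> eigenform k (spectrum \<eta>) (\<lambda>y. f (permute (sw i j) y))"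
proof -
  have "i \<noteq> j" using assms(1) by (auto simp: adjacent_def)
  note * = eigenform_swap[OF assms spectrum_neq[OF this]]
  show "eigenform k (spectrum (\<eta> \<circ> sw i j))
            (\<lambda>y. f (permute (sw i j) y) + 1 / (2 * (spectrum \<eta> j - spectrum \<eta> i)) * f y)" if "\<eta> i \<noteq> \<eta> j"
    using * by (simp add: spectrum_swap[OF assms(1) that])
  show "eigenform k (spectrum \<eta>) (\<lambda>y. f (permute (sw i j) y))" if "\<eta> i = \<eta> j"
  proof -
    have "(\<lambda>y. f (permute (sw i j) y) + 1 / (2 * (spectrum \<eta> j - spectrum \<eta> i)) * f y) = (\<lambda>y. 0)"
      using eigenform_nonzero_spectrum[OF *] spectrum_neq_swap[OF \<open>i \<noteq> j\<close> that] by metis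
    then have "f (permute (sw i j) y) = - (1 / (2 * (spectrum \<eta> j - spectrum \<eta> i))) * f y" for y
      by (simp add: fun_eq_iff add_eq_0_iff)
    then show ?thesis
      using eigenform_scale[OF assms(2)] by presburger
  qed
qed

lemma is_form_mult_var: "is_form k f \<Longrightarrow> is_form (Suc k) (\<lambda>y. y $ j * f y)"
proof (induction rule: is_form_induct)
  case (monom a)
  have "(\<lambda>y. y $ j * monom_at a y) = monom_at (a(j := Suc (a j)))"
    by (auto simp: fun_eq_iff monom_at_remove[of _ _ j] intro!: prod.cong)
  moreover have "a(j := Suc (a j)) \<in> exponents (Suc k)"
    using monom by (auto simp: exponents_def sum.remove[of UNIV j] intro!: sum.cong)
  ultimately show ?case by (simp add: is_form_monom)
next
  case (scale r f)
  then show ?case using is_form_scale[of "Suc k" "\<lambda>y. y $ j * f y" r] by (simp add: algebra_simps)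
next
  case (add f g)
  then show ?case using is_form_add[of "Suc k" "\<lambda>y. y $ j * f y" "\<lambda>y. y $ j * g y"] by (simp add: algebra_simps)
qed (simp add: is_form_0)

lemma is_form_raise: "is_form k f \<Longrightarrow> is_form (Suc k) (raise f)"
  unfolding raise_def[abs_def] by (intro is_form_mult_var is_form_permute bij_prev)

lemma eigenform_raise:
  assumes "eigenform k (spectrum \<eta>) f"
  shows "eigenform (Suc k) (spectrum (raise_exp \<eta>)) (raise f)"
  unfolding eigenform_def
proof (intro conjI allI impI)
  show "is_form (Suc k) (raise f)"
    using assms by (simp add: is_form_raise eigenform_def)
  fix i and y :: "real^'a" assume y: "generic y"
  have "generic (permute prev_index y)"
    by (rule generic_permute[OF y bij_is_inj[OF bij_prev]])
  then show "cherednik i (raise f) y = spectrum (raise_exp \<eta>) i * raise f y"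
    using cherednik_raise[OF eigenform_is_form[OF assms] y, of i] eigenform_eq[OF assms]
    by (simp add: spectrum_raise raise_def algebra_simps)
qed

section \<open>The components of the powers of the trace\<close>

definition decomposes :: "nat \<Rightarrow> (('q::finite \<Rightarrow> nat) \<Rightarrow> real^'q \<Rightarrow> real) \<Rightarrow> (real^'q \<Rightarrow> real) \<Rightarrow> bool" where
  "decomposes k g f \<longleftrightarrow> (\<forall>\<eta>\<in>exponents k. eigenform k (spectrum \<eta>) (g \<eta>)) \<and>
     (\<forall>y. f y = (\<Sum>\<eta>\<in>exponents k. g \<eta> y))"

lemma decomposes_add:
  "decomposes k g f \<Longrightarrow> decomposes k g' f' \<Longrightarrow> decomposes k (\<lambda>\<eta> y. g \<eta> y + g' \<eta> y) (\<lambda>y. f y + f' y)"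
  by (auto simp: decomposes_def sum.distrib intro: eigenform_add)

lemma decomposes_scale: "decomposes k g f \<Longrightarrow> decomposes k (\<lambda>\<eta> y. r * g \<eta> y) (\<lambda>y. r * f y)"
  by (auto simp: decomposes_def sum_distrib_left intro: eigenform_scale)

lemma decomposes_sum:
  assumes "finite A" "\<And>a. a \<in> A \<Longrightarrow> \<exists>g. decomposes k g (f a)"
  shows "\<exists>g. decomposes k g (\<lambda>y. \<Sum>a\<in>A. f a y)"
  using assms
proof (induction A rule: finite_induct)
  case empty
  show ?case
    by (rule exI[of _ "\<lambda>_ _. 0"]) (simp add: decomposes_def eigenform_zero)
next
  case (insert a A)
  obtain g where "decomposes k g (f a)" using insert.prems by blast
  moreover obtain g' where "decomposes k g' (\<lambda>y. \<Sum>a\<in>A. f a y)" using insert by blast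
  ultimately show ?case
    using decomposes_add[of k g "f a" g' "\<lambda>y. \<Sum>a\<in>A. f a y"] insert.hyps by (auto simp: insert.hyps)
qed

lemma eigenform_decomposes:
  assumes "\<eta> \<in> exponents k" "eigenform k (spectrum \<eta>) f"
  shows "\<exists>g. decomposes k g f"
proof -
  have "(\<Sum>\<mu>\<in>exponents k. (if \<mu> = \<eta> then f else (\<lambda>y. 0)) y) = f y" for y
    using assms(1) by (subst sum.remove[of _ \<eta>]) auto
  then show ?thesis
    using assms(2)
    by (intro exI[of _ "\<lambda>\<mu>. if \<mu> = \<eta> then f else (\<lambda>y. 0)"]) (simp add: decomposes_def eigenform_zero)
qed

text \<open>If \<open>\<eta> i \<noteq> \<eta> j\<close>, the swapped component of \<open>\<eta>\<close> is an eigenform for the swapped exponent minus a multiple of the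
  component; otherwise it is itself an eigenform for \<open>\<eta>\<close>.\<close>

lemma decomposes_swap:
  assumes ij: "adjacent i j" and f: "decomposes k g f"
  shows "\<exists>g. decomposes k g (\<lambda>y. f (permute (sw i j) y))"
proof -
  have "\<exists>h. decomposes k h (\<lambda>y. g \<eta> (permute (sw i j) y))" if \<eta>: "\<eta> \<in> exponents k" for \<eta>
  proof (cases "\<eta> i = \<eta> j")
    case True
    show ?thesis
      by (rule eigenform_decomposes[OF \<eta>], rule eigenform_swap_spectrum(2)[OF ij _ True])
         (use f \<eta> in \<open>auto simp: decomposes_def\<close>)
  next
    case False
    have g: "eigenform k (spectrum \<eta>) (g \<eta>)"
      using f \<eta> by (auto simp: decomposes_def)
    define c where "c = 1 / (2 * (spectrum \<eta> j - spectrum \<eta> i))"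
    have "\<eta> \<circ> sw i j \<in> exponents k"
      using \<eta> by (simp add: exponents_comp)
    from eigenform_decomposes[OF this eigenform_swap_spectrum(1)[OF ij g False]]
    obtain h where "decomposes k h (\<lambda>y. g \<eta> (permute (sw i j) y) + c * g \<eta> y)"
      by (auto simp: c_def)
    moreover obtain h' where "decomposes k h' (g \<eta>)"
      using eigenform_decomposes[OF \<eta> g] by blast
    ultimately have "decomposes k (\<lambda>\<mu> y. h \<mu> y + (-c) * h' \<mu> y)
        (\<lambda>y. (g \<eta> (permute (sw i j) y) + c * g \<eta> y) + (-c) * g \<eta> y)"
      by (intro decomposes_add decomposes_scale)
    then show ?thesis by auto
  qed
  then have "\<exists>h. decomposes k h (\<lambda>y. \<Sum>\<eta>\<in>exponents k. g \<eta> (permute (sw i j) y))"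
    by (intro decomposes_sum) auto
  then show ?thesis
    using f by (simp add: decomposes_def)
qed

lemma decomposes_permute:
  fixes f :: "real^'q::finite \<Rightarrow> real"
  assumes "bij \<pi>" "\<exists>g. decomposes k g f"
  shows "\<exists>g. decomposes k g (\<lambda>y. f (permute \<pi> y))"
proof -
  have "\<forall>f::real^'q \<Rightarrow> real. (\<exists>g. decomposes k g f) \<longrightarrow> (\<exists>g. decomposes k g (\<lambda>y. f (permute \<pi> y)))"
    using assms(1)
  proof (rule transpose_adjacent_induct[rotated 3])
    fix \<pi> \<rho> :: "'q \<Rightarrow> 'q"
    assume 1: "\<forall>f::real^'q \<Rightarrow> real. (\<exists>g. decomposes k g f) \<longrightarrow> (\<exists>g. decomposes k g (\<lambda>y. f (permute \<pi> y)))"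
      and 2: "\<forall>f::real^'q \<Rightarrow> real. (\<exists>g. decomposes k g f) \<longrightarrow> (\<exists>g. decomposes k g (\<lambda>y. f (permute \<rho> y)))"
    show "\<forall>f::real^'q \<Rightarrow> real. (\<exists>g. decomposes k g f) \<longrightarrow> (\<exists>g. decomposes k g (\<lambda>y. f (permute (\<pi> \<circ> \<rho>) y)))"
    proof (intro allI impI)
      fix f :: "real^'q \<Rightarrow> real" assume "\<exists>g. decomposes k g f"
      then have "\<exists>g. decomposes k g (\<lambda>y. f (permute \<rho> y))" using 2 by blast
      then have "\<exists>g. decomposes k g (\<lambda>y. f (permute \<rho> (permute \<pi> y)))"
        using 1[rule_format, of "\<lambda>y. f (permute \<rho> y)"] by blast
      then show "\<exists>g. decomposes k g (\<lambda>y. f (permute (\<pi> \<circ> \<rho>) y))" by simp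
    qed
  qed (use decomposes_swap in auto)
  then show ?thesis using assms(2) by blast
qed

lemma decomposes_raise:
  assumes "decomposes k g f"
  shows "\<exists>g. decomposes (Suc k) g (raise f)"
proof -
  have "\<exists>h. decomposes (Suc k) h (\<lambda>y. \<Sum>\<eta>\<in>exponents k. raise (g \<eta>) y)"
    using assms
    by (intro decomposes_sum eigenform_decomposes[OF raise_exp_exponents] eigenform_raise)
       (auto simp: decomposes_def)
  moreover have "raise f = (\<lambda>y. \<Sum>\<eta>\<in>exponents k. raise (g \<eta>) y)"
    using assms by (auto simp: decomposes_def raise_def sum_distrib_left fun_eq_iff)
  ultimately show ?thesis by simp
qed

definition trace_power :: "nat \<Rightarrow> real^'q::finite \<Rightarrow> real" where
  "trace_power k y = (\<Sum>i\<in>UNIV. y $ i) ^ k"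

lemma trace_power_permute [simp]: "bij \<pi> \<Longrightarrow> trace_power k (permute \<pi> y) = trace_power k y"
  unfolding trace_power_def using sum.reindex_bij_betw[of \<pi> UNIV UNIV "\<lambda>i. y $ i"]
  by (simp add: bij_def bij_betw_def)

lemma exponents_0: "exponents 0 = {\<lambda>_. 0}"
  by (auto simp: exponents_def)

text \<open>The next power of the trace is the sum of the products of the \<open>y $ i\<close> with the given power, and these are the
  raised power and its images under transpositions.\<close>

lemma decomposes_trace_power: "\<exists>g. decomposes k g (trace_power k :: real^'q::finite \<Rightarrow> real)"
proof (induction k)
  case 0
  have one: "(trace_power 0 :: real^'q \<Rightarrow> real) = (\<lambda>y. 1)"
    by (simp add: trace_power_def fun_eq_iff)
  have "is_form 0 (\<lambda>y::real^'q. 1)"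
    unfolding is_form_def by (rule exI[of _ "\<lambda>_. 1"]) (simp add: fun_eq_iff form_def monom_at_def exponents_0)
  then have "eigenform 0 (spectrum (\<lambda>_. 0)) (\<lambda>y::real^'q. 1)"
    by (simp add: eigenform_def cherednik_def partial_deriv_def spectrum_def below_def)
  then show ?case
    unfolding one by (intro eigenform_decomposes[of "\<lambda>_. 0"]) (simp_all add: exponents_0)
next
  case (Suc k)
  let ?p = "trace_power k :: real^'q \<Rightarrow> real"
  have raise: "\<exists>g. decomposes (Suc k) g (raise ?p)"
    using Suc decomposes_raise by blast
  have "\<exists>g. decomposes (Suc k) g (\<lambda>y. raise ?p (permute (sw i last_index) y))" for i
    by (rule decomposes_permute[OF _ raise]) simp
  then have "\<exists>g. decomposes (Suc k) g (\<lambda>y. \<Sum>i\<in>UNIV. raise ?p (permute (sw i last_index) y))"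
    by (intro decomposes_sum) auto
  moreover have "(\<Sum>i\<in>UNIV. raise ?p (permute (sw i last_index) y)) = trace_power (Suc k) y" for y
  proof -
    have "raise ?p (permute (sw i last_index) y) = y $ i * trace_power k y" for i
      by (simp add: raise_def bij_prev del: permute_permute)
    then show ?thesis
      by (simp add: trace_power_def sum_distrib_right)
  qed
  ultimately show ?case by simp
qed

text \<open>Subtracting an eigenvalue of one summand from an operator removes this summand and multiplies the others by
  differences of eigenvalues, and distinct exponents have spectra that differ at some index.\<close>

lemma eigenforms_independent:
  assumes "finite A" "A \<subseteq> exponents k" "\<And>\<eta>. \<eta> \<in> A \<Longrightarrow> eigenform k (spectrum \<eta>) (g \<eta>)"
    and "\<And>y. (\<Sum>\<eta>\<in>A. g \<eta> y) = 0" and "\<eta> \<in> A"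
  shows "g \<eta> = (\<lambda>y. 0)"
  using assms
proof (induction A arbitrary: g \<eta> rule: finite_induct)
  case (insert \<eta>0 A)
  have eig: "eigenform k (spectrum \<eta>) (g \<eta>)" if "\<eta> \<in> insert \<eta>0 A" for \<eta>
    using insert.prems that by blast
  have zero: "spectrum \<eta> i * g \<eta> y = spectrum \<eta>0 i * g \<eta> y" if \<eta>: "\<eta> \<in> A" for \<eta> i y
  proof -
    let ?h = "\<lambda>\<eta> y. (spectrum \<eta> i - spectrum \<eta>0 i) * g \<eta> y"
    have form: "is_form k (\<lambda>y. \<Sum>\<eta>\<in>A. ?h \<eta> y)"
      using eig by (intro is_form_sum is_form_scale eigenform_is_form) auto
    have "(\<Sum>\<eta>\<in>A. ?h \<eta> y) = 0" if y: "generic y" for y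
    proof -
      have "0 = cherednik i (\<lambda>y. \<Sum>\<eta>\<in>insert \<eta>0 A. g \<eta> y) y"
        using insert.prems(3) by (simp only: cherednik_zero)
      also have "\<dots> = (\<Sum>\<eta>\<in>insert \<eta>0 A. cherednik i (g \<eta>) y)"
        by (rule cherednik_sum[where k = k]) (use eig eigenform_is_form in blast)
      also have "\<dots> = (\<Sum>\<eta>\<in>insert \<eta>0 A. spectrum \<eta> i * g \<eta> y)"
        by (rule sum.cong) (simp_all add: eigenform_eq[OF eig y])
      also have "\<dots> = (\<Sum>\<eta>\<in>insert \<eta>0 A. ?h \<eta> y) + spectrum \<eta>0 i * (\<Sum>\<eta>\<in>insert \<eta>0 A. g \<eta> y)"
        by (simp only: sum_distrib_left sum.distrib[symmetric]) (simp add: algebra_simps)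
      also have "\<dots> = (\<Sum>\<eta>\<in>A. ?h \<eta> y)"
        using insert.hyps insert.prems(3)[of y] by simp
      finally show ?thesis by simp
    qed
    then have "(\<lambda>y. \<Sum>\<eta>\<in>A. ?h \<eta> y) = (\<lambda>y. 0)"
      by (intro is_form_eqI[OF form is_form_0]) auto
    then have "?h \<eta> = (\<lambda>y. 0)"
    proof (intro insert.IH)
      show "eigenform k (spectrum \<mu>) (?h \<mu>)" if "\<mu> \<in> A" for \<mu>
        using that by (intro eigenform_scale eig) simp
    qed (use insert.prems \<eta> in \<open>auto simp: fun_eq_iff\<close>)
    from fun_cong[OF this, of y] show ?thesis by (simp add: algebra_simps)
  qed
  have A: "g \<eta> = (\<lambda>y. 0)" if "\<eta> \<in> A" for \<eta>
  proof (rule ccontr)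
    assume "g \<eta> \<noteq> (\<lambda>y. 0)"
    then obtain y where "g \<eta> y \<noteq> 0" by auto
    then have "spectrum \<eta> = spectrum \<eta>0"
      using zero[OF that, of _ y] by auto
    then show False
      using spectrum_inj that insert.hyps by blast
  qed
  have "g \<eta>0 = (\<lambda>y. 0)"
    using insert.prems(3) insert.hyps A by (simp add: fun_eq_iff)
  with A insert.prems(4) show ?case by auto
qed simp

lemma decomposes_unique:
  assumes "decomposes k g f" "decomposes k h f" "\<eta> \<in> exponents k"
  shows "g \<eta> = h \<eta>"
proof -
  have d: "decomposes k (\<lambda>\<eta> y. g \<eta> y + (-1) * h \<eta> y) (\<lambda>y. f y + (-1) * f y)"
    by (intro decomposes_add decomposes_scale assms)
  have "(\<lambda>y. g \<eta> y + (-1) * h \<eta> y) = (\<lambda>y. 0)"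
    by (rule eigenforms_independent[of "exponents k" k "\<lambda>\<eta> y. g \<eta> y + (-1) * h \<eta> y"])
       (use d assms(3) in \<open>auto simp: decomposes_def simp flip: sum_subtractf\<close>)
  then show ?thesis by (simp add: fun_eq_iff)
qed

definition trace_component :: "nat \<Rightarrow> ('q::finite \<Rightarrow> nat) \<Rightarrow> real^'q \<Rightarrow> real" where
  "trace_component k = (SOME g. decomposes k g (trace_power k))"

lemma trace_component: "decomposes k (trace_component k) (trace_power k)"
  unfolding trace_component_def by (rule someI_ex[OF decomposes_trace_power])

lemma eigenform_component: "\<eta> \<in> exponents k \<Longrightarrow> eigenform k (spectrum \<eta>) (trace_component k \<eta>)"
  using trace_component[of k] unfolding decomposes_def by blast

lemma sum_component:
  fixes y :: "real^'q::finite"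
  shows "(\<Sum>\<eta>\<in>exponents k. trace_component k \<eta> y) = trace_power k y"
  using trace_component[of k, where 'a = 'q] by (simp add: decomposes_def)

definition swap_coeff :: "'q::finite \<Rightarrow> 'q \<Rightarrow> ('q \<Rightarrow> nat) \<Rightarrow> real" where
  "swap_coeff i j \<mu> = 1 / (2 * (spectrum \<mu> j - spectrum \<mu> i))"

lemma bij_betw_comp_exponents:
  fixes \<pi> :: "'q::finite \<Rightarrow> 'q" and A :: "('q \<Rightarrow> nat) set"
  assumes "bij \<pi>" "\<And>a. a \<circ> \<pi> \<in> A \<longleftrightarrow> a \<in> A"
  shows "bij_betw (\<lambda>a. a \<circ> \<pi>) A A"
proof (rule bij_betwI[where g = "\<lambda>a. a \<circ> inv \<pi>"])
  have inv: "(\<lambda>x. \<pi> (inv \<pi> x)) = id" "(\<lambda>x. inv \<pi> (\<pi> x)) = id"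
    using assms(1) by (auto simp: fun_eq_iff bij_is_surj surj_f_inv_f bij_is_inj inv_f_f)
  show "(\<lambda>a. a \<circ> inv \<pi>) \<in> A \<rightarrow> A"
  proof
    fix a assume "a \<in> A"
    moreover have "(a \<circ> inv \<pi>) \<circ> \<pi> = a"
      using fun_cong[OF inv(2)] by (simp add: fun_eq_iff)
    ultimately show "a \<circ> inv \<pi> \<in> A"
      using assms(2)[of "a \<circ> inv \<pi>"] by simp
  qed
  show "(\<lambda>a. a \<circ> \<pi>) \<in> A \<rightarrow> A" using assms(2) by blast
  show "a \<circ> \<pi> \<circ> inv \<pi> = a" for a :: "'q \<Rightarrow> nat" using fun_cong[OF inv(1)] by (simp add: fun_eq_iff)
  show "a \<circ> inv \<pi> \<circ> \<pi> = a" for a :: "'q \<Rightarrow> nat" using fun_cong[OF inv(2)] by (simp add: fun_eq_iff)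
qed

lemma sum_comp_invariant:
  fixes \<pi> :: "'q::finite \<Rightarrow> 'q" and A :: "('q \<Rightarrow> nat) set"
  assumes "bij \<pi>" "\<And>a. a \<circ> \<pi> \<in> A \<longleftrightarrow> a \<in> A"
  shows "(\<Sum>a\<in>A. h (a \<circ> \<pi>)) = (\<Sum>a\<in>A. h a)"
  by (rule sum.reindex_bij_betw[OF bij_betw_comp_exponents[OF assms]])

text \<open>The power of the trace is symmetric, and the two correction terms exchange their sums under \<open>\<eta> \<mapsto> \<eta> \<circ> sw i j\<close>.
  Hence the right-hand sides form another decomposition of the power of the trace, which is the same one by
  uniqueness.\<close>

lemma component_swap:
  fixes i :: "'q::finite"
  assumes ij: "adjacent i j" and \<eta>: "\<eta> \<in> exponents k"
  shows "trace_component k \<eta> y = trace_component k (\<eta> \<circ> sw i j) (permute (sw i j) y)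
    + swap_coeff i j (\<eta> \<circ> sw i j) * trace_component k (\<eta> \<circ> sw i j) y - swap_coeff i j \<eta> * trace_component k \<eta> y"
proof -
  let ?g = "trace_component k :: ('q \<Rightarrow> nat) \<Rightarrow> real^'q \<Rightarrow> real"
  let ?s = "sw i j"
  let ?h = "\<lambda>\<mu> y. ?g (\<mu> \<circ> ?s) (permute ?s y) + swap_coeff i j (\<mu> \<circ> ?s) * ?g (\<mu> \<circ> ?s) y + - swap_coeff i j \<mu> * ?g \<mu> y"
  have inv: "\<mu> \<circ> ?s \<circ> ?s = \<mu>" for \<mu> :: "'q \<Rightarrow> nat" by (simp add: comp_assoc)
  have "decomposes k ?h (trace_power k)"
    unfolding decomposes_def
  proof (intro conjI ballI allI)
    fix \<mu> :: "'q \<Rightarrow> nat" assume \<mu>: "\<mu> \<in> exponents k"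
    then have \<mu>': "\<mu> \<circ> ?s \<in> exponents k" by (simp add: exponents_comp)
    show "eigenform k (spectrum \<mu>) (?h \<mu>)"
    proof (cases "\<mu> i = \<mu> j")
      case True
      then have eq: "\<mu> \<circ> ?s = \<mu>" by (auto simp: fun_eq_iff Transposition.transpose_def)
      show ?thesis
        unfolding eq using eigenform_swap_spectrum(2)[OF ij eigenform_component[OF \<mu>] True] by simp
    next
      case False
      then have "(\<mu> \<circ> ?s) i \<noteq> (\<mu> \<circ> ?s) j" by simp
      from eigenform_swap_spectrum(1)[OF ij eigenform_component[OF \<mu>'] this]
      have "eigenform k (spectrum \<mu>) (\<lambda>y. ?g (\<mu> \<circ> ?s) (permute ?s y) + swap_coeff i j (\<mu> \<circ> ?s) * ?g (\<mu> \<circ> ?s) y)"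
        by (simp only: inv swap_coeff_def)
      then show ?thesis
        by (intro eigenform_add[where g = "\<lambda>y. - swap_coeff i j \<mu> * ?g \<mu> y"] eigenform_scale eigenform_component \<mu>)
    qed
  next
    fix y :: "real^'q"
    have ex: "a \<circ> ?s \<in> exponents k \<longleftrightarrow> a \<in> exponents k" for a :: "'q \<Rightarrow> nat"
      by (simp add: exponents_comp)
    have "(\<Sum>\<mu>\<in>exponents k. ?h \<mu> y)
      = (\<Sum>\<mu>\<in>exponents k. ?g (\<mu> \<circ> ?s) (permute ?s y)) + (\<Sum>\<mu>\<in>exponents k. swap_coeff i j (\<mu> \<circ> ?s) * ?g (\<mu> \<circ> ?s) y)
        - (\<Sum>\<mu>\<in>exponents k. swap_coeff i j \<mu> * ?g \<mu> y)"
      by (simp add: sum.distrib sum_negf sum_subtractf)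
    also have "(\<Sum>\<mu>\<in>exponents k. swap_coeff i j (\<mu> \<circ> ?s) * ?g (\<mu> \<circ> ?s) y) = (\<Sum>\<mu>\<in>exponents k. swap_coeff i j \<mu> * ?g \<mu> y)"
      by (rule sum_comp_invariant[where h = "\<lambda>\<mu>. swap_coeff i j \<mu> * ?g \<mu> y", OF _ ex]) simp
    also have "(\<Sum>\<mu>\<in>exponents k. ?g (\<mu> \<circ> ?s) (permute ?s y)) = (\<Sum>\<mu>\<in>exponents k. ?g \<mu> (permute ?s y))"
      by (rule sum_comp_invariant[where h = "\<lambda>\<mu>. ?g \<mu> (permute ?s y)", OF _ ex]) simp
    also have "(\<Sum>\<mu>\<in>exponents k. ?g \<mu> (permute ?s y)) + (\<Sum>\<mu>\<in>exponents k. swap_coeff i j \<mu> * ?g \<mu> y)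
        - (\<Sum>\<mu>\<in>exponents k. swap_coeff i j \<mu> * ?g \<mu> y) = trace_power k y"
      unfolding sum_component by simp
    finally show "trace_power k y = (\<Sum>\<mu>\<in>exponents k. ?h \<mu> y)"
      by (rule sym)
  qed
  from fun_cong[OF decomposes_unique[OF trace_component this \<eta>], of y] show ?thesis
    by simp
qed

text \<open>If the swapped component were zero, \<open>component_swap\<close> would give \<open>1 + swap_coeff i j \<eta> = 0\<close>, that is, two
  eigenvalues at distance \<open>1/2\<close>; those of unequal exponents are further apart.\<close>

lemma component_swap_nonzero:
  assumes ij: "adjacent i j" and \<eta>: "\<eta> \<in> exponents k" and nz: "trace_component k \<eta> \<noteq> (\<lambda>y. 0)"
  shows "trace_component k (\<eta> \<circ> sw i j) \<noteq> (\<lambda>y. 0)"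
proof
  assume 0: "trace_component k (\<eta> \<circ> sw i j) = (\<lambda>y. 0)"
  have "\<eta> i \<noteq> \<eta> j"
  proof
    assume "\<eta> i = \<eta> j"
    then have "\<eta> \<circ> sw i j = \<eta>" by (auto simp: fun_eq_iff Transposition.transpose_def)
    with 0 nz show False by simp
  qed
  note gap = spectrum_gap_abs[OF this]
  have "1 + swap_coeff i j \<eta> \<noteq> 0"
  proof
    assume "1 + swap_coeff i j \<eta> = 0"
    then have "1 / (2 * (spectrum \<eta> j - spectrum \<eta> i)) = - 1"
      by (simp add: swap_coeff_def)
    then have "2 * (spectrum \<eta> j - spectrum \<eta> i) = - 1"
      by (cases "spectrum \<eta> j = spectrum \<eta> i") (simp_all add: divide_eq_eq)
    then have "spectrum \<eta> i = spectrum \<eta> j + 1 / 2" by (simp add: algebra_simps)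
    with gap show False by simp
  qed
  moreover have "(1 + swap_coeff i j \<eta>) * trace_component k \<eta> y = 0" for y
    using component_swap[OF ij \<eta>, of y] by (simp add: 0 algebra_simps)
  ultimately have "trace_component k \<eta> y = 0" for y
    by (simp only: mult_eq_0_iff) blast
  with nz show False by auto
qed

lemma component_comp_nonzero:
  fixes \<pi> :: "'q::finite \<Rightarrow> 'q"
  assumes "bij \<pi>" "\<eta> \<in> exponents k" "trace_component k \<eta> \<noteq> (\<lambda>y. 0)"
  shows "trace_component k (\<eta> \<circ> \<pi>) \<noteq> (\<lambda>y. 0)"
proof -
  have "\<forall>\<eta>::'q \<Rightarrow> nat. \<eta> \<in> exponents k \<longrightarrow> trace_component k \<eta> \<noteq> (\<lambda>y. 0) \<longrightarrow> trace_component k (\<eta> \<circ> \<pi>) \<noteq> (\<lambda>y. 0)"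
    using assms(1)
  proof (rule transpose_adjacent_induct[rotated 3])
    fix \<pi> \<rho> :: "'q \<Rightarrow> 'q"
    assume "bij \<pi>" and 1: "\<forall>\<eta>::'q \<Rightarrow> nat. \<eta> \<in> exponents k \<longrightarrow> trace_component k \<eta> \<noteq> (\<lambda>y. 0) \<longrightarrow> trace_component k (\<eta> \<circ> \<pi>) \<noteq> (\<lambda>y. 0)"
      and 2: "\<forall>\<eta>::'q \<Rightarrow> nat. \<eta> \<in> exponents k \<longrightarrow> trace_component k \<eta> \<noteq> (\<lambda>y. 0) \<longrightarrow> trace_component k (\<eta> \<circ> \<rho>) \<noteq> (\<lambda>y. 0)"
    show "\<forall>\<eta>::'q \<Rightarrow> nat. \<eta> \<in> exponents k \<longrightarrow> trace_component k \<eta> \<noteq> (\<lambda>y. 0) \<longrightarrow> trace_component k (\<eta> \<circ> (\<pi> \<circ> \<rho>)) \<noteq> (\<lambda>y. 0)"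
    proof (intro allI impI)
      fix \<eta> :: "'q \<Rightarrow> nat" assume \<eta>: "\<eta> \<in> exponents k" "trace_component k \<eta> \<noteq> (\<lambda>y. 0)"
      have "trace_component k ((\<eta> \<circ> \<pi>) \<circ> \<rho>) \<noteq> (\<lambda>y. 0)"
        using 2[rule_format, of "\<eta> \<circ> \<pi>"] 1[rule_format, OF \<eta>] \<eta>(1) exponents_comp[OF \<open>bij \<pi>\<close>] by blast
      then show "trace_component k (\<eta> \<circ> (\<pi> \<circ> \<rho>)) \<noteq> (\<lambda>y. 0)" by (simp add: comp_assoc)
    qed
  next
    show "\<forall>\<eta>::'q \<Rightarrow> nat. \<eta> \<in> exponents k \<longrightarrow> trace_component k \<eta> \<noteq> (\<lambda>y. 0) \<longrightarrow> trace_component k (\<eta> \<circ> id) \<noteq> (\<lambda>y. 0)"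
      unfolding comp_id by (intro allI impI)
  next
    fix i j :: 'q assume "adjacent i j"
    then show "\<forall>\<eta>::'q \<Rightarrow> nat. \<eta> \<in> exponents k \<longrightarrow> trace_component k \<eta> \<noteq> (\<lambda>y. 0) \<longrightarrow> trace_component k (\<eta> \<circ> sw i j) \<noteq> (\<lambda>y. 0)"
      using component_swap_nonzero by (intro allI impI)
  qed
  then show ?thesis using assms by blast
qed

text \<open>The form vanishes off a coordinate hyperplane, and by continuity also on it.\<close>

lemma raise_zero:
  assumes "is_form k f" "raise f = (\<lambda>y. 0)"
  shows "f = (\<lambda>y. 0)"
proof
  fix z :: "real^'a"
  define i where "i = next_index (last_index :: 'a)"
  have nz: "f y = 0" if "y $ i \<noteq> 0" for y
  proof -
    have "raise f (permute next_index y) = y $ i * f y"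
      by (simp add: raise_def i_def o_def)
    then show ?thesis using assms(2) that by (simp add: fun_eq_iff)
  qed
  have "isCont (\<lambda>x. f (upd z i x)) (z $ i)"
    using form_differentiable[OF assms(1)] field_differentiable_imp_continuous_at by blast
  then have "((\<lambda>x. f (upd z i x)) \<longlongrightarrow> f z) (at (z $ i))"
    by (simp add: isCont_def upd_self)
  moreover have "eventually (\<lambda>x. f (upd z i x) = 0) (at (z $ i))"
  proof (cases "z $ i = 0")
    case True
    then show ?thesis
      using nz by (auto simp: eventually_at intro!: exI[of _ 1])
  next
    case False
    then have "eventually (\<lambda>x. x \<in> - {0}) (at (z $ i))"
      by (intro eventually_at_in_open') auto
    then show ?thesis
      by eventually_elim (use nz in auto)
  qed
  then have "((\<lambda>x. f (upd z i x)) \<longlongrightarrow> 0) (at (z $ i))"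
    by (rule tendsto_eventually)
  ultimately show "f z = 0"
    by (rule tendsto_unique[OF at_neq_bot])
qed

lemma partial_deriv_trace_power:
  "partial_deriv i (trace_power (Suc k)) y = real (Suc k) * trace_power k y"
proof -
  have sum: "(\<Sum>j\<in>UNIV. upd y i x $ j) = x + (\<Sum>j\<in>UNIV - {i}. y $ j)" for x
    by (subst sum.remove[of _ i]) auto
  have "((\<lambda>x. (x + (\<Sum>j\<in>UNIV - {i}. y $ j)) ^ Suc k) has_real_derivative
      real (Suc k) * ((1 + 0) * (y $ i + (\<Sum>j\<in>UNIV - {i}. y $ j)) ^ (Suc k - Suc 0))) (at (y $ i))"
    by (intro DERIV_power DERIV_add DERIV_ident DERIV_const)
  then have "((\<lambda>x. (x + (\<Sum>j\<in>UNIV - {i}. y $ j)) ^ Suc k) has_real_derivative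
      real (Suc k) * (y $ i + (\<Sum>j\<in>UNIV - {i}. y $ j)) ^ k) (at (y $ i))"
    unfolding diff_Suc_Suc diff_zero add_0_right mult_1_left .
  moreover have "y $ i + (\<Sum>j\<in>UNIV - {i}. y $ j) = (\<Sum>j\<in>UNIV. y $ j)"
    by (subst sum.remove[of UNIV i]) auto
  ultimately show ?thesis
    unfolding partial_deriv_def trace_power_def sum by (metis DERIV_imp_deriv)
qed

text \<open>On a symmetric form all divided differences vanish, and the last index has no indices above it.\<close>

lemma cherednik_last_trace_power:
  "cherednik last_index (trace_power (Suc k)) y = real (Suc k) * raise (trace_power k) y"
  by (simp add: cherednik_def partial_deriv_trace_power raise_def bij_prev)

lemma raise_exp_eqI:
  assumes "\<eta> last_index > 0" "\<eta> \<in> exponents (Suc k)"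
  obtains \<mu> where "\<mu> \<in> exponents k" "\<eta> = raise_exp \<mu>"
proof -
  define \<mu> where "\<mu> = (\<lambda>i. \<eta> (prev_index i) - (if prev_index i = last_index then 1 else 0))"
  have eq: "\<eta> = raise_exp \<mu>"
    using assms(1) by (auto simp: raise_exp_def \<mu>_def fun_eq_iff)
  have "(\<Sum>i\<in>UNIV. \<mu> (next_index i)) = (\<Sum>i\<in>UNIV. \<mu> i)"
    by (rule sum.reindex_bij_betw[OF bij_next])
  then have "\<mu> \<in> exponents k"
    using assms(2) unfolding eq by (simp add: exponents_def raise_exp_def sum.distrib)
  with eq show ?thesis using that by blast
qed

lemma inj_raise_exp: "inj raise_exp"
proof (rule injI)
  fix \<eta> \<mu> :: "'a \<Rightarrow> nat" assume eq: "raise_exp \<eta> = raise_exp \<mu>"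
  have "\<eta> (next_index i) = \<mu> (next_index i)" for i
    using fun_cong[OF eq, of i] by (simp add: raise_exp_def)
  from this[of "prev_index _"] show "\<eta> = \<mu>" by auto
qed

text \<open>The last operator sends the power \<open>k + 1\<close> of the trace to \<open>k + 1\<close> times the raised power \<open>k\<close>.  Comparing
  components, every \<open>\<eta>\<close> with a positive last entry inherits a nonzero component from degree \<open>k\<close>, and
  every nonzero exponent vector has a rearrangement with a positive last entry.\<close>

lemma component_nonzero:
  fixes \<eta> :: "'q::finite \<Rightarrow> nat"
  assumes "\<eta> \<in> exponents k"
  shows "trace_component k \<eta> \<noteq> (\<lambda>y. 0)"
  using assms
proof (induction k arbitrary: \<eta>)
  case 0
  then have "trace_component 0 \<eta> y = 1" for y
    using sum_component[of 0 y] by (simp add: exponents_0 trace_power_def)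
  then show ?case by (metis zero_neq_one)
next
  case (Suc k)
  have last: "trace_component (Suc k) \<eta> \<noteq> (\<lambda>y. 0)"
    if pos: "\<eta> last_index > 0" "\<eta> \<in> exponents (Suc k)" for \<eta> :: "'q \<Rightarrow> nat"
  proof
    assume 0: "trace_component (Suc k) \<eta> = (\<lambda>y. 0)"
    obtain \<mu> where \<mu>: "\<mu> \<in> exponents k" "\<eta> = raise_exp \<mu>"
      using raise_exp_eqI[OF pos] .
    let ?R = "raise_exp ` (exponents k :: ('q \<Rightarrow> nat) set)"
    define f where "f = (\<lambda>y::real^'q. real (Suc k) * raise (trace_power k) y)"
    define g where "g = (\<lambda>\<eta> y. spectrum \<eta> last_index * trace_component (Suc k) \<eta> (y :: real^'q))"
    define h where "h = (\<lambda>\<eta>. if \<eta> \<in> ?R then (\<lambda>y. real (Suc k) * raise (trace_component k (inv raise_exp \<eta>)) y) else (\<lambda>y. 0))"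
    have inv: "inv raise_exp (raise_exp \<nu>) = \<nu>" for \<nu> :: "'q \<Rightarrow> nat"
      by (rule inv_f_f[OF inj_raise_exp])
    have sub: "?R \<subseteq> exponents (Suc k)" by (auto intro: raise_exp_exponents)
    \<comment> \<open>The components of \<open>f\<close> from those of degree \<open>k\<close> \<dots>\<close>
    have "decomposes (Suc k) h f"
      unfolding decomposes_def
    proof (intro conjI ballI allI)
      show "eigenform (Suc k) (spectrum \<nu>) (h \<nu>)" for \<nu>
        by (auto simp: h_def inv intro!: eigenform_zero eigenform_scale eigenform_raise eigenform_component)
      fix y :: "real^'q"
      have "(\<Sum>\<nu>\<in>exponents (Suc k). h \<nu> y) = (\<Sum>\<nu>\<in>?R. h \<nu> y)"
        using sub by (intro sum.mono_neutral_right) (auto simp: h_def)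
      also have "\<dots> = (\<Sum>\<nu>\<in>exponents k. h (raise_exp \<nu>) y)"
        by (simp add: sum.reindex inj_on_subset[OF inj_raise_exp])
      also have "\<dots> = (\<Sum>\<nu>\<in>exponents k. real (Suc k) * raise (trace_component k \<nu>) y)"
        by (rule sum.cong) (auto simp: h_def inv)
      also have "\<dots> = f y"
        by (simp add: f_def raise_def sum_component[symmetric] sum_distrib_left)
      finally show "f y = (\<Sum>\<nu>\<in>exponents (Suc k). h \<nu> y)" ..
    qed
    \<comment> \<open>\<dots> and from the eigenvalues of the last operator on the components of degree \<open>k + 1\<close>.\<close>
    moreover have "decomposes (Suc k) g f"
      unfolding decomposes_def
    proof (intro conjI ballI allI)
      show g: "eigenform (Suc k) (spectrum \<nu>) (g \<nu>)" if "\<nu> \<in> exponents (Suc k)" for \<nu>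
        using that by (auto simp: g_def intro!: eigenform_scale eigenform_component)
      have "f = (\<lambda>y. \<Sum>\<nu>\<in>exponents (Suc k). g \<nu> y)"
      proof (rule is_form_eqI[where k = "Suc k"])
        have "is_form k (trace_power k :: real^'q \<Rightarrow> real)"
          unfolding sum_component[symmetric, abs_def] by (intro is_form_sum eigenform_is_form[OF eigenform_component])
        then show "is_form (Suc k) f"
          unfolding f_def by (intro is_form_scale is_form_raise)
        show "is_form (Suc k) (\<lambda>y. \<Sum>\<nu>\<in>exponents (Suc k). g \<nu> y)"
          by (intro is_form_sum eigenform_is_form[OF g])
        fix y :: "real^'q" assume y: "generic y"
        have "f y = cherednik last_index (trace_power (Suc k)) y"
          by (simp add: f_def cherednik_last_trace_power)
        also have "trace_power (Suc k) = (\<lambda>y::real^'q. \<Sum>\<nu>\<in>exponents (Suc k). trace_component (Suc k) \<nu> y)"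
          by (simp add: fun_eq_iff sum_component)
        also have "cherednik last_index \<dots> y = (\<Sum>\<nu>\<in>exponents (Suc k). cherednik last_index (trace_component (Suc k) \<nu>) y)"
          by (rule cherednik_sum[where k = "Suc k"]) (rule eigenform_is_form[OF eigenform_component])
        also have "\<dots> = (\<Sum>\<nu>\<in>exponents (Suc k). g \<nu> y)"
          by (rule sum.cong) (simp_all add: eigenform_eq[OF eigenform_component y] g_def)
        finally show "f y = (\<Sum>\<nu>\<in>exponents (Suc k). g \<nu> y)" .
      qed
      then show "f y = (\<Sum>\<nu>\<in>exponents (Suc k). g \<nu> y)" for y by simp
    qed
    ultimately have "h \<eta> = g \<eta>"
      using decomposes_unique[OF _ _ pos(2)] by blast
    moreover have "h \<eta> = (\<lambda>y. real (Suc k) * raise (trace_component k \<mu>) y)"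
      unfolding \<mu>(2) h_def inv using \<mu>(1) by simp
    moreover have "g \<eta> = (\<lambda>y. 0)"
      by (simp add: g_def 0)
    ultimately have "real (Suc k) * raise (trace_component k \<mu>) y = 0" for y
      by metis
    then have "raise (trace_component k \<mu>) = (\<lambda>y. 0)"
      by (simp add: fun_eq_iff del: of_nat_Suc)
    then have "trace_component k \<mu> = (\<lambda>y. 0)"
      using raise_zero eigenform_is_form[OF eigenform_component[OF \<mu>(1)]] by blast
    then show False using Suc.IH[OF \<mu>(1)] by blast
  qed
  obtain i where i: "\<eta> i > 0"
    using Suc.prems by (auto simp: exponents_def) (metis neq0_conv sum.neutral nat.distinct(1))
  let ?s = "sw i (last_index :: 'q)"
  have "trace_component (Suc k) (\<eta> \<circ> ?s) \<noteq> (\<lambda>y. 0)"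
    using i Suc.prems by (intro last) (simp_all add: exponents_comp)
  from component_comp_nonzero[OF _ _ this, of ?s]
  have "trace_component (Suc k) (\<eta> \<circ> ?s \<circ> ?s) \<noteq> (\<lambda>y. 0)"
    using Suc.prems by (auto simp: exponents_comp)
  then show ?case by (simp add: comp_assoc)
qed

section \<open>Symmetric forms and the Laplace-Beltrami operator\<close>

lemma is_form_partial_deriv:
  assumes "is_form k f"
  shows "is_form (k - 1) (partial_deriv i f)"
  using assms
proof (induction rule: is_form_induct)
  case zero
  then show ?case using is_form_0 by (simp add: partial_deriv_zero[abs_def])
next
  case (add f g)
  have "partial_deriv i (\<lambda>y. f y + g y) = (\<lambda>y. partial_deriv i f y + partial_deriv i g y)"
    using partial_deriv_add[OF add(1,2)] by (intro ext)
  then show ?case using add by (simp add: is_form_add)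
next
  case (scale r f)
  have "partial_deriv i (\<lambda>y. r * f y) = (\<lambda>y. r * partial_deriv i f y)"
    using partial_deriv_scale[OF scale(1)] by (intro ext)
  then show ?case using scale by (simp add: is_form_scale)
next
  case (monom a)
  have eq: "partial_deriv i (monom_at a) y = real (a i) * monom_at (a(i := a i - 1)) y" for y
  proof -
    have "partial_deriv i (monom_at a) y = real (a i) * (y $ i) ^ (a i - 1) * (\<Prod>j\<in>UNIV - {i}. y $ j ^ a j)"
      unfolding partial_deriv_def by (intro DERIV_imp_deriv monom_at_upd_deriv)
    then show ?thesis
      by (auto simp: monom_at_remove[of _ y i] intro!: prod.cong)
  qed
  have form: "is_form (k - 1) (\<lambda>y. real (a i) * monom_at (a(i := a i - 1)) y)"
  proof (cases "a i = 0")
    case True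
    then show ?thesis using is_form_0 by simp
  next
    case False
    have "sum (a(i := a i - 1)) (UNIV - {i}) = sum a (UNIV - {i})"
      by (intro sum.cong) auto
    moreover have "sum a UNIV = a i + sum a (UNIV - {i})" by (simp add: sum.remove)
    moreover have "sum (a(i := a i - 1)) UNIV = a i - 1 + sum (a(i := a i - 1)) (UNIV - {i})"
      by (subst sum.remove[of UNIV i]) simp_all
    ultimately have "a(i := a i - 1) \<in> exponents (k - 1)"
      using monom False by (simp add: exponents_def)
    then show ?thesis by (intro is_form_scale is_form_monom)
  qed
  have "partial_deriv i (monom_at a) = (\<lambda>y. real (a i) * monom_at (a(i := a i - 1)) y)"
    using eq by (intro ext)
  with form show ?case by simp
qed

lemma is_form_euler:
  assumes "is_form k f"
  shows "is_form k (\<lambda>y. y $ i * partial_deriv i f y)"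
  using assms
proof (induction rule: is_form_induct)
  case zero
  then show ?case using is_form_0 by (simp add: partial_deriv_zero)
next
  case (add f g)
  have "(\<lambda>y. y $ i * partial_deriv i (\<lambda>y. f y + g y) y) = (\<lambda>y. y $ i * partial_deriv i f y + y $ i * partial_deriv i g y)"
    using partial_deriv_add[OF add(1,2)] by (simp add: algebra_simps)
  then show ?case using add by (simp add: is_form_add)
next
  case (scale r f)
  have "(\<lambda>y. y $ i * partial_deriv i (\<lambda>y. r * f y) y) = (\<lambda>y. r * (y $ i * partial_deriv i f y))"
    using partial_deriv_scale[OF scale(1)] by (simp add: algebra_simps)
  then show ?case using is_form_scale[OF scale(2), of r] by simp
next
  case (monom a)
  then show ?case by (simp add: euler_monom is_form_scale is_form_monom)
qed

lemma euler_identity: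
  assumes "is_form k f"
  shows "(\<Sum>i\<in>UNIV. y $ i * partial_deriv i f y) = real k * f y"
  using assms
proof (induction rule: is_form_induct)
  case (add f g)
  then show ?case by (simp add: partial_deriv_add[OF add(1,2)] algebra_simps sum.distrib)
next
  case (scale r f)
  then show ?case by (simp add: partial_deriv_scale[OF scale(1)] mult.left_commute sum_distrib_left[symmetric])
next
  case (monom a)
  then show ?case
    by (simp add: euler_monom sum_distrib_right[symmetric] of_nat_sum[symmetric] exponents_def del: of_nat_sum)
qed (simp add: partial_deriv_zero)

lemma sum_offdiag_swap:
  fixes F :: "'q::finite \<Rightarrow> 'q \<Rightarrow> real"
  shows "(\<Sum>i\<in>UNIV. \<Sum>j\<in>UNIV - {i}. F i j) = (\<Sum>i\<in>UNIV. \<Sum>j\<in>UNIV - {i}. F j i)"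
proof -
  have off: "(\<Sum>j\<in>UNIV - {i}. G j) = (\<Sum>j\<in>UNIV. if j = i then 0 else G j)" for G :: "'q \<Rightarrow> real" and i
    by (rule sum.mono_neutral_cong_left) auto
  show ?thesis
    unfolding off by (subst sum.swap) (simp add: eq_commute)
qed

text \<open>On the symmetric form \<open>f\<close> the operator of \<open>i\<close> is the Euler derivative \<open>e\<^sub>i = y\<^sub>i \<partial>\<^sub>i\<close> plus a constant.  The form
  \<open>e\<^sub>i f\<close> is no longer symmetric: the second application produces the divided differences of the \<open>e\<^sub>i f\<close>,
  whose sum over all pairs is the first-order part of the Laplace-Beltrami operator, and everything else reduces to
  Euler's identity.  The forms \<open>h i\<close> carry the values of the operators at generic points.\<close>

lemma sum_cherednik_squares:
  fixes f :: "real^'q::finite \<Rightarrow> real"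
  assumes f: "is_form k f" and sym: "\<And>i j y. f (permute (sw i j) y) = f y"
    and h: "\<And>i. is_form k (h i)" "\<And>i y. generic y \<Longrightarrow> cherednik i f y = h i y" and y: "generic y"
  shows "(\<Sum>i\<in>UNIV. cherednik i (h i) y)
    = laplace_beltrami f y + (real k + (\<Sum>i\<in>(UNIV::'q set). (real (card {j::'q. idx i < idx j}))\<^sup>2) / 4) * f y"
proof -
  define e where "e = (\<lambda>i y. y $ i * partial_deriv i f y)"
  define n where "n = (\<lambda>i::'q. real (card {j::'q. idx i < idx j}))"
  have e: "is_form k (e i)" for i
    unfolding e_def by (rule is_form_euler[OF f])
  have chf: "cherednik i f y = e i y + n i / 2 * f y" for i y
    by (simp add: cherednik_def sym e_def n_def)
  have heq: "h i = (\<lambda>y. e i y + n i / 2 * f y)" for i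
  proof (rule is_form_eqI[OF h(1)])
    show "is_form k (\<lambda>y. e i y + n i / 2 * f y)"
      by (intro is_form_add e is_form_scale f)
    show "h i z = e i z + n i / 2 * f z" if "generic z" for z
      using h(2)[OF that, of i] chf[of i z] by linarith
  qed
  have esw: "e i (permute (sw i j) y) = e j y" for i j and y :: "real^'q"
    using partial_deriv_permute[of "sw i j" i f y] by (simp add: e_def sym)
  have de: "y $ i * partial_deriv i (e i) y = (y $ i)\<^sup>2 * partial_deriv i (partial_deriv i f) y + e i y" for i
    unfolding e_def partial_deriv_mult_var[OF is_form_partial_deriv[OF f]] by (simp add: power2_eq_square algebra_simps)
  have che: "cherednik i (e i) y = (y $ i)\<^sup>2 * partial_deriv i (partial_deriv i f) y + e i y
     + (\<Sum>j\<in>UNIV - {i}. y $ i * (e i y - e j y) / (y $ i - y $ j)) / 2 + (\<Sum>j | idx i < idx j. e j y) / 2" for i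
    unfolding cherednik_def de esw ..
  have chh: "cherednik i (h i) y = cherednik i (e i) y + n i / 2 * e i y + (n i)\<^sup>2 / 4 * f y" for i
    unfolding heq cherednik_add[OF e is_form_scale[OF f]] cherednik_scale[OF f] chf
    by (simp add: algebra_simps power2_eq_square)
  have sume: "(\<Sum>i\<in>UNIV. e i y) = real k * f y"
    unfolding e_def by (rule euler_identity[OF f])
  define S where "S = (\<Sum>i\<in>UNIV. \<Sum>j\<in>UNIV - {i}. y $ i * e i y / (y $ i - y $ j))"
  have cross: "(\<Sum>i\<in>UNIV. \<Sum>j\<in>UNIV - {i}. y $ i * e j y / (y $ i - y $ j)) = - S + (real CARD('q) - 1) * (real k * f y)"
  proof -
    have "(\<Sum>i\<in>UNIV. \<Sum>j\<in>UNIV - {i}. y $ i * e j y / (y $ i - y $ j))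
        = (\<Sum>i\<in>UNIV. \<Sum>j\<in>UNIV - {i}. y $ j * e i y / (y $ j - y $ i))"
      by (rule sum_offdiag_swap)
    also have "\<dots> = (\<Sum>i\<in>UNIV. \<Sum>j\<in>UNIV - {i}. - (y $ i * e i y / (y $ i - y $ j)) + e i y)"
    proof (intro sum.cong refl)
      fix i j :: 'q assume "j \<in> UNIV - {i}"
      then have "y $ i - y $ j \<noteq> 0" "y $ j - y $ i \<noteq> 0"
        using y by (auto simp: generic_nth_eq_iff)
      then show "y $ j * e i y / (y $ j - y $ i) = - (y $ i * e i y / (y $ i - y $ j)) + e i y"
        by (simp add: field_simps)
    qed
    also have "\<dots> = - S + (real CARD('q) - 1) * (\<Sum>i\<in>UNIV. e i y)"
    proof -
      have "real (CARD('q) - 1) = real CARD('q) - 1"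
        by (simp add: of_nat_diff Suc_leI)
      then show ?thesis
        by (simp add: S_def sum_subtractf card_Diff_singleton sum_distrib_left)
    qed
    finally show ?thesis by (simp only: sume)
  qed
  have "(\<Sum>i\<in>UNIV. \<Sum>j\<in>UNIV - {i}. y $ i * (e i y - e j y) / (y $ i - y $ j))
      = S - (\<Sum>i\<in>UNIV. \<Sum>j\<in>UNIV - {i}. y $ i * e j y / (y $ i - y $ j))"
    unfolding S_def by (simp add: sum_subtractf[symmetric] diff_divide_distrib algebra_simps)
  then have pairs: "(\<Sum>i\<in>UNIV. \<Sum>j\<in>UNIV - {i}. y $ i * (e i y - e j y) / (y $ i - y $ j))
      = 2 * S - (real CARD('q) - 1) * (real k * f y)"
    by (simp add: cross)
  have tails: "(\<Sum>i\<in>(UNIV::'q set). \<Sum>j | idx i < idx j. e j y) + (\<Sum>i\<in>UNIV. n i * e i y) = (real CARD('q) - 1) * (real k * f y)"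
  proof -
    have "(\<Sum>i\<in>(UNIV::'q set). \<Sum>j | idx i < idx j. e j y) = (\<Sum>i\<in>UNIV. \<Sum>j\<in>UNIV. if idx (i::'q) < idx j then e j y else 0)"
      by (rule sum.cong[OF refl], rule sum.mono_neutral_cong_left) auto
    also have "\<dots> = (\<Sum>j\<in>UNIV. \<Sum>i\<in>UNIV. if idx (i::'q) < idx j then e j y else 0)"
      by (rule sum.swap)
    also have "\<dots> = (\<Sum>j\<in>UNIV. real (card {i::'q. idx i < idx j}) * e j y)"
      by (intro sum.cong refl) (simp add: sum.If_cases)
    finally have 1: "(\<Sum>i\<in>(UNIV::'q set). \<Sum>j | idx i < idx j. e j y) = \<dots>" .
    have "real (card {i::'q. idx i < idx j}) + n j = real CARD('q) - 1" for j :: 'q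
    proof -
      have part: "UNIV = insert j ({i::'q. idx i < idx j} \<union> {i. idx j < idx i})"
        using idx_eq_iff[of j] by (auto simp: set_eq_iff) (metis idx_eq_iff nat_neq_iff)
      have "CARD('q) = Suc (card ({i::'q. idx i < idx j} \<union> {i. idx j < idx i}))"
        by (subst part, subst card_insert_disjoint) auto
      also have "card ({i::'q. idx i < idx j} \<union> {i. idx j < idx i}) = card {i::'q. idx i < idx j} + card {i::'q. idx j < idx i}"
        by (intro card_Un_disjoint) auto
      finally show ?thesis by (simp add: n_def)
    qed
    then have "(\<Sum>j\<in>UNIV. real (card {i::'q. idx i < idx j}) * e j y) + (\<Sum>i\<in>UNIV. n i * e i y)
        = (\<Sum>j\<in>UNIV. (real CARD('q) - 1) * e j y)"
      by (simp only: sum.distrib[symmetric] distrib_right[symmetric])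
    then show ?thesis
      unfolding 1 by (simp only: sum_distrib_left[symmetric] sume)
  qed
  have lap: "laplace_beltrami f y = (\<Sum>i\<in>UNIV. (y $ i)\<^sup>2 * partial_deriv i (partial_deriv i f) y) + S"
    unfolding laplace_beltrami_def S_def e_def by (simp add: power2_eq_square mult_ac)
  have "(\<Sum>i\<in>UNIV. cherednik i (h i) y) = (\<Sum>i\<in>UNIV. (y $ i)\<^sup>2 * partial_deriv i (partial_deriv i f) y)
     + (\<Sum>i\<in>UNIV. e i y)
     + (\<Sum>i\<in>UNIV. \<Sum>j\<in>UNIV - {i}. y $ i * (e i y - e j y) / (y $ i - y $ j)) / 2
     + ((\<Sum>i\<in>(UNIV::'q set). \<Sum>j | idx i < idx j. e j y) + (\<Sum>i\<in>UNIV. n i * e i y)) / 2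
     + (\<Sum>i\<in>UNIV. (n i)\<^sup>2) / 4 * f y"
    unfolding chh che
    by (simp add: sum.distrib sum_divide_distrib[symmetric] sum_distrib_right[symmetric] add_divide_distrib)
  also have "\<dots> = laplace_beltrami f y + (real k + (\<Sum>i\<in>UNIV. (n i)\<^sup>2) / 4) * f y"
    unfolding pairs tails sume lap by (simp add: field_simps)
  finally show ?thesis by (simp add: n_def)
qed

section \<open>The zonal family\<close>

lemma rearranges_comp:
  assumes "bij \<pi>"
  shows "rearranges (a \<circ> \<pi>) \<kappa> \<longleftrightarrow> rearranges a \<kappa>"
proof -
  have "image_mset \<pi> (mset_set UNIV) = mset_set UNIV"
    using assms image_mset_mset_set[of \<pi> UNIV] by (simp add: bij_def)
  then show ?thesis
    unfolding rearranges_def by (metis multiset.map_comp)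
qed

lemma rearranges_eq_comp:
  fixes a b :: "'q::finite \<Rightarrow> nat"
  assumes "rearranges a \<kappa>" "rearranges b \<kappa>"
  shows "\<exists>\<pi>. bij \<pi> \<and> a = b \<circ> \<pi>"
proof -
  have "image_mset a (mset_set UNIV) = image_mset b (mset_set UNIV)"
    using assms by (simp add: rearranges_def)
  from image_mset_eq_implies_permutes[OF finite this] obtain \<pi> where
    "\<pi> permutes UNIV" "\<And>x. a x = b (\<pi> x)" by auto
  then show ?thesis
    by (intro exI[of _ \<pi>]) (auto simp: permutes_bij fun_eq_iff)
qed

lemma rearranges_exponents:
  fixes a :: "'q::finite \<Rightarrow> nat"
  assumes "rearranges a \<kappa>" "sum_list \<kappa> = k"
  shows "a \<in> exponents k"
proof -
  have "sum_mset (image_mset a (mset_set UNIV)) = sum_list \<kappa>"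
    using assms(1) by (simp add: rearranges_def sum_mset_sum_list)
  then show ?thesis
    using assms(2) by (simp add: exponents_def sum_unfold_sum_mset)
qed

lemma rearranges_nth_idx:
  assumes "length \<kappa> = CARD('q::finite)"
  shows "rearranges (\<lambda>i::'q. \<kappa> ! idx i) \<kappa>"
proof -
  have "image_mset (\<lambda>i::'q. \<kappa> ! idx i) (mset_set UNIV) = image_mset ((!) \<kappa>) (image_mset idx (mset_set (UNIV :: 'q set)))"
    by (simp add: multiset.map_comp o_def)
  also have "image_mset idx (mset_set (UNIV :: 'q set)) = mset_set {..<CARD('q)}"
    using bij_idx[where 'q = 'q] by (subst image_mset_mset_set) (auto simp: bij_betw_def)
  also have "mset_set {..<CARD('q)} = mset [0..<CARD('q)]"
    by (simp add: lessThan_atLeast0)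
  also have "image_mset ((!) \<kappa>) (mset [0..<CARD('q)]) = mset \<kappa>"
    using map_nth[of \<kappa>] assms by (metis mset_map)
  finally show ?thesis by (simp add: rearranges_def)
qed

lemma sum_antitone_le_initial:
  fixes f :: "nat \<Rightarrow> nat"
  assumes "finite N" "\<And>m n. m \<le> n \<Longrightarrow> n \<in> N \<Longrightarrow> f n \<le> f m"
  shows "(\<Sum>n\<in>N. f n) \<le> (\<Sum>n<card N. f n)"
  using assms
proof (induction "card N" arbitrary: N)
  case (Suc c)
  then have ne: "N \<noteq> {}" by auto
  define m where "m = Max N"
  have m: "m \<in> N" using Suc.prems(1) ne by (simp add: m_def)
  have c: "card (N - {m}) = c" using Suc m by simp
  have "N \<subseteq> {..m}" using Suc.prems(1) by (auto simp: m_def)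
  then have "card N \<le> Suc m" using card_mono[of "{..m}" N] by simp
  then have "c \<le> m" using Suc.hyps(2) by simp
  then have "f m \<le> f c" using Suc.prems(2) m by blast
  moreover have "(\<Sum>n\<in>N - {m}. f n) \<le> (\<Sum>n<c. f n)"
    using Suc.hyps(1)[of "N - {m}"] Suc.prems c by auto
  ultimately show ?case
    using m Suc.prems(1) Suc.hyps(2)[symmetric] by (simp add: sum.remove)
qed simp

lemma dom_rearranges_dominated:
  fixes a \<eta> :: "'q::finite \<Rightarrow> nat"
  assumes \<eta>: "rearranges \<eta> \<kappa>" and \<kappa>: "length \<kappa> = CARD('q)" "sorted_wrt (\<ge>) \<kappa>" and "dom a \<eta>"
  shows "dominated a \<kappa>"
proof -
  have top: "(\<Sum>i\<in>J. \<eta> i) \<le> sum_list (take (card J) \<kappa>)" for J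
  proof -
    obtain \<pi> :: "'q \<Rightarrow> 'q" where \<pi>: "bij \<pi>" "\<eta> = (\<lambda>i. \<kappa> ! idx i) \<circ> \<pi>"
      using rearranges_eq_comp[OF \<eta> rearranges_nth_idx[OF \<kappa>(1)]] by blast
    define N where "N = (idx \<circ> \<pi>) ` J"
    have inj: "inj_on (idx \<circ> \<pi>) J"
      using \<pi>(1) by (auto simp: inj_on_def bij_def inj_def)
    have N: "card N = card J" "N \<subseteq> {..<CARD('q)}"
      unfolding N_def using card_image[OF inj] idx_less[where 'q = 'q] by auto
    have "(\<Sum>i\<in>J. \<eta> i) = (\<Sum>n\<in>N. \<kappa> ! n)"
      unfolding N_def by (subst sum.reindex[OF inj]) (simp add: \<pi>(2))
    also have "\<dots> \<le> (\<Sum>n<card N. \<kappa> ! n)"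
    proof (rule sum_antitone_le_initial)
      show "\<kappa> ! n \<le> \<kappa> ! m" if "m \<le> n" "n \<in> N" for m n
        using that N(2) \<kappa> sorted_wrt_nth_less[of "(\<ge>)" \<kappa> m n] by (cases "m = n") auto
    qed (simp add: N_def)
    also have "\<dots> = sum_list (take (card J) \<kappa>)"
    proof -
      have "card J \<le> length \<kappa>" using \<kappa>(1) card_mono[of UNIV J] by simp
      then show ?thesis
        unfolding N(1) sum_list_sum_nth by (intro sum.cong) (auto simp: lessThan_atLeast0)
    qed
    finally show ?thesis .
  qed
  show ?thesis
    unfolding dominated_def
  proof
    fix J
    obtain J' where "card J' = card J" "(\<Sum>i\<in>J. a i) \<le> (\<Sum>i\<in>J'. \<eta> i)"
      using \<open>dom a \<eta>\<close> by (auto simp: dom_def)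
    then show "(\<Sum>i\<in>J. a i) \<le> sum_list (take (card J) \<kappa>)"
      using top[of J'] by simp
  qed
qed

definition arrangements :: "nat list \<Rightarrow> ('q::finite \<Rightarrow> nat) set" where
  "arrangements \<kappa> = {\<eta> \<in> exponents (sum_list \<kappa>). rearranges \<eta> \<kappa>}"

definition zonal_form :: "nat list \<Rightarrow> real^'q::finite \<Rightarrow> real" where
  "zonal_form \<kappa> y = (\<Sum>\<eta>\<in>arrangements \<kappa>. trace_component (sum_list \<kappa>) \<eta> y)"

lemma finite_arrangements [simp]: "finite (arrangements \<kappa> :: ('q::finite \<Rightarrow> nat) set)"
  by (simp add: arrangements_def)

lemma arrangements_comp: "bij \<pi> \<Longrightarrow> \<eta> \<circ> \<pi> \<in> arrangements \<kappa> \<longleftrightarrow> \<eta> \<in> arrangements \<kappa>"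
  for \<pi> :: "'q::finite \<Rightarrow> 'q"
  by (simp add: arrangements_def exponents_comp rearranges_comp)

lemma is_form_zonal: "is_form (sum_list \<kappa>) (zonal_form \<kappa>)"
  unfolding zonal_form_def[abs_def]
  by (intro is_form_sum eigenform_is_form[OF eigenform_component]) (simp add: arrangements_def)

text \<open>In the sum of \<open>component_swap\<close> over the rearrangements of \<open>\<kappa>\<close> the correction terms cancel.\<close>

lemma zonal_form_swap:
  fixes i :: "'q::finite"
  assumes "adjacent i j"
  shows "zonal_form \<kappa> (permute (sw i j) y) = zonal_form \<kappa> y"
proof -
  let ?g = "trace_component (sum_list \<kappa>) :: ('q \<Rightarrow> nat) \<Rightarrow> real^'q \<Rightarrow> real"
  let ?A = "arrangements \<kappa> :: ('q \<Rightarrow> nat) set"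
  let ?s = "sw i j"
  have inv: "\<eta> \<circ> ?s \<in> ?A \<longleftrightarrow> \<eta> \<in> ?A" for \<eta> by (rule arrangements_comp) simp
  have "zonal_form \<kappa> y = (\<Sum>\<eta>\<in>?A. ?g (\<eta> \<circ> ?s) (permute ?s y) + swap_coeff i j (\<eta> \<circ> ?s) * ?g (\<eta> \<circ> ?s) y - swap_coeff i j \<eta> * ?g \<eta> y)"
    unfolding zonal_form_def
    by (intro sum.cong refl component_swap[OF assms]) (simp add: arrangements_def)
  also have "\<dots> = (\<Sum>\<eta>\<in>?A. ?g (\<eta> \<circ> ?s) (permute ?s y)) + (\<Sum>\<eta>\<in>?A. swap_coeff i j (\<eta> \<circ> ?s) * ?g (\<eta> \<circ> ?s) y)
      - (\<Sum>\<eta>\<in>?A. swap_coeff i j \<eta> * ?g \<eta> y)"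
    by (simp add: sum.distrib sum_subtractf)
  also have "(\<Sum>\<eta>\<in>?A. swap_coeff i j (\<eta> \<circ> ?s) * ?g (\<eta> \<circ> ?s) y) = (\<Sum>\<eta>\<in>?A. swap_coeff i j \<eta> * ?g \<eta> y)"
    by (rule sum_comp_invariant[where h = "\<lambda>\<eta>. swap_coeff i j \<eta> * ?g \<eta> y", OF _ inv]) simp
  also have "(\<Sum>\<eta>\<in>?A. ?g (\<eta> \<circ> ?s) (permute ?s y)) = (\<Sum>\<eta>\<in>?A. ?g \<eta> (permute ?s y))"
    by (rule sum_comp_invariant[where h = "\<lambda>\<eta>. ?g \<eta> (permute ?s y)", OF _ inv]) simp
  finally show ?thesis by (simp add: zonal_form_def)
qed

lemma zonal_form_permute:
  fixes \<pi> :: "'q::finite \<Rightarrow> 'q"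
  assumes "bij \<pi>"
  shows "zonal_form \<kappa> (permute \<pi> y) = zonal_form \<kappa> y"
proof -
  have "\<forall>y::real^'q. zonal_form \<kappa> (permute \<pi> y) = zonal_form \<kappa> y"
    using assms
  proof (rule transpose_adjacent_induct[rotated 3])
    fix \<pi> \<rho> :: "'q \<Rightarrow> 'q"
    assume "\<forall>y::real^'q. zonal_form \<kappa> (permute \<pi> y) = zonal_form \<kappa> y"
      "\<forall>y::real^'q. zonal_form \<kappa> (permute \<rho> y) = zonal_form \<kappa> y"
    then show "\<forall>y::real^'q. zonal_form \<kappa> (permute (\<pi> \<circ> \<rho>) y) = zonal_form \<kappa> y"
      by (simp flip: permute_permute)
  next
    show "\<forall>y::real^'q. zonal_form \<kappa> (permute id y) = zonal_form \<kappa> y" by simp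
  next
    fix i j :: 'q assume "adjacent i j"
    then show "\<forall>y::real^'q. zonal_form \<kappa> (permute (sw i j) y) = zonal_form \<kappa> y"
      by (simp add: zonal_form_swap)
  qed
  then show ?thesis by blast
qed

text \<open>The eigenvalue of the sum of the squares of the Cherednik operators.\<close>

definition spectrum_norm :: "('q::finite \<Rightarrow> nat) \<Rightarrow> real" where
  "spectrum_norm \<eta> = (\<Sum>i\<in>UNIV. (spectrum \<eta> i)\<^sup>2)"

lemma spectrum_norm_comp:
  fixes \<pi> :: "'q::finite \<Rightarrow> 'q"
  assumes "bij \<pi>"
  shows "spectrum_norm (\<eta> \<circ> \<pi>) = spectrum_norm \<eta>"
proof -
  have "\<forall>\<eta>::'q \<Rightarrow> nat. spectrum_norm (\<eta> \<circ> \<pi>) = spectrum_norm \<eta>"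
    using assms
  proof (rule transpose_adjacent_induct[rotated 3])
    fix \<pi> \<rho> :: "'q \<Rightarrow> 'q"
    assume 1: "\<forall>\<eta>::'q \<Rightarrow> nat. spectrum_norm (\<eta> \<circ> \<pi>) = spectrum_norm \<eta>"
      and 2: "\<forall>\<eta>::'q \<Rightarrow> nat. spectrum_norm (\<eta> \<circ> \<rho>) = spectrum_norm \<eta>"
    show "\<forall>\<eta>::'q \<Rightarrow> nat. spectrum_norm (\<eta> \<circ> (\<pi> \<circ> \<rho>)) = spectrum_norm \<eta>"
      unfolding comp_assoc[symmetric] using 1 2 by metis
  next
    show "\<forall>\<eta>::'q \<Rightarrow> nat. spectrum_norm (\<eta> \<circ> id) = spectrum_norm \<eta>"
      unfolding comp_id by simp
  next
    fix i j :: 'q assume ij: "adjacent i j"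
    show "\<forall>\<eta>::'q \<Rightarrow> nat. spectrum_norm (\<eta> \<circ> sw i j) = spectrum_norm \<eta>"
    proof
      fix \<eta> :: "'q \<Rightarrow> nat"
      show "spectrum_norm (\<eta> \<circ> sw i j) = spectrum_norm \<eta>"
      proof (cases "\<eta> i = \<eta> j")
        case True
        then have "\<eta> \<circ> sw i j = \<eta>" by (auto simp: fun_eq_iff Transposition.transpose_def)
        then show ?thesis by simp
      next
        case False
        have "(\<Sum>l\<in>UNIV. (spectrum \<eta> (sw i j l))\<^sup>2) = (\<Sum>l\<in>UNIV. (spectrum \<eta> l)\<^sup>2)"
          by (rule sum.reindex_bij_betw) simp
        then show ?thesis
          by (simp add: spectrum_norm_def spectrum_swap[OF ij False])
      qed
    qed
  qed
  then show ?thesis by blast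
qed

text \<open>All components have the same \<open>spectrum_norm\<close>, since their exponents are rearrangements of each other.\<close>

lemma zonal_form_laplace:
  "\<exists>r. \<forall>y. generic y \<longrightarrow> laplace_beltrami (zonal_form \<kappa>) y = r * zonal_form \<kappa> (y :: real^'q::finite)"
proof -
  let ?k = "sum_list \<kappa>"
  let ?g = "trace_component ?k :: ('q \<Rightarrow> nat) \<Rightarrow> real^'q \<Rightarrow> real"
  let ?A = "arrangements \<kappa> :: ('q \<Rightarrow> nat) set"
  obtain \<rho> where \<rho>: "\<And>\<eta>. \<eta> \<in> ?A \<Longrightarrow> spectrum_norm \<eta> = \<rho>"
  proof -
    have "spectrum_norm \<eta> = spectrum_norm \<mu>" if "\<eta> \<in> ?A" "\<mu> \<in> ?A" for \<eta> \<mu>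
    proof -
      have "rearranges \<eta> \<kappa>" "rearranges \<mu> \<kappa>" using that by (auto simp: arrangements_def)
      from rearranges_eq_comp[OF this] obtain \<pi> where "bij \<pi>" "\<eta> = \<mu> \<circ> \<pi>" by blast
      then show ?thesis using spectrum_norm_comp by blast
    qed
    then show ?thesis using that by (cases "?A = {}") blast+
  qed
  have ex: "\<eta> \<in> exponents ?k" if "\<eta> \<in> ?A" for \<eta>
    using that by (simp add: arrangements_def)
  have gf: "is_form ?k (?g \<eta>)" if "\<eta> \<in> ?A" for \<eta>
    by (rule eigenform_is_form[OF eigenform_component[OF ex[OF that]]])
  define h where "h = (\<lambda>i y. \<Sum>\<eta>\<in>?A. spectrum \<eta> i * ?g \<eta> y)"
  have hf: "is_form ?k (h i)" for i
    unfolding h_def by (intro is_form_sum is_form_scale gf)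
  have zf: "zonal_form \<kappa> = (\<lambda>y. \<Sum>\<eta>\<in>?A. ?g \<eta> y)"
    by (simp add: fun_eq_iff zonal_form_def)
  have ch: "cherednik i (zonal_form \<kappa>) y = h i y" if y: "generic y" for i and y :: "real^'q"
  proof -
    have "cherednik i (zonal_form \<kappa>) y = (\<Sum>\<eta>\<in>?A. cherednik i (?g \<eta>) y)"
      unfolding zf by (rule cherednik_sum[OF gf])
    also have "\<dots> = h i y"
      unfolding h_def by (intro sum.cong refl eigenform_eq[OF eigenform_component[OF ex] y])
    finally show ?thesis .
  qed
  have chh: "cherednik i (h i) y = (\<Sum>\<eta>\<in>?A. (spectrum \<eta> i)\<^sup>2 * ?g \<eta> y)" if y: "generic y" for i and y :: "real^'q"
  proof -
    have "cherednik i (h i) y = (\<Sum>\<eta>\<in>?A. cherednik i (\<lambda>y. spectrum \<eta> i * ?g \<eta> y) y)"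
      unfolding h_def by (rule cherednik_sum[OF is_form_scale[OF gf]])
    also have "\<dots> = (\<Sum>\<eta>\<in>?A. (spectrum \<eta> i)\<^sup>2 * ?g \<eta> y)"
      by (intro sum.cong refl)
         (simp add: cherednik_scale[OF gf] eigenform_eq[OF eigenform_component[OF ex] y] power2_eq_square)
    finally show ?thesis .
  qed
  have sum: "(\<Sum>i\<in>UNIV. cherednik i (h i) y) = \<rho> * zonal_form \<kappa> y" if y: "generic y" for y
  proof -
    have "(\<Sum>i\<in>UNIV. cherednik i (h i) y) = (\<Sum>\<eta>\<in>?A. spectrum_norm \<eta> * ?g \<eta> y)"
      unfolding chh[OF y] by (subst sum.swap) (simp add: spectrum_norm_def sum_distrib_right)
    also have "\<dots> = \<rho> * zonal_form \<kappa> y"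
      unfolding zf sum_distrib_left by (intro sum.cong refl) (simp add: \<rho>)
    finally show ?thesis .
  qed
  have sym: "zonal_form \<kappa> (permute (sw i j) y) = zonal_form \<kappa> y" for i j and y :: "real^'q"
    by (rule zonal_form_permute) simp
  define N where "N = (\<Sum>i\<in>(UNIV::'q set). (real (card {j::'q. idx i < idx j}))\<^sup>2) / 4"
  have "laplace_beltrami (zonal_form \<kappa>) y = (\<rho> - (real ?k + N)) * zonal_form \<kappa> y" if y: "generic y" for y :: "real^'q"
    using sum_cherednik_squares[OF is_form_zonal[of \<kappa>] sym hf ch y] sum[OF y]
    by (simp add: N_def algebra_simps)
  then show ?thesis by blast
qed

text \<open>The exponents of a component are lower than its own exponent, which is a rearrangement of \<open>\<kappa>\<close>.  A rearrangement with
  the large entries at the earliest indices is not lower than any other one, so its coefficient comes from its own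
  component alone, where it is nonzero because that component is nonzero.\<close>

lemma zonal_form_coeffs:
  fixes \<kappa> :: "nat list"
  assumes \<kappa>: "\<kappa> \<in> partitions_of CARD('q::finite) k"
  shows "\<exists>c. symmetric_form k c (zonal_form \<kappa> :: real^'q \<Rightarrow> real) \<and>
             (\<forall>a\<in>exponents k. rearranges a \<kappa> \<longrightarrow> c a \<noteq> 0) \<and>
             (\<forall>a\<in>exponents k. c a \<noteq> 0 \<longrightarrow> dominated a \<kappa>)"
proof -
  have len: "length \<kappa> = CARD('q)" and sorted: "sorted_wrt (\<ge>) \<kappa>" and k: "sum_list \<kappa> = k"
    using \<kappa> by (auto simp: partitions_of_def)
  let ?g = "trace_component k :: ('q \<Rightarrow> nat) \<Rightarrow> real^'q \<Rightarrow> real"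
  let ?A = "arrangements \<kappa> :: ('q \<Rightarrow> nat) set"
  have A: "\<eta> \<in> ?A \<longleftrightarrow> rearranges \<eta> \<kappa>" for \<eta>
    using rearranges_exponents[OF _ k] by (auto simp: arrangements_def k)
  have ex: "\<eta> \<in> exponents k" if "\<eta> \<in> ?A" for \<eta>
    using that by (simp add: arrangements_def k)
  have "\<exists>c. ?g \<eta> = form k c" if "\<eta> \<in> ?A" for \<eta>
    using eigenform_is_form[OF eigenform_component[OF ex[OF that]]] by (simp add: is_form_def)
  then obtain cc where cc: "\<And>\<eta>. \<eta> \<in> ?A \<Longrightarrow> ?g \<eta> = form k (cc \<eta>)" by metis
  have lead: "\<exists>b. b = \<eta> \<and> cc \<eta> b \<noteq> 0 \<and> (a = b \<or> lower a b)"
    if "\<eta> \<in> ?A" "a \<in> exponents k" "cc \<eta> a \<noteq> 0" for \<eta> a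
  proof -
    have "eigenform k (spectrum \<eta>) (form k (cc \<eta>))"
      using eigenform_component[OF ex[OF that(1)]] cc[OF that(1)] by simp
    from eigenform_leading[OF this that(2,3)] show ?thesis
      using spectrum_inj by metis
  qed
  define c where "c = (\<lambda>a. if a \<in> exponents k then \<Sum>\<eta>\<in>?A. cc \<eta> a else 0)"
  have zf: "zonal_form \<kappa> = form k c"
  proof
    fix y :: "real^'q"
    have "zonal_form \<kappa> y = (\<Sum>\<eta>\<in>?A. form k (cc \<eta>) y)"
      unfolding zonal_form_def k by (intro sum.cong refl) (simp add: cc)
    also have "\<dots> = form k c y"
      unfolding form_sum by (rule fun_cong[OF form_cong]) (simp add: c_def)
    finally show "zonal_form \<kappa> y = form k c y" .
  qed
  have c_comp: "c (a \<circ> \<pi>) = c a" if "bij \<pi>" for a \<pi>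
  proof (cases "a \<in> exponents k")
    case True
    show ?thesis
    proof (rule form_coeff_unique[OF _ True, where c = "\<lambda>a. c (a \<circ> \<pi>)"])
      show "form k (\<lambda>a. c (a \<circ> \<pi>)) y = form k c y" for y
        using zonal_form_permute[OF that, of \<kappa> y] form_permute[OF that, of k c y] by (simp add: zf)
    qed
  next
    case False
    then show ?thesis using exponents_comp[OF that, of a k] by (simp add: c_def)
  qed
  have "symmetric_form k c (zonal_form \<kappa>)"
    using c_comp by (auto simp: symmetric_form_def zf form_def monom_at_def)
  moreover have "dominated a \<kappa>" if a: "a \<in> exponents k" "c a \<noteq> 0" for a
  proof -
    obtain \<eta> where \<eta>: "\<eta> \<in> ?A" "cc \<eta> a \<noteq> 0"
      using a by (auto simp: c_def elim!: sum.not_neutral_contains_not_neutral)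
    then have "dom a \<eta>"
      using lead[OF \<eta>(1) a(1) \<eta>(2)] dom_refl by (auto simp: lower_def)
    then show ?thesis
      using dom_rearranges_dominated[OF _ len sorted] \<eta>(1) A by blast
  qed
  moreover have "c a \<noteq> 0" if a: "rearranges a \<kappa>" for a
  proof -
    have "finite ?A" "?A \<noteq> {}" using a A by auto
    \<comment> \<open>Large entries at early indices make the moment small, so \<open>a0\<close> is not lower than any other rearrangement.\<close>
    then obtain a0 where a0: "a0 \<in> ?A" "\<And>\<eta>. \<eta> \<in> ?A \<Longrightarrow> moment a0 \<le> moment \<eta>"
      by (metis (no_types, lifting) arg_min_if_finite(1) arg_min_least)
    have other: "cc \<eta> a0 = 0" if \<eta>: "\<eta> \<in> ?A" "\<eta> \<noteq> a0" for \<eta>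
    proof (rule ccontr)
      assume "cc \<eta> a0 \<noteq> 0"
      from lead[OF \<eta>(1) ex[OF a0(1)] this] \<eta>(2) have "lower a0 \<eta>" by auto
      moreover have "sqnorm a0 = sqnorm \<eta>"
      proof -
        have "rearranges a0 \<kappa>" "rearranges \<eta> \<kappa>" using a0(1) \<eta>(1) A by auto
        from rearranges_eq_comp[OF this] obtain \<pi> where "bij \<pi>" "a0 = \<eta> \<circ> \<pi>" by blast
        then show ?thesis using sqnorm_comp by blast
      qed
      ultimately show False
        using a0(2)[OF \<eta>(1)] by (simp add: lower_def)
    qed
    have "cc a0 a0 \<noteq> 0"
    proof -
      have "?g a0 \<noteq> (\<lambda>y. 0)" by (rule component_nonzero[OF ex[OF a0(1)]])
      then obtain b where "b \<in> exponents k" "cc a0 b \<noteq> 0"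
        using form_zero_iff[of k "cc a0"] cc[OF a0(1)] by auto
      from lead[OF a0(1) this] show ?thesis by auto
    qed
    moreover have "c a0 = cc a0 a0"
      using ex[OF a0(1)] a0(1) other by (simp add: c_def sum.remove)
    moreover obtain \<pi> where "bij \<pi>" "a = a0 \<circ> \<pi>"
      using rearranges_eq_comp[of a \<kappa> a0] a a0(1) A by blast
    ultimately show ?thesis using c_comp by simp
  qed
  ultimately show ?thesis by blast
qed

lemma finite_partitions_of: "finite (partitions_of q k)"
proof (rule finite_subset)
  show "partitions_of q k \<subseteq> {\<kappa>. set \<kappa> \<subseteq> {..k} \<and> length \<kappa> = q}"
    by (auto simp: partitions_of_def member_le_sum_list)
qed (rule finite_lists_length_eq, simp)

definition shape :: "('q::finite \<Rightarrow> nat) \<Rightarrow> nat list" where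
  "shape a = rev (sorted_list_of_multiset (image_mset a (mset_set UNIV)))"

lemma mset_shape: "mset (shape a) = image_mset a (mset_set UNIV)"
  by (simp add: shape_def)

lemma shape_partition: "a \<in> exponents k \<Longrightarrow> shape (a :: 'q::finite \<Rightarrow> nat) \<in> partitions_of CARD('q) k"
proof -
  assume a: "a \<in> exponents k"
  have "length (shape a) = CARD('q)"
    using arg_cong[OF mset_shape[of a], of size] by simp
  moreover have "sum_list (shape a) = k"
    using arg_cong[OF mset_shape[of a], of sum_mset] a by (simp add: sum_mset_sum_list exponents_def sum_unfold_sum_mset)
  moreover have "sorted_wrt (\<ge>) (shape a)"
    by (simp add: shape_def sorted_wrt_rev)
  ultimately show ?thesis by (simp add: partitions_of_def)
qed

lemma rearranges_iff_shape:
  fixes a :: "'q::finite \<Rightarrow> nat"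
  assumes "\<kappa> \<in> partitions_of CARD('q) k"
  shows "rearranges a \<kappa> \<longleftrightarrow> shape a = \<kappa>"
proof
  assume "rearranges a \<kappa>"
  then have "mset (rev \<kappa>) = mset (rev (shape a))" by (simp add: rearranges_def mset_shape)
  moreover have "sorted (rev \<kappa>)" "sorted (rev (shape a))"
    using assms by (auto simp: partitions_of_def shape_def sorted_wrt_rev)
  ultimately have "rev \<kappa> = rev (shape a)"
    by (metis properties_for_sort)
  then show "shape a = \<kappa>" by simp
qed (auto simp: rearranges_def mset_shape[symmetric])

lemma sum_zonal_form:
  "(\<Sum>\<kappa>\<in>partitions_of CARD('q) k. zonal_form \<kappa> y) = (\<Sum>i\<in>UNIV. (y :: real^'q::finite) $ i) ^ k"
proof -
  let ?E = "exponents k :: ('q \<Rightarrow> nat) set"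
  have "(\<Sum>\<kappa>\<in>partitions_of CARD('q) k. zonal_form \<kappa> y)
      = (\<Sum>\<kappa>\<in>partitions_of CARD('q) k. \<Sum>\<eta>\<in>{\<eta>\<in>?E. shape \<eta> = \<kappa>}. trace_component k \<eta> y)"
  proof (rule sum.cong[OF refl])
    fix \<kappa> assume \<kappa>: "\<kappa> \<in> partitions_of CARD('q) k"
    then have k: "sum_list \<kappa> = k" by (simp add: partitions_of_def)
    show "zonal_form \<kappa> y = (\<Sum>\<eta>\<in>{\<eta>\<in>?E. shape \<eta> = \<kappa>}. trace_component k \<eta> y)"
      unfolding zonal_form_def arrangements_def k rearranges_iff_shape[OF \<kappa>] ..
  qed
  also have "\<dots> = (\<Sum>\<eta>\<in>?E. trace_component k \<eta> y)"
    by (rule sum.group) (auto simp: finite_partitions_of shape_partition)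
  also have "\<dots> = (\<Sum>i\<in>UNIV. y $ i) ^ k"
    by (simp add: sum_component trace_power_def)
  finally show ?thesis .
qed

lemma zonal_family_exists: "zonal_family k (zonal_form :: nat list \<Rightarrow> real^'q::finite \<Rightarrow> real)"
  unfolding zonal_family_def
  using zonal_form_coeffs zonal_form_laplace sum_zonal_form by blast

section \<open>The zonal polynomial of a one-row partition\<close>

lemma euler_form: "y $ i * partial_deriv i (form k c) y = form k (\<lambda>a. real (a i) * c a) y"
proof -
  have sub: "is_form k (\<lambda>y. \<Sum>a\<in>A. c a * monom_at a y) \<and>
     y $ i * partial_deriv i (\<lambda>y. \<Sum>a\<in>A. c a * monom_at a y) y = (\<Sum>a\<in>A. real (a i) * c a * monom_at a y)"
    if "A \<subseteq> exponents k" for A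
    using finite_subset[OF that finite_exponents] that
  proof (induction A rule: finite_induct)
    case empty
    then show ?case using is_form_0 by (simp add: partial_deriv_zero)
  next
    case (insert a A)
    have a: "is_form k (\<lambda>y. c a * monom_at a y)"
      using insert by (intro is_form_scale is_form_monom) auto
    have A: "is_form k (\<lambda>y. \<Sum>a\<in>A. c a * monom_at a y)" and
      IH: "y $ i * partial_deriv i (\<lambda>y. \<Sum>a\<in>A. c a * monom_at a y) y = (\<Sum>a\<in>A. real (a i) * c a * monom_at a y)"
      using insert by auto
    have "partial_deriv i (\<lambda>y. c a * monom_at a y) y = c a * partial_deriv i (monom_at a) y"
      using insert by (intro partial_deriv_scale is_form_monom) auto
    then have "y $ i * partial_deriv i (\<lambda>y. c a * monom_at a y) y = real (a i) * c a * monom_at a y"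
      using euler_monom[of y i a] by (simp add: algebra_simps)
    then show ?case
      using IH insert.hyps is_form_add[OF a A] partial_deriv_add[OF a A, of i y] by (simp add: distrib_left)
  qed
  have "form k c = (\<lambda>y. \<Sum>a\<in>exponents k. c a * monom_at a y)"
    by (simp add: fun_eq_iff form_def)
  then show ?thesis
    using sub[OF order_refl] by (simp add: form_def)
qed

definition row_coeff :: "nat \<Rightarrow> real" where
  "row_coeff n = pochhammer (1/2) n / fact n"

lemma row_coeff_Suc: "real (Suc n) * row_coeff (Suc n) = (real n + 1/2) * row_coeff n"
  by (simp add: row_coeff_def pochhammer_Suc field_simps del: of_nat_Suc)

lemma row_coeff_pos: "row_coeff n > 0"
  by (simp add: row_coeff_def pochhammer_pos)

text \<open>The coefficients of \<open>\<Prod> (1 - x y\<^sub>i)^(-1/2)\<close> as a power series in \<open>x\<close>; \<open>row_coeff n\<close> is the coefficient of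
  \<open>x^n\<close> in \<open>(1 - x)^(-1/2)\<close>.\<close>

definition row_form :: "nat \<Rightarrow> real^'q::finite \<Rightarrow> real" where
  "row_form k = form k (\<lambda>a. \<Prod>i\<in>UNIV. row_coeff (a i))"

text \<open>The Euler-Poisson-Darboux equation \<open>2 (y\<^sub>i - y\<^sub>j) \<partial>\<^sub>i \<partial>\<^sub>j Z = \<partial>\<^sub>i Z - \<partial>\<^sub>j Z\<close> of the generating function, written with Euler
  derivatives.  In terms of coefficients it compares exponent vectors in which one unit has moved from \<open>j\<close> to
  \<open>i\<close>, that is, it follows from \<open>row_coeff_Suc\<close>.\<close>

lemma row_form_pair:
  fixes y :: "real^'q::finite"
  assumes "i \<noteq> j"
  defines "c \<equiv> (\<lambda>a. \<Prod>i\<in>UNIV. row_coeff (a i))"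
  shows "y $ i * form k (\<lambda>a. real (a i) * c a) y - y $ j * form k (\<lambda>a. real (a j) * c a) y
    = (y $ i - y $ j) * form k (\<lambda>a. (2 * real (a i) * real (a j) + real (a i) + real (a j)) * c a) y"
proof -
  have shift: "(\<Sum>a\<in>exponents k. c a * (real (a j) * (2 * real (a i) + 1)) * (y $ i * monom_at a y))
      = (\<Sum>a\<in>exponents k. c a * (real (a i) * (2 * real (a j) + 1)) * (y $ j * monom_at a y))"
    (is "?L = ?R")
  proof -
    let ?P = "{a \<in> exponents k. a j > 0}" and ?Q = "{a \<in> exponents k. a i > 0}"
    have "?L = (\<Sum>a\<in>?P. c a * (real (a j) * (2 * real (a i) + 1)) * (y $ i * monom_at a y))"
      by (rule sum.mono_neutral_right) auto
    also have "\<dots> = (\<Sum>a\<in>?Q. c a * (real (a i) * (2 * real (a j) + 1)) * (y $ j * monom_at a y))"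
    proof (rule sum.reindex_bij_witness[where i = "\<lambda>a. move a i j 1" and j = "\<lambda>a. move a j i 1"])
      fix a assume a: "a \<in> ?P"
      then have aj: "a j = Suc (a j - 1)" by simp
      show "move (move a j i 1) i j 1 = a"
        using a assms(1) by (auto simp: move_def fun_eq_iff)
      show "move a j i 1 \<in> ?Q"
        using a assms(1) move_exponents[of j i 1 a k] by (auto simp: move_def)
      let ?r = "\<Prod>l\<in>UNIV - {i, j}. row_coeff (a l)" and ?m = "\<Prod>l\<in>UNIV - {i, j}. y $ l ^ a l"
      have "(\<Prod>l\<in>UNIV - {i, j}. row_coeff (move a j i 1 l)) = ?r"
        "(\<Prod>l\<in>UNIV - {i, j}. y $ l ^ move a j i 1 l) = ?m"
        by (auto simp: move_def intro!: prod.cong)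
      then have c': "c (move a j i 1) = row_coeff (Suc (a i)) * row_coeff (a j - 1) * ?r"
        and m': "monom_at (move a j i 1) y = y $ i ^ Suc (a i) * y $ j ^ (a j - 1) * ?m"
        unfolding c_def monom_at_def prod_remove2[OF assms(1)] using assms(1) by (auto simp: move_def)
      have c: "c a = row_coeff (a i) * row_coeff (a j) * ?r" and m: "monom_at a y = y $ i ^ a i * y $ j ^ a j * ?m"
        unfolding c_def monom_at_def prod_remove2[OF assms(1)] by auto
      have mm: "y $ j * monom_at (move a j i 1) y = y $ i * monom_at a y"
        unfolding m m' by (subst (2) aj) (simp add: algebra_simps)
      have w1: "row_coeff (a j) * real (a j) = (real (a j) - 1/2) * row_coeff (a j - 1)"
        using row_coeff_Suc[of "a j - 1"] aj by (simp add: algebra_simps of_nat_diff)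
      have w2: "row_coeff (Suc (a i)) * real (Suc (a i)) = (real (a i) + 1/2) * row_coeff (a i)"
        using row_coeff_Suc[of "a i"] by (simp add: algebra_simps)
      have "c (move a j i 1) * (real (move a j i 1 i) * (2 * real (move a j i 1 j) + 1))
          = (row_coeff (Suc (a i)) * real (Suc (a i))) * (row_coeff (a j - 1) * (2 * real (a j) - 1)) * ?r"
        unfolding c' using assms(1) a by (simp add: move_def of_nat_diff algebra_simps)
      also have "\<dots> = (row_coeff (a j) * real (a j)) * (row_coeff (a i) * (2 * real (a i) + 1)) * ?r"
        unfolding w1 w2 by (simp add: field_simps)
      also have "\<dots> = c a * (real (a j) * (2 * real (a i) + 1))"
        unfolding c by simp
      finally show "c (move a j i 1) * (real (move a j i 1 i) * (2 * real (move a j i 1 j) + 1)) * (y $ j * monom_at (move a j i 1) y)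
          = c a * (real (a j) * (2 * real (a i) + 1)) * (y $ i * monom_at a y)"
        unfolding mm by simp
    next
      fix a assume a: "a \<in> ?Q"
      show "move (move a i j 1) j i 1 = a"
        using a assms(1) by (auto simp: move_def fun_eq_iff)
      show "move a i j 1 \<in> ?P"
        using a assms(1) move_exponents[of i j 1 a k] by (auto simp: move_def)
    qed
    also have "\<dots> = ?R"
      by (rule sum.mono_neutral_left) auto
    finally show ?thesis .
  qed
  have "(y $ i - y $ j) * form k (\<lambda>a. (2 * real (a i) * real (a j) + real (a i) + real (a j)) * c a) y
      - (y $ i * form k (\<lambda>a. real (a i) * c a) y - y $ j * form k (\<lambda>a. real (a j) * c a) y) = ?L - ?R"
    unfolding form_def by (simp add: sum_distrib_left sum_subtractf[symmetric] algebra_simps)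
  then show ?thesis unfolding shift by simp
qed

text \<open>By \<open>row_form_pair\<close> the singular terms of the pairs \<open>(i, j)\<close> and \<open>(j, i)\<close> add up to products of Euler
  derivatives.  The whole operator then becomes a polynomial in the sum of the Euler derivatives, which is \<open>k\<close>.\<close>

lemma laplace_row_form:
  fixes y :: "real^'q::finite"
  assumes y: "generic y"
  shows "laplace_beltrami (row_form k) y = (real k * (real k - 1) + real k * (real CARD('q) - 1)) * row_form k y"
proof -
  define c :: "('q \<Rightarrow> nat) \<Rightarrow> real" where "c = (\<lambda>a. \<Prod>i\<in>UNIV. row_coeff (a i))"
  have row: "row_form k = form k c" by (simp add: row_form_def c_def)
  let ?E = "\<lambda>i. form k (\<lambda>a. real (a i) * c a)"
  have E: "(\<lambda>y. y $ i * partial_deriv i (form k c) y) = ?E i" for i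
    by (rule ext) (rule euler_form)
  have second: "(y $ i)\<^sup>2 * partial_deriv i (partial_deriv i (form k c)) y
      = form k (\<lambda>a. real (a i) * (real (a i) * c a)) y - ?E i y" for i
  proof -
    have "y $ i * partial_deriv i (\<lambda>y. y $ i * partial_deriv i (form k c) y) y
        = (y $ i)\<^sup>2 * partial_deriv i (partial_deriv i (form k c)) y + y $ i * partial_deriv i (form k c) y"
      unfolding partial_deriv_mult_var[OF is_form_partial_deriv[OF is_form_form]]
      by (simp add: power2_eq_square algebra_simps)
    then show ?thesis unfolding E euler_form by simp
  qed
  have cross: "(\<Sum>i\<in>UNIV. \<Sum>j\<in>UNIV - {i}. (y $ i)\<^sup>2 / (y $ i - y $ j) * partial_deriv i (form k c) y)
      = (\<Sum>i\<in>UNIV. \<Sum>j\<in>UNIV - {i}. form k (\<lambda>a. (2 * real (a i) * real (a j) + real (a i) + real (a j)) * c a) y) / 2"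
  proof -
    let ?T = "\<Sum>i\<in>UNIV. \<Sum>j\<in>UNIV - {i}. y $ i * ?E i y / (y $ i - y $ j)"
    have T: "(\<Sum>i\<in>UNIV. \<Sum>j\<in>UNIV - {i}. (y $ i)\<^sup>2 / (y $ i - y $ j) * partial_deriv i (form k c) y) = ?T"
      unfolding euler_form[symmetric] by (simp add: power2_eq_square mult_ac)
    have "?T + ?T = ?T + (\<Sum>i\<in>UNIV. \<Sum>j\<in>UNIV - {i}. y $ j * ?E j y / (y $ j - y $ i))"
      using sum_offdiag_swap[of "\<lambda>i j. y $ i * ?E i y / (y $ i - y $ j)"] by simp
    also have "\<dots> = (\<Sum>i\<in>UNIV. \<Sum>j\<in>UNIV - {i}. y $ i * ?E i y / (y $ i - y $ j) + y $ j * ?E j y / (y $ j - y $ i))"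
      by (simp add: sum.distrib)
    also have "\<dots> = (\<Sum>i\<in>UNIV. \<Sum>j\<in>UNIV - {i}. form k (\<lambda>a. (2 * real (a i) * real (a j) + real (a i) + real (a j)) * c a) y)"
    proof (intro sum.cong refl)
      fix i j :: 'q assume ij: "j \<in> UNIV - {i}"
      then have nz: "y $ i - y $ j \<noteq> 0" "y $ j - y $ i \<noteq> 0"
        using y by (auto simp: generic_nth_eq_iff)
      have neg: "Y / (y $ j - y $ i) = - (Y / (y $ i - y $ j))" for Y
        using minus_divide_right[of Y "y $ i - y $ j"] by simp
      have "y $ i * ?E i y / (y $ i - y $ j) + y $ j * ?E j y / (y $ j - y $ i)
          = (y $ i * ?E i y - y $ j * ?E j y) / (y $ i - y $ j)"
        unfolding neg by (simp add: diff_divide_distrib)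
      also have "\<dots> = form k (\<lambda>a. (2 * real (a i) * real (a j) + real (a i) + real (a j)) * c a) y"
        using row_form_pair[of i j y k] ij nz by (simp add: c_def)
      finally show "y $ i * ?E i y / (y $ i - y $ j) + y $ j * ?E j y / (y $ j - y $ i) = \<dots>" .
    qed
    finally show ?thesis unfolding T by simp
  qed
  have count: "(\<Sum>i\<in>UNIV. (real (a i))\<^sup>2 - real (a i))
      + (\<Sum>i\<in>UNIV. \<Sum>j\<in>UNIV - {i}. 2 * real (a i) * real (a j) + real (a i) + real (a j)) / 2
      = real k * (real k - 1) + real k * (real CARD('q) - 1)" if a: "a \<in> exponents k" for a :: "'q \<Rightarrow> nat"
  proof -
    have k: "(\<Sum>i\<in>UNIV. real (a i)) = real k"
      using a by (simp add: exponents_def flip: of_nat_sum)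
    have rest: "(\<Sum>j\<in>UNIV - {i}. real (a j)) = real k - real (a i)" for i
      using sum.remove[of UNIV i "\<lambda>j. real (a j)"] k by simp
    have card: "real (CARD('q) - Suc 0) = real CARD('q) - 1"
      by (simp add: of_nat_diff Suc_leI)
    have inner: "(\<Sum>j\<in>UNIV - {i}. 2 * real (a i) * real (a j) + real (a i) + real (a j))
        = (2 * real k + real CARD('q) - 2) * real (a i) - 2 * (real (a i))\<^sup>2 + real k" for i
      unfolding sum.distrib sum_distrib_left[symmetric] rest
      by (simp add: card_Diff_singleton card power2_eq_square algebra_simps)
    have "(\<Sum>i\<in>UNIV. \<Sum>j\<in>UNIV - {i}. 2 * real (a i) * real (a j) + real (a i) + real (a j))
        = (\<Sum>i\<in>UNIV. (2 * real k + real CARD('q) - 2) * real (a i) - 2 * (real (a i))\<^sup>2 + real k)"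
      unfolding inner ..
    also have "\<dots> = (2 * real k + real CARD('q) - 2) * real k - 2 * (\<Sum>i\<in>UNIV. (real (a i))\<^sup>2) + real CARD('q) * real k"
      by (simp add: sum.distrib sum_subtractf sum_distrib_left[symmetric] k)
    finally show ?thesis
      by (simp add: sum_subtractf k field_simps)
  qed
  have "laplace_beltrami (form k c) y = (\<Sum>i\<in>UNIV. form k (\<lambda>a. real (a i) * (real (a i) * c a)) y - ?E i y)
      + (\<Sum>i\<in>UNIV. \<Sum>j\<in>UNIV - {i}. form k (\<lambda>a. (2 * real (a i) * real (a j) + real (a i) + real (a j)) * c a) y) / 2"
    unfolding laplace_beltrami_def second cross ..
  also have "\<dots> = form k (\<lambda>a. ((\<Sum>i\<in>UNIV. (real (a i))\<^sup>2 - real (a i))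
      + (\<Sum>i\<in>UNIV. \<Sum>j\<in>UNIV - {i}. 2 * real (a i) * real (a j) + real (a i) + real (a j)) / 2) * c a) y"
  proof -
    have half: "form k d y / 2 = form k (\<lambda>a. d a / 2) y" for d
      by (simp add: form_def sum_divide_distrib)
    show ?thesis
      unfolding form_diff form_sum half form_add
      by (rule fun_cong[OF form_cong])
         (simp add: sum_distrib_right sum_distrib_left distrib_right power2_eq_square algebra_simps)
  qed
  also have "\<dots> = (real k * (real k - 1) + real k * (real CARD('q) - 1)) * form k c y"
    unfolding form_scale by (rule fun_cong[OF form_cong]) (simp add: count)
  finally show ?thesis by (simp add: row)
qed

text \<open>The argument of \<open>eigenform_leading\<close>, applied to the sum of the squares of the Cherednik operators: it is
  triangular with the diagonal entries \<open>spectrum_norm\<close>.\<close>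

lemma laplace_leading:
  fixes c :: "('q::finite \<Rightarrow> nat) \<Rightarrow> real"
  assumes sym: "\<And>i j y. form k c (permute (sw i j) y) = form k c y"
    and eig: "\<And>y. generic y \<Longrightarrow> laplace_beltrami (form k c) y = r * form k c y"
    and a0: "a0 \<in> exponents k" "c a0 \<noteq> 0"
  shows "\<exists>b\<in>exponents k. c b \<noteq> 0 \<and> (a0 = b \<or> lower a0 b)
    \<and> spectrum_norm b = r + (real k + (\<Sum>i\<in>(UNIV::'q set). (real (card {j::'q. idx i < idx j}))\<^sup>2) / 4)"
proof -
  obtain b where bE: "b \<in> exponents k" "c b \<noteq> 0" and above: "a0 = b \<or> lower a0 b"
    and top: "\<And>a'. a' \<in> exponents k \<Longrightarrow> lower b a' \<Longrightarrow> c a' = 0"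
    using maximal_exponent[of a0 k c, OF a0] by blast
  have "\<forall>i::'q. \<exists>m. cherednik_coeffs k i m"
    using ex_cherednik_coeffs by blast
  then obtain m where m: "\<And>i::'q. cherednik_coeffs k i (m i)" by metis
  define d where "d = (\<lambda>i b. \<Sum>a\<in>exponents k. c a * m i a b)"
  define d2 where "d2 = (\<lambda>i b. \<Sum>a\<in>exponents k. d i a * m i a b)"
  have single: "(\<Sum>a\<in>exponents k. x a * m i a b) = x b * spectrum b i"
    if "\<And>a. a \<in> exponents k \<Longrightarrow> lower b a \<Longrightarrow> x a = 0" for x i
  proof -
    have "(\<Sum>a\<in>exponents k. x a * m i a b) = (\<Sum>a\<in>exponents k. if a = b then x b * spectrum b i else 0)"
    proof (rule sum.cong)
      fix a :: "'q \<Rightarrow> nat" assume a: "a \<in> exponents k"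
      show "x a * m i a b = (if a = b then x b * spectrum b i else 0)"
        using cherednik_coeffsD(1)[OF m a, of i] cherednik_coeffsD(2)[OF m a bE(1), of i] that[OF a] by auto
    qed simp
    then show ?thesis using bE(1) by simp
  qed
  have d_b: "d i b = c b * spectrum b i" for i
    unfolding d_def by (rule single) (use top in auto)
  have d_top: "d i a' = 0" if a': "a' \<in> exponents k" "lower b a'" for i a'
    unfolding d_def
  proof (rule sum.neutral, rule ballI)
    fix a :: "'q \<Rightarrow> nat" assume a: "a \<in> exponents k"
    show "c a * m i a a' = 0"
    proof (cases "a' = a")
      case True
      then show ?thesis using top[OF a'] by simp
    next
      case False
      then show ?thesis
        using cherednik_coeffsD(2)[OF m a a'(1), of i] top[OF a] lower_trans[OF a'(2), of a] by auto
    qed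
  qed
  have d2_b: "d2 i b = c b * (spectrum b i)\<^sup>2" for i
    unfolding d2_def by (subst single) (use d_top d_b in \<open>auto simp: power2_eq_square\<close>)
  define N where "N = real k + (\<Sum>i\<in>(UNIV::'q set). (real (card {j::'q. idx i < idx j}))\<^sup>2) / 4"
  have "form k (\<lambda>b. \<Sum>i\<in>UNIV. d2 i b) y = form k (\<lambda>b. (r + N) * c b) y" if y: "generic y" for y
  proof -
    have h: "cherednik i (form k c) z = form k (d i) z" if "generic z" for i and z :: "real^'q"
      unfolding d_def by (rule cherednik_coeffsD(3)[OF m that])
    have h2: "cherednik i (form k (d i)) y = form k (d2 i) y" for i
      unfolding d2_def by (rule cherednik_coeffsD(3)[OF m y])
    have "(\<Sum>i\<in>UNIV. cherednik i (form k (d i)) y) = laplace_beltrami (form k c) y + N * form k c y"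
      unfolding N_def by (rule sum_cherednik_squares[OF is_form_form sym is_form_form h y])
    then show ?thesis
      unfolding h2 form_sum eig[OF y] form_scale form_add distrib_right .
  qed
  from form_coeff_unique[OF this bE(1)]
  have "c b * spectrum_norm b = (r + N) * c b"
    by (simp add: d2_b spectrum_norm_def sum_distrib_left)
  then have "spectrum_norm b = r + N" using bE(2) by simp
  then show ?thesis
    using bE above unfolding N_def by (intro bexI[of _ b]) auto
qed

lemma laplace_add:
  assumes "is_form k f" "is_form k g"
  shows "laplace_beltrami (\<lambda>y. f y + g y) y = laplace_beltrami f y + laplace_beltrami g y"
proof -
  have 1: "partial_deriv i (\<lambda>y. f y + g y) = (\<lambda>y. partial_deriv i f y + partial_deriv i g y)" for i
    by (rule ext) (rule partial_deriv_add[OF assms])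
  have 2: "partial_deriv i (\<lambda>y. partial_deriv i f y + partial_deriv i g y) y
     = partial_deriv i (partial_deriv i f) y + partial_deriv i (partial_deriv i g) y" for i
    by (rule partial_deriv_add[OF is_form_partial_deriv[OF assms(1)] is_form_partial_deriv[OF assms(2)]])
  show ?thesis
    unfolding laplace_beltrami_def 1 2 by (simp add: distrib_left sum.distrib)
qed

lemma laplace_scale:
  assumes "is_form k f"
  shows "laplace_beltrami (\<lambda>y. r * f y) y = r * laplace_beltrami f y"
proof -
  have 1: "partial_deriv i (\<lambda>y. r * f y) = (\<lambda>y. r * partial_deriv i f y)" for i
    by (rule ext) (rule partial_deriv_scale[OF assms])
  have 2: "partial_deriv i (\<lambda>y. r * partial_deriv i f y) y = r * partial_deriv i (partial_deriv i f) y" for i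
    by (rule partial_deriv_scale[OF is_form_partial_deriv[OF assms]])
  show ?thesis
    unfolding laplace_beltrami_def 1 2 by (simp add: distrib_left sum_distrib_left mult.left_commute)
qed

definition corner :: "nat \<Rightarrow> 'q::finite \<Rightarrow> 'q \<Rightarrow> nat" where
  "corner k i = (\<lambda>j. if j = i then k else 0)"

lemma corner_exponents: "corner k i \<in> exponents k"
  by (simp add: corner_def exponents_def)

lemma sqnorm_corner: "sqnorm (corner k i) = k\<^sup>2"
  by (simp add: sqnorm_def corner_def if_distrib[of "\<lambda>x. x\<^sup>2"] cong: if_cong)

lemma sqnorm_le_corner:
  fixes b :: "'q::finite \<Rightarrow> nat"
  assumes b: "b \<in> exponents k"
  shows "sqnorm b \<le> k\<^sup>2" and "sqnorm b = k\<^sup>2 \<Longrightarrow> \<exists>i. b = corner k i"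
proof -
  have k: "(\<Sum>i\<in>UNIV. b i) = k" using b by (simp add: exponents_def)
  have sq: "k\<^sup>2 = (\<Sum>i\<in>UNIV. b i * k)" by (simp add: power2_eq_square sum_distrib_right[symmetric] k)
  have le: "(b i)\<^sup>2 \<le> b i * k" for i
    using exponents_le[OF b, of i] by (simp add: power2_eq_square)
  show "sqnorm b \<le> k\<^sup>2"
    unfolding sqnorm_def sq by (intro sum_mono le)
  assume eq: "sqnorm b = k\<^sup>2"
  have all: "(b i)\<^sup>2 = b i * k" for i
  proof (rule ccontr)
    assume "(b i)\<^sup>2 \<noteq> b i * k"
    then have "(b i)\<^sup>2 < b i * k" using le[of i] by simp
    then have "sqnorm b < k\<^sup>2"
      unfolding sqnorm_def sq by (intro sum_strict_mono_ex1) (auto intro: le)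
    with eq show False by simp
  qed
  show "\<exists>i. b = corner k i"
  proof (cases "\<forall>i. b i = 0")
    case True
    then show ?thesis using k by (auto simp: corner_def fun_eq_iff)
  next
    case False
    then obtain i where i: "b i \<noteq> 0" by blast
    then have bi: "b i = k" using all[of i] by (simp add: power2_eq_square)
    then have "(\<Sum>j\<in>UNIV - {i}. b j) = 0" using sum.remove[of UNIV i b] k by simp
    then have "b j = 0" if "j \<noteq> i" for j using that by simp
    then show ?thesis using bi by (intro exI[of _ i]) (auto simp: corner_def fun_eq_iff)
  qed
qed

lemma card_below_less_CARD: "card (below \<eta> i) < CARD('q)"
  for \<eta> :: "'q::finite \<Rightarrow> nat"
proof -
  have "below \<eta> i \<noteq> UNIV" using below_irrefl[of i \<eta>] by blast
  then show ?thesis by (intro psubset_card_mono) auto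
qed

lemma bij_betw_rank: "bij_betw (\<lambda>i. card (below \<eta> i)) UNIV {..<CARD('q)}"
  for \<eta> :: "'q::finite \<Rightarrow> nat"
proof -
  have "inj (\<lambda>i. card (below \<eta> i))"
  proof (rule injI, rule ccontr)
    fix i j assume "card (below \<eta> i) = card (below \<eta> j)" "i \<noteq> j"
    then show False
      using below_total[of i j \<eta>] card_below_less[of i \<eta> j] card_below_less[of j \<eta> i] by auto
  qed
  moreover have "card (below \<eta> i) < CARD('q)" for i
    by (rule card_below_less_CARD)
  ultimately show ?thesis
    by (simp add: bij_betw_def card_image card_subset_eq image_subset_iff)
qed

lemma spectrum_norm_eq:
  fixes \<eta> :: "'q::finite \<Rightarrow> nat"
  shows "spectrum_norm \<eta> = real (sqnorm \<eta>) + (\<Sum>i\<in>UNIV. real (\<eta> i) * real (card (below \<eta> i)))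
    + (\<Sum>n<CARD('q). (real n)\<^sup>2) / 4"
proof -
  have "(\<Sum>n<CARD('q). (real n)\<^sup>2) = (\<Sum>i\<in>UNIV. (real (card (below \<eta> i)))\<^sup>2)"
    by (rule sum.reindex_bij_betw[OF bij_betw_rank, symmetric])
  then show ?thesis
    by (simp add: spectrum_norm_def spectrum_def sqnorm_def power2_sum sum.distrib sum_divide_distrib power_divide)
qed

text \<open>Both the sum of squares and the sum of the products of entries and ranks are largest when a single index
  carries the whole degree, the former strictly.\<close>

lemma spectrum_norm_less_corner:
  fixes b :: "'q::finite \<Rightarrow> nat" and i :: 'q
  assumes b: "b \<in> exponents k" and "sqnorm b \<noteq> k\<^sup>2"
  shows "spectrum_norm b < spectrum_norm (corner k i)"
proof -
  have lt: "sqnorm b < k\<^sup>2" using sqnorm_le_corner(1)[OF b] assms(2) by simp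
  then have k: "k > 0" by (cases k) auto
  have rank: "real (card (below b j)) \<le> real (CARD('q) - 1)" for j
    using card_below_less_CARD[of b j] by (intro of_nat_mono) simp
  have "(\<Sum>j\<in>UNIV. real (b j) * real (card (below b j))) \<le> (\<Sum>j\<in>UNIV. real (b j) * real (CARD('q) - 1))"
    by (intro sum_mono mult_left_mono rank) simp
  also have "\<dots> = real k * real (CARD('q) - 1)"
    using b by (simp add: exponents_def sum_distrib_right[symmetric] flip: of_nat_sum)
  also have "\<dots> = (\<Sum>j\<in>UNIV. real (corner k i j) * real (card (below (corner k i) j)))"
  proof -
    have "below (corner k i) i = UNIV - {i}" using k by (auto simp: below_def corner_def)
    then have c: "card (below (corner k i) i) = CARD('q) - 1" by (simp add: card_Diff_singleton)
    have "(\<Sum>j\<in>UNIV. real (corner k i j) * real (card (below (corner k i) j)))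
        = (\<Sum>j\<in>UNIV. if j = i then real k * real (card (below (corner k i) i)) else 0)"
      by (intro sum.cong) (auto simp: corner_def)
    then show ?thesis by (simp add: c)
  qed
  finally show ?thesis
    using lt unfolding spectrum_norm_eq sqnorm_corner by (simp flip: of_nat_power)
qed

lemma spectrum_norm_corner:
  fixes i j :: "'q::finite"
  shows "spectrum_norm (corner k i) = spectrum_norm (corner k j)"
proof -
  have "corner k i = corner k j \<circ> sw i j"
    by (auto simp: corner_def fun_eq_iff Transposition.transpose_def)
  then show ?thesis using spectrum_norm_comp[of "sw i j"] by simp
qed

definition axis_point :: "'q::finite \<Rightarrow> real^'q" where
  "axis_point i = (\<chi> j. if j = i then 1 else 0)"

lemma form_axis_point: "form k c (axis_point i) = c (corner k i)"
proof -
  have mono: "monom_at a (axis_point i) = (if a = corner k i then 1 else 0)" if a: "a \<in> exponents k" for a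
  proof (cases "a = corner k i")
    case True
    then show ?thesis by (auto simp: monom_at_def axis_point_def corner_def intro!: prod.neutral)
  next
    case False
    have "\<exists>j. j \<noteq> i \<and> a j \<noteq> 0"
    proof (rule ccontr)
      assume "\<nexists>j. j \<noteq> i \<and> a j \<noteq> 0"
      then have 0: "a j = 0" if "j \<noteq> i" for j using that by blast
      then have "a i = k" using a sum.remove[of UNIV i a] by (simp add: exponents_def)
      with 0 have "a = corner k i" by (auto simp: corner_def fun_eq_iff)
      with False show False by simp
    qed
    then obtain j where "j \<noteq> i" "a j \<noteq> 0" by blast
    then have "(axis_point i) $ j ^ a j = 0" by (simp add: axis_point_def)
    then show ?thesis using False by (auto simp: monom_at_def)
  qed
  have "form k c (axis_point i) = (\<Sum>a\<in>exponents k. if a = corner k i then c a else 0)"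
    unfolding form_def by (intro sum.cong) (auto simp: mono)
  then show ?thesis by (simp add: corner_exponents)
qed

text \<open>A nonzero value at a coordinate vector means that \<open>y\<^sub>i^k\<close> occurs, and then \<open>laplace_leading\<close> determines the eigenvalue.
  The difference of the two multiples has the same eigenvalue but vanishes at the coordinate vectors; were it nonzero,
  \<open>laplace_leading\<close> would exhibit an exponent with the norm of a corner that is not a corner.\<close>

lemma symmetric_eigenform_unique:
  fixes f g :: "real^'q::finite \<Rightarrow> real"
  assumes f: "is_form k f" "\<And>\<pi> y. bij \<pi> \<Longrightarrow> f (permute \<pi> y) = f y"
      "\<And>y. generic y \<Longrightarrow> laplace_beltrami f y = r * f y"
    and g: "is_form k g" "\<And>\<pi> y. bij \<pi> \<Longrightarrow> g (permute \<pi> y) = g y"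
      "\<And>y. generic y \<Longrightarrow> laplace_beltrami g y = s * g y"
    and i: "f (axis_point i) \<noteq> 0" "g (axis_point i) \<noteq> 0"
  shows "g (axis_point i) * f y = f (axis_point i) * g y"
proof -
  define N where "N = real k + (\<Sum>i\<in>(UNIV::'q set). (real (card {j::'q. idx i < idx j}))\<^sup>2) / 4"
  have eigenvalue: "t + N = spectrum_norm (corner k i)"
    if h: "is_form k h" "\<And>\<pi> y. bij \<pi> \<Longrightarrow> h (permute \<pi> y) = h y"
      "\<And>y. generic y \<Longrightarrow> laplace_beltrami h y = t * h y" "h (axis_point i) \<noteq> 0"
    for h :: "real^'q \<Rightarrow> real" and t
  proof -
    obtain c where c: "h = form k c" using h(1) by (auto simp: is_form_def)
    have "c (corner k i) \<noteq> 0" using h(4) by (simp add: c form_axis_point)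
    moreover have "form k c (permute (sw i j) y) = form k c y" for i j y
      using h(2)[of "sw i j" y] by (simp add: c)
    ultimately obtain b where b: "b \<in> exponents k" "corner k i = b \<or> lower (corner k i) b"
      "spectrum_norm b = t + N"
      using laplace_leading[of k c t "corner k i"] h(3) corner_exponents unfolding c N_def by blast
    have "sqnorm (corner k i) \<le> sqnorm b" using b(2) by (auto simp: lower_def)
    then have "sqnorm b = k\<^sup>2"
      using sqnorm_le_corner(1)[OF b(1)] by (simp add: sqnorm_corner)
    then obtain j where "b = corner k j" using sqnorm_le_corner(2)[OF b(1)] by blast
    then show ?thesis using b(3) spectrum_norm_corner[of k j i] by simp
  qed
  have rs: "r = s"
    using eigenvalue[OF f i(1)] eigenvalue[OF g i(2)] by linarith
  define h where "h = (\<lambda>y. g (axis_point i) * f y + (- f (axis_point i)) * g y)"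
  have hf: "is_form k h" unfolding h_def by (intro is_form_add is_form_scale f g)
  have hs: "h (permute \<pi> y) = h y" if "bij \<pi>" for \<pi> y
    using that by (simp add: h_def f(2) g(2))
  have hl: "laplace_beltrami h y = r * h y" if y: "generic y" for y
    unfolding h_def laplace_add[OF is_form_scale[OF f(1)] is_form_scale[OF g(1)]]
      laplace_scale[OF f(1)] laplace_scale[OF g(1)] f(3)[OF y] g(3)[OF y] rs
    by (simp add: algebra_simps)
  obtain c where c: "h = form k c" using hf by (auto simp: is_form_def)
  have "c a = 0" if a: "a \<in> exponents k" for a
  proof (rule ccontr)
    assume "c a \<noteq> 0"
    moreover have "form k c (permute (sw i j) y) = form k c y" for i j y
      using hs[of "sw i j" y] by (simp add: c)
    ultimately obtain b where b: "b \<in> exponents k" "c b \<noteq> 0" "spectrum_norm b = r + N"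
      using laplace_leading[of k c r a] hl a unfolding c N_def by blast
    have "spectrum_norm b = spectrum_norm (corner k i)"
      using b(3) eigenvalue[OF f i(1)] by simp
    then have "sqnorm b = k\<^sup>2" using spectrum_norm_less_corner[OF b(1)] by force
    then obtain j where j: "b = corner k j" using sqnorm_le_corner(2)[OF b(1)] by blast
    have ax: "axis_point j = permute (sw i j) (axis_point i)"
      by (auto simp: axis_point_def vec_eq_iff Transposition.transpose_def)
    have "c b = h (axis_point j)" by (simp add: c form_axis_point j)
    also have "\<dots> = h (axis_point i)" unfolding ax by (rule hs) simp
    also have "\<dots> = 0" by (simp add: h_def)
    finally show False using b(2) by simp
  qed
  then have "h = (\<lambda>y. 0)" using form_zero_iff[of k c] c by simp
  then have "h y = 0" by simp
  then show ?thesis by (simp add: h_def)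
qed

lemma is_form_row [simp]: "is_form k (row_form k)"
  by (simp add: row_form_def)

lemma row_form_permute:
  assumes "bij \<pi>"
  shows "row_form k (permute \<pi> y) = row_form k y"
proof -
  have "(\<Prod>i\<in>UNIV. row_coeff ((a \<circ> \<pi>) i)) = (\<Prod>i\<in>UNIV. row_coeff (a i))" for a :: "'a \<Rightarrow> nat"
    using prod.reindex_bij_betw[of \<pi> UNIV UNIV "\<lambda>i. row_coeff (a i)"] assms by simp
  then show ?thesis unfolding row_form_def form_permute[OF assms] by simp
qed

lemma row_form_axis_point: "row_form k (axis_point i) = row_coeff k"
proof -
  have "(\<Prod>j\<in>UNIV. row_coeff (corner k i j)) = row_coeff k * (\<Prod>j\<in>UNIV - {i}. row_coeff (corner k i j))"
    by (subst prod.remove[of _ i]) (auto simp: corner_def)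
  also have "(\<Prod>j\<in>UNIV - {i}. row_coeff (corner k i j)) = 1"
    by (intro prod.neutral) (auto simp: corner_def row_coeff_def)
  finally show ?thesis by (simp add: row_form_def form_axis_point)
qed

definition row_partition :: "nat \<Rightarrow> nat \<Rightarrow> nat list" where
  "row_partition q k = k # replicate (q - 1) 0"

lemma row_partition: "q > 0 \<Longrightarrow> row_partition q k \<in> partitions_of q k"
  by (auto simp: row_partition_def partitions_of_def sum_list_replicate sorted_wrt_iff_nth_less)

lemma row_partition_unique:
  assumes "\<kappa> \<in> partitions_of q k" "k \<le> sum_list (take 1 \<kappa>)" "q > 0"
  shows "\<kappa> = row_partition q k"
proof -
  have \<kappa>: "length \<kappa> = q" "sum_list \<kappa> = k" using assms(1) by (auto simp: partitions_of_def)
  then obtain x xs where xs: "\<kappa> = x # xs" using assms(3) by (cases \<kappa>) auto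
  then have "sum_list xs = 0" "x = k" using \<kappa>(2) assms(2) by auto
  then have "\<forall>z\<in>set xs. z = 0" by (simp add: sum_list_eq_0_iff)
  then have "xs = replicate (q - 1) 0" using \<kappa>(1) xs by (metis length_Cons diff_Suc_1 replicate_length_same)
  then show ?thesis using xs \<open>x = k\<close> by (simp add: row_partition_def)
qed

text \<open>At a coordinate vector the members of all other partitions vanish, because dominance excludes \<open>y\<^sub>i^k\<close>; so the
  member of the row equals the power of the trace there, which is \<open>1\<close>.\<close>

lemma zonal_eig_row:
  "zonal_eig (row_partition CARD('q) k) y = row_form k (y :: real^'q::finite) / row_coeff k"
proof -
  define C :: "nat list \<Rightarrow> real^'q \<Rightarrow> real" where "C = (SOME C. zonal_family k C)"
  have C: "zonal_family k C"
    unfolding C_def by (rule someI[of "zonal_family k", OF zonal_family_exists])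
  let ?\<kappa> = "row_partition CARD('q) k"
  have \<kappa>: "?\<kappa> \<in> partitions_of CARD('q) k" by (rule row_partition) simp
  fix i :: 'q
  have "(\<Sum>\<kappa>\<in>partitions_of CARD('q) k. C \<kappa> (axis_point i)) = (\<Sum>j\<in>UNIV. axis_point i $ j) ^ k"
    using C unfolding zonal_family_def by blast
  also have "\<dots> = 1" by (simp add: axis_point_def)
  also have "(\<Sum>\<kappa>\<in>partitions_of CARD('q) k. C \<kappa> (axis_point i)) = (\<Sum>\<kappa>\<in>partitions_of CARD('q) k. if \<kappa> = ?\<kappa> then C ?\<kappa> (axis_point i) else 0)"
  proof (intro sum.cong refl)
    fix \<kappa> assume mem: "\<kappa> \<in> partitions_of CARD('q) k"
    show "C \<kappa> (axis_point i) = (if \<kappa> = ?\<kappa> then C ?\<kappa> (axis_point i) else 0)"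
    proof (cases "\<kappa> = ?\<kappa>")
      case False
      obtain c where c: "symmetric_form k c (C \<kappa>)" "\<forall>a\<in>exponents k. c a \<noteq> 0 \<longrightarrow> dominated a \<kappa>"
        using C mem unfolding zonal_family_def by blast
      have "C \<kappa> = form k c"
        using c(1) by (auto simp: symmetric_form_def form_def monom_at_def fun_eq_iff)
      then have val: "C \<kappa> (axis_point i) = c (corner k i)" by (simp add: form_axis_point)
      have "c (corner k i) = 0"
      proof (rule ccontr)
        assume "c (corner k i) \<noteq> 0"
        then have "dominated (corner k i) \<kappa>" using c(2) corner_exponents by blast
        then have "(\<Sum>j\<in>{i}. corner k i j) \<le> sum_list (take (card {i}) \<kappa>)"
          unfolding dominated_def by blast
        then have "k \<le> sum_list (take 1 \<kappa>)" by (simp add: corner_def)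
        with row_partition_unique[OF mem] False show False by simp
      qed
      with val False show ?thesis by simp
    qed simp
  qed
  also have "\<dots> = C ?\<kappa> (axis_point i)"
    using \<kappa> by (simp add: finite_partitions_of)
  finally have ax: "C ?\<kappa> (axis_point i) = 1" .
  obtain c where c: "symmetric_form k c (C ?\<kappa>)"
    using C \<kappa> unfolding zonal_family_def by blast
  have Cc: "C ?\<kappa> = form k c"
    using c by (auto simp: symmetric_form_def form_def monom_at_def fun_eq_iff)
  obtain r where r: "\<forall>y. generic y \<longrightarrow> laplace_beltrami (C ?\<kappa>) y = r * C ?\<kappa> y"
    using C \<kappa> unfolding zonal_family_def by blast
  have "row_form k (axis_point i) * C ?\<kappa> y = C ?\<kappa> (axis_point i) * row_form k y"
  proof (rule symmetric_eigenform_unique[where k = k and r = r and s = "real k * (real k - 1) + real k * (real CARD('q) - 1)"])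
    show "C ?\<kappa> (permute \<pi> y) = C ?\<kappa> y" if "bij \<pi>" for \<pi> :: "'q \<Rightarrow> 'q" and y
      using c that unfolding Cc form_permute[OF that] symmetric_form_def by simp
  qed (use r ax row_coeff_pos[of k] in \<open>auto simp: Cc row_form_permute laplace_row_form row_form_axis_point\<close>)
  then have "C ?\<kappa> y = row_form k y / row_coeff k"
    using row_coeff_pos[of k] by (simp add: ax row_form_axis_point field_simps)
  moreover have "sum_list ?\<kappa> = k" using \<kappa> by (simp add: partitions_of_def)
  ultimately show ?thesis by (simp add: zonal_eig_def C_def)
qed

section \<open>Symmetric and positive definite matrices\<close>

definition diag_matrix :: "('n::finite \<Rightarrow> real) \<Rightarrow> real^'n^'n" where
  "diag_matrix d = (\<chi> i j. if i = j then d i else 0)"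

lemma symmetric_dot:
  fixes S :: "real^'n^'n"
  assumes "transpose S = S"
  shows "x \<bullet> (S *v y) = (S *v x) \<bullet> y"
  by (metis assms dot_lmul_matrix vector_transpose_matrix)

lemma linear_coeff_zero_of_quadratic:
  fixes \<alpha> \<gamma> :: real
  assumes "\<And>t. 2 * t * \<alpha> + t\<^sup>2 * \<gamma> \<le> 0"
  shows "\<alpha> = 0"
proof (rule ccontr)
  assume "\<alpha> \<noteq> 0"
  define c where "c = \<bar>\<gamma>\<bar> + 1"
  have c: "c > 0" "- \<gamma> < c" by (auto simp: c_def)
  have "2 * (\<alpha> / c) * \<alpha> + (\<alpha> / c)\<^sup>2 * \<gamma> = (\<alpha> / c)\<^sup>2 * (2 * c + \<gamma>)"
    using c by (simp add: power2_eq_square field_simps)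
  moreover have "\<dots> > 0"
    using c \<open>\<alpha> \<noteq> 0\<close> by (intro mult_pos_pos) (auto simp: zero_less_power2)
  ultimately show False using assms[of "\<alpha> / c"] by linarith
qed

text \<open>The orthogonal complement of \<open>B\<close> is invariant, and a maximum point of \<open>x \<bullet> S x\<close> on its unit sphere is an eigenvector.\<close>

lemma symmetric_eigenvector_orthogonal:
  fixes S :: "real^'n^'n"
  assumes sym: "transpose S = S" and B: "\<And>b. b \<in> B \<Longrightarrow> \<exists>l. S *v b = l *\<^sub>R b" and d: "dim B < CARD('n)"
  shows "\<exists>v l. norm v = 1 \<and> S *v v = l *\<^sub>R v \<and> (\<forall>b\<in>B. b \<bullet> v = 0)"
proof -
  define W where "W = {x. \<forall>b\<in>B. b \<bullet> x = 0}"
  have subW: "x + t *\<^sub>R y \<in> W" if "x \<in> W" "y \<in> W" for x y t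
    using that by (auto simp: W_def inner_add_right)
  have SW: "S *v x \<in> W" if "x \<in> W" for x
  proof -
    have "b \<bullet> (S *v x) = 0" if "b \<in> B" for b
      using symmetric_dot[OF sym, of b x] B[OF that] \<open>x \<in> W\<close> that by (auto simp: W_def)
    then show ?thesis by (simp add: W_def)
  qed
  have closedW: "closed W"
  proof -
    have "W = (\<Inter>b\<in>B. {x. b \<bullet> x = 0})" by (auto simp: W_def)
    then show ?thesis by (auto intro!: closed_INT closed_hyperplane)
  qed
  obtain x0 where x0: "x0 \<noteq> 0" "\<And>y. y \<in> span B \<Longrightarrow> orthogonal x0 y"
    using orthogonal_to_subspace_exists[of B] d by auto
  then have "x0 \<in> W"
    by (auto simp: W_def orthogonal_def inner_commute intro: span_base)
  then have "(1 / norm x0) *\<^sub>R x0 \<in> W \<inter> sphere 0 1"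
    using x0(1) by (auto simp: W_def)
  then have ne: "W \<inter> sphere 0 1 \<noteq> {}" by blast
  have "compact (W \<inter> sphere 0 1)"
    by (rule closed_Int_compact[OF closedW compact_sphere])
  moreover have "continuous_on (W \<inter> sphere 0 1) (\<lambda>x. x \<bullet> (S *v x))"
    by (intro continuous_on_inner continuous_on_id linear_continuous_on matrix_vector_mul_bounded_linear)
  ultimately obtain v where v0: "v \<in> W \<inter> sphere 0 1" "\<forall>x\<in>W \<inter> sphere 0 1. x \<bullet> (S *v x) \<le> v \<bullet> (S *v v)"
    using continuous_attains_sup[OF _ ne] by blast
  then have v: "v \<in> W" "norm v = 1" by auto
  have max: "x \<bullet> (S *v x) \<le> v \<bullet> (S *v v)" if "x \<in> W" "norm x = 1" for x
    using v0(2) that by simp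
  define \<mu> where "\<mu> = v \<bullet> (S *v v)"
  have le: "x \<bullet> (S *v x) \<le> \<mu> * (x \<bullet> x)" if "x \<in> W" for x
  proof (cases "x = 0")
    case False
    have "(1 / norm x) *\<^sub>R x \<in> W" using that by (auto simp: W_def)
    from max[OF this] have "(x \<bullet> (S *v x)) / (norm x)\<^sup>2 \<le> \<mu>"
      using False by (simp add: \<mu>_def matrix_vector_mult_scaleR power2_eq_square)
    then show ?thesis using False by (simp add: divide_le_eq power2_norm_eq_inner)
  qed simp
  define w where "w = S *v v - \<mu> *\<^sub>R v"
  have w: "w \<in> W"
    using subW[OF SW[OF v(1)] v(1), of "- \<mu>"] by (simp add: w_def)
  have vv: "v \<bullet> v = 1" using v(2) by (simp add: norm_eq_1)
  have vw: "v \<bullet> w = 0" by (simp add: w_def inner_diff_right \<mu>_def vv)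
  have "2 * t * (w \<bullet> (S *v v)) + t\<^sup>2 * (w \<bullet> (S *v w) - \<mu> * (w \<bullet> w)) \<le> 0" for t
  proof -
    have "(v + t *\<^sub>R w) \<bullet> (S *v (v + t *\<^sub>R w)) = \<mu> + 2 * t * (w \<bullet> (S *v v)) + t\<^sup>2 * (w \<bullet> (S *v w))"
      using symmetric_dot[OF sym, of v w]
      by (simp add: matrix_vector_right_distrib matrix_vector_mult_scaleR inner_add_left inner_add_right \<mu>_def
          power2_eq_square algebra_simps inner_commute)
    moreover have "(v + t *\<^sub>R w) \<bullet> (v + t *\<^sub>R w) = 1 + t\<^sup>2 * (w \<bullet> w)"
      using vw vv by (simp add: inner_add_left inner_add_right inner_commute power2_eq_square)
    ultimately show ?thesis
      using le[OF subW[OF v(1) w], of t] by (simp add: algebra_simps)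
  qed
  from linear_coeff_zero_of_quadratic[OF this] have "w \<bullet> (S *v v) = 0" .
  then have "w \<bullet> w = 0"
    using vw by (simp add: w_def inner_diff_right inner_diff_left inner_commute)
  then have "S *v v = \<mu> *\<^sub>R v" by (simp add: w_def)
  then show ?thesis using v by (auto simp: W_def)
qed

lemma symmetric_orthonormal_eigenvectors:
  fixes S :: "real^'n^'n"
  assumes sym: "transpose S = S" and "m \<le> CARD('n)"
  shows "\<exists>B. finite B \<and> card B = m \<and> pairwise orthogonal B \<and> (\<forall>b\<in>B. norm b = 1 \<and> (\<exists>l. S *v b = l *\<^sub>R b))"
  using assms(2)
proof (induction m)
  case 0
  then show ?case by (intro exI[of _ "{}"]) auto
next
  case (Suc m)
  then obtain B where B: "finite B" "card B = m" "pairwise orthogonal B"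
    "\<And>b. b \<in> B \<Longrightarrow> norm b = 1" "\<And>b. b \<in> B \<Longrightarrow> \<exists>l. S *v b = l *\<^sub>R b" by auto
  have "dim B \<le> m" using dim_le_card'[OF B(1)] B(2) by simp
  then have "dim B < CARD('n)" using Suc.prems by simp
  from symmetric_eigenvector_orthogonal[OF sym B(5) this]
  obtain v l where v: "norm v = 1" "S *v v = l *\<^sub>R v" and orth: "\<forall>b\<in>B. b \<bullet> v = 0"
    by blast
  have "v \<notin> B"
  proof
    assume "v \<in> B"
    with orth have "v \<bullet> v = 0" by blast
    with v(1) show False by (simp add: norm_eq_1)
  qed
  then show ?case
  proof (intro exI[of _ "insert v B"] conjI)
    show "pairwise orthogonal (insert v B)"
      using B(3) orth by (simp add: pairwise_insert) (simp add: orthogonal_def inner_commute)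
  qed (use B v \<open>v \<notin> B\<close> in auto)
qed

lemma symmetric_diagonalizable:
  fixes S :: "real^'n^'n"
  assumes sym: "transpose S = S"
  obtains Q y where "orthogonal_matrix Q" "S = Q ** diag_matrix y ** transpose Q"
proof -
  obtain B where B: "finite B" "card B = CARD('n)" "pairwise orthogonal B"
    "\<And>b. b \<in> B \<Longrightarrow> norm b = 1" "\<And>b. b \<in> B \<Longrightarrow> \<exists>l. S *v b = l *\<^sub>R b"
    using symmetric_orthonormal_eigenvectors[OF sym order_refl] by auto
  obtain e :: "'n \<Rightarrow> real^'n" where e: "bij_betw e UNIV B"
    using finite_same_card_bij[of "UNIV :: 'n set" B] B(1,2) by auto
  then have eB: "e i \<in> B" for i by (auto simp: bij_betw_def)
  obtain y where y: "\<And>i. S *v e i = y i *\<^sub>R e i" using B(5)[OF eB] by metis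
  define Q :: "real^'n^'n" where "Q = (\<chi> i j. e j $ i)"
  have col: "column j Q = e j" for j by (simp add: Q_def column_def vec_eq_iff)
  have orth: "orthogonal_matrix Q"
    unfolding orthogonal_matrix_orthonormal_columns col
  proof (intro conjI allI impI)
    show "norm (e i) = 1" for i using B(4) eB by blast
    show "orthogonal (e i) (e j)" if "i \<noteq> j" for i j
      using B(3) eB that e unfolding pairwise_def bij_betw_def inj_on_def by blast
  qed
  have "(S ** Q) $ i $ j = (Q ** diag_matrix y) $ i $ j" for i j
  proof -
    have "(S ** Q) $ i $ j = (S *v e j) $ i"
      by (simp add: matrix_matrix_mult_def matrix_vector_mult_def Q_def)
    also have "\<dots> = (Q ** diag_matrix y) $ i $ j"
      unfolding y by (simp add: matrix_matrix_mult_def diag_matrix_def Q_def if_distrib[of "\<lambda>x. _ * x"] mult.commute cong: if_cong)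
    finally show ?thesis .
  qed
  then have "S ** Q = Q ** diag_matrix y" by (simp add: vec_eq_iff)
  then have "S ** Q ** transpose Q = Q ** diag_matrix y ** transpose Q" by simp
  then have "S = Q ** diag_matrix y ** transpose Q"
    using orth by (simp add: matrix_mul_assoc[symmetric] orthogonal_matrix_def)
  with orth show ?thesis using that by blast
qed

lemma eigenvalue_vec_exists:
  fixes S :: "real^'n^'n"
  assumes "transpose S = S"
  shows "\<exists>y. eigenvalue_vec S y"
proof -
  obtain Q y where "orthogonal_matrix Q" "S = Q ** diag_matrix y ** transpose Q"
    by (rule symmetric_diagonalizable[OF assms])
  then show ?thesis
    unfolding eigenvalue_vec_def diag_matrix_def by (intro exI[of _ "\<chi> i. y i"] exI[of _ Q]) (simp cong: if_cong)
qed

lemma diag_matrix_mult: "diag_matrix d ** diag_matrix e = diag_matrix (\<lambda>i. d i * e i)"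
  by (simp add: diag_matrix_def matrix_matrix_mult_def vec_eq_iff if_distrib[of "\<lambda>x. _ * x"] cong: if_cong)

lemma conj_diag_mult:
  assumes "orthogonal_matrix Q"
  shows "(Q ** diag_matrix d ** transpose Q) ** (Q ** diag_matrix e ** transpose Q)
    = Q ** diag_matrix (\<lambda>i. d i * e i) ** transpose Q"
proof -
  have "(Q ** diag_matrix d ** transpose Q) ** (Q ** diag_matrix e ** transpose Q)
      = Q ** diag_matrix d ** (transpose Q ** Q) ** diag_matrix e ** transpose Q"
    by (simp add: matrix_mul_assoc)
  also have "\<dots> = Q ** (diag_matrix d ** diag_matrix e) ** transpose Q"
    using assms by (simp add: orthogonal_matrix_def matrix_mul_assoc)
  finally show ?thesis by (simp add: diag_matrix_mult)
qed

lemma dot_matrix_vector: "x \<bullet> (A *v w) = (transpose A *v x) \<bullet> w"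
  for A :: "real^'m^'n"
  using dot_lmul_matrix[of x A w] vector_transpose_matrix[of x "transpose A"] by simp

lemma diag_matrix_vector: "(diag_matrix d *v u) $ i = d i * u $ i"
  by (simp add: diag_matrix_def matrix_vector_mult_def if_distrib[of "\<lambda>x. x * _"] cong: if_cong)

lemma conj_diag_vector: "(Q ** diag_matrix d ** transpose Q) *v x = Q *v (diag_matrix d *v (transpose Q *v x))"
  by (simp only: matrix_vector_mul_assoc matrix_mul_assoc)

lemma conj_diag_quadratic:
  "x \<bullet> ((Q ** diag_matrix d ** transpose Q) *v x) = (\<Sum>i\<in>UNIV. d i * ((transpose Q *v x) $ i)\<^sup>2)"
proof -
  have "x \<bullet> ((Q ** diag_matrix d ** transpose Q) *v x) = (transpose Q *v x) \<bullet> (diag_matrix d *v (transpose Q *v x))"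
    unfolding conj_diag_vector by (rule dot_matrix_vector)
  then show ?thesis
    by (simp add: inner_vec_def diag_matrix_vector power2_eq_square mult_ac del: matrix_vector_mul_assoc)
qed

lemma transpose_conj_diag: "transpose (Q ** diag_matrix d ** transpose Q) = Q ** diag_matrix d ** transpose Q"
proof -
  have "transpose (diag_matrix d) = diag_matrix d"
    by (auto simp: diag_matrix_def Finite_Cartesian_Product.transpose_def vec_eq_iff)
  then show ?thesis by (simp add: matrix_transpose_mul matrix_mul_assoc)
qed

lemma orthogonal_transpose_nonzero:
  assumes "orthogonal_matrix Q" "x \<noteq> (0 :: real^'n)"
  shows "\<exists>i. (transpose Q *v x) $ i \<noteq> 0"
proof (rule ccontr)
  assume "\<nexists>i. (transpose Q *v x) $ i \<noteq> 0"
  then have "transpose Q *v x = 0" by (simp add: vec_eq_iff)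
  have "x = (Q ** transpose Q) *v x" using assms(1) by (simp add: orthogonal_matrix_def)
  also have "\<dots> = Q *v (transpose Q *v x)" by (simp only: matrix_vector_mul_assoc)
  also have "\<dots> = 0" unfolding \<open>transpose Q *v x = 0\<close> by simp
  finally show False using assms(2) by contradiction
qed

lemma positive_definite_conj_diag:
  assumes Q: "orthogonal_matrix Q" and d: "\<And>i. d i > 0"
  shows "positive_definite (Q ** diag_matrix d ** transpose Q)"
  unfolding positive_definite_def conj_diag_quadratic transpose_conj_diag
proof (intro conjI allI impI refl)
  fix x :: "real^'a" assume "x \<noteq> 0"
  then obtain i where "(transpose Q *v x) $ i \<noteq> 0"
    using orthogonal_transpose_nonzero[OF Q] by blast
  then show "0 < (\<Sum>i\<in>UNIV. d i * ((transpose Q *v x) $ i)\<^sup>2)"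
    using d by (intro sum_pos2[of _ i]) (auto simp: less_imp_le)
qed

lemma positive_definite_diagonalizable:
  fixes A :: "real^'n^'n"
  assumes "positive_definite A"
  shows "\<exists>Q y. orthogonal_matrix Q \<and> A = Q ** diag_matrix y ** transpose Q \<and> (\<forall>i. y i > 0)"
proof -
  obtain Q y where Q: "orthogonal_matrix Q" "A = Q ** diag_matrix y ** transpose Q"
    using symmetric_diagonalizable[of A] assms by (auto simp: positive_definite_def)
  have "y i > 0" for i
  proof -
    define x where "x = Q *v axis i 1"
    have tx: "transpose Q *v x = axis i 1"
      using Q(1) by (simp add: x_def matrix_vector_mul_assoc orthogonal_matrix_def)
    then have "x \<noteq> 0" by (auto simp: axis_eq_0_iff)
    then have "0 < x \<bullet> (A *v x)" using assms by (simp add: positive_definite_def)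
    also have "\<dots> = y i"
      unfolding Q(2) conj_diag_quadratic tx by (simp add: axis_def if_distrib[of "\<lambda>x. _ * x"] if_distrib[of "\<lambda>x. x\<^sup>2"] cong: if_cong)
    finally show ?thesis .
  qed
  with Q show ?thesis by blast
qed

lemma matrix_inv_eqI:
  fixes A B :: "real^'n^'n"
  assumes "A ** B = mat 1"
  shows "matrix_inv A = B"
proof -
  have BA: "B ** A = mat 1" using assms by (simp add: matrix_left_right_inverse)
  have "A ** matrix_inv A = mat 1 \<and> matrix_inv A ** A = mat 1"
    unfolding matrix_inv_def by (rule someI[of _ B]) (use assms BA in auto)
  then show ?thesis using BA by (metis matrix_mul_assoc matrix_mul_lid matrix_mul_rid)
qed

text \<open>The difference \<open>D\<close> satisfies \<open>B D + D C = 0\<close>.  For an eigenvector \<open>v\<close> of \<open>D\<close> this reads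
  \<open>y (v \<bullet> B v + v \<bullet> C v) = 0\<close>, so every eigenvalue \<open>y\<close> of \<open>D\<close> is zero.\<close>

lemma positive_definite_sqrt_unique:
  fixes B C :: "real^'n^'n"
  assumes B: "positive_definite B" and C: "positive_definite C" and eq: "B ** B = C ** C"
  shows "B = C"
proof -
  define D where "D = B - C"
  have sD: "transpose D = D"
    using B C by (simp add: D_def positive_definite_def Finite_Cartesian_Product.transpose_def vec_eq_iff)
  have Dw: "D *v w = B *v w - C *v w" for w
    by (simp add: D_def matrix_vector_mult_diff_rdistrib)
  have BD: "B *v (D *v v) + D *v (C *v v) = 0" for v
  proof -
    have "B *v (D *v v) + D *v (C *v v) = B *v (B *v v) - C *v (C *v v)"
      unfolding Dw by (simp add: matrix_vector_mult_diff_distrib del: matrix_vector_mul_assoc)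
    also have "\<dots> = 0"
      by (simp add: matrix_vector_mul_assoc eq)
    finally show ?thesis .
  qed
  obtain Q y where Q: "orthogonal_matrix Q" "D = Q ** diag_matrix y ** transpose Q"
    by (rule symmetric_diagonalizable[OF sD])
  have "y i = 0" for i
  proof -
    define v where "v = Q *v axis i 1"
    have tv: "transpose Q *v v = axis i 1"
      using Q(1) by (simp add: v_def matrix_vector_mul_assoc orthogonal_matrix_def)
    have v0: "v \<noteq> 0" using tv by (auto simp: axis_eq_0_iff)
    have "diag_matrix y *v axis i 1 = y i *\<^sub>R axis i 1"
      by (auto simp: diag_matrix_def matrix_vector_mult_def axis_def vec_eq_iff if_distrib[of "\<lambda>x. _ * x"] cong: if_cong)
    then have Dv: "D *v v = y i *\<^sub>R v"
      using tv unfolding Q(2) conj_diag_vector by (simp add: v_def matrix_vector_mult_scaleR del: matrix_vector_mul_assoc)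
    have "0 = v \<bullet> (B *v (D *v v) + D *v (C *v v))" unfolding BD by simp
    also have "\<dots> = v \<bullet> (B *v (D *v v)) + (D *v v) \<bullet> (C *v v)"
      unfolding inner_add_right symmetric_dot[OF sD] ..
    also have "\<dots> = y i * (v \<bullet> (B *v v) + v \<bullet> (C *v v))"
      by (simp add: Dv matrix_vector_mult_scaleR algebra_simps)
    finally have "y i * (v \<bullet> (B *v v) + v \<bullet> (C *v v)) = 0" by simp
    moreover have "v \<bullet> (B *v v) + v \<bullet> (C *v v) > 0"
      using B C v0 by (intro add_pos_pos) (auto simp: positive_definite_def)
    ultimately show ?thesis by simp
  qed
  then have "diag_matrix y = 0" by (simp add: diag_matrix_def vec_eq_iff)
  then have "D = 0" by (simp add: Q(2) matrix_matrix_mult_def vec_eq_iff)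
  then show ?thesis by (simp add: D_def)
qed

lemma inv_sqrt_matrix:
  fixes A :: "real^'n^'n"
  assumes "positive_definite A"
  shows "positive_definite (inv_sqrt_matrix A)" "inv_sqrt_matrix A ** inv_sqrt_matrix A = matrix_inv A"
    "inv_sqrt_matrix A ** A ** inv_sqrt_matrix A = mat 1"
proof -
  obtain Q y where Q: "orthogonal_matrix Q" "A = Q ** diag_matrix y ** transpose Q" "\<And>i. y i > 0"
    using positive_definite_diagonalizable[OF assms] by blast
  have one: "Q ** diag_matrix (\<lambda>i. 1) ** transpose Q = mat 1"
    using Q(1) by (simp add: orthogonal_matrix_def diag_matrix_def mat_def[symmetric])
  have nz: "y i \<noteq> 0" for i using Q(3)[of i] by simp
  have inv: "matrix_inv A = Q ** diag_matrix (\<lambda>i. 1 / y i) ** transpose Q"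
    by (rule matrix_inv_eqI) (simp add: Q(2) conj_diag_mult[OF Q(1)] nz one)
  let ?P = "Q ** diag_matrix (\<lambda>i. 1 / sqrt (y i)) ** transpose Q"
  have P: "positive_definite ?P \<and> ?P ** ?P = matrix_inv A"
    using Q(3) by (simp add: positive_definite_conj_diag[OF Q(1)] conj_diag_mult[OF Q(1)] inv less_imp_le)
  have "\<exists>!B. positive_definite B \<and> B ** B = matrix_inv A"
  proof (rule ex1I[of _ ?P])
    fix B assume B: "positive_definite B \<and> B ** B = matrix_inv A"
    show "B = ?P"
      by (rule positive_definite_sqrt_unique[OF conjunct1[OF B] conjunct1[OF P]])
         (simp only: conjunct2[OF B] conjunct2[OF P])
  qed (rule P)
  from theI'[OF this]
  have *: "positive_definite (inv_sqrt_matrix A)" "inv_sqrt_matrix A ** inv_sqrt_matrix A = matrix_inv A"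
    by (auto simp: inv_sqrt_matrix_def)
  have "matrix_inv A ** A = mat 1"
    unfolding inv by (simp add: Q(2) conj_diag_mult[OF Q(1)] nz one)
  then have "inv_sqrt_matrix A ** (inv_sqrt_matrix A ** A) = mat 1"
    by (simp add: matrix_mul_assoc *(2))
  then have "inv_sqrt_matrix A ** A ** inv_sqrt_matrix A = mat 1"
    by (simp add: matrix_left_right_inverse)
  with * show "positive_definite (inv_sqrt_matrix A)" "inv_sqrt_matrix A ** inv_sqrt_matrix A = matrix_inv A"
    "inv_sqrt_matrix A ** A ** inv_sqrt_matrix A = mat 1" by auto
qed

section \<open>Gaussian integrals\<close>

lemma nn_integral_scale:
  fixes f :: "'a::euclidean_space \<Rightarrow> ennreal"
  assumes f: "f \<in> borel_measurable borel" and c: "c > 0"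
  shows "(\<integral>\<^sup>+x. f x \<partial>lborel) = ennreal (c ^ DIM('a)) * (\<integral>\<^sup>+x. f (c *\<^sub>R x) \<partial>lborel)"
proof -
  have "(\<integral>\<^sup>+x. f x \<partial>lborel)
      = (\<integral>\<^sup>+x. f x \<partial>density (distr lborel borel (\<lambda>x. 0 + c *\<^sub>R x)) (\<lambda>x. ennreal (\<bar>c\<bar> ^ DIM('a))))"
    using lborel_affine[of c "0 :: 'a"] c by simp
  also have "\<dots> = (\<integral>\<^sup>+x. ennreal (\<bar>c\<bar> ^ DIM('a)) * f (c *\<^sub>R x) \<partial>lborel)"
    using f by (simp add: nn_integral_density nn_integral_distr)
  also have "\<dots> = ennreal (c ^ DIM('a)) * (\<integral>\<^sup>+x. f (c *\<^sub>R x) \<partial>lborel)"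
    using f c by (subst nn_integral_cmult) auto
  finally show ?thesis .
qed

lemma nn_integral_gaussian_moment:
  "(\<integral>\<^sup>+x. ennreal (exp (- x\<^sup>2) * x ^ (2 * k)) \<partial>lborel) = ennreal (sqrt pi * pochhammer (1/2) k)"
proof -
  have std: "std_normal_density (sqrt 2 * x) * (sqrt 2 * x) ^ (2 * k) = 2 ^ k / sqrt (2 * pi) * (exp (- x\<^sup>2) * x ^ (2 * k))" for x
    by (simp add: std_normal_density_def power_mult_distrib power_mult)
  have "ennreal (fact (2 * k) / (2 ^ k * fact k)) = (\<integral>\<^sup>+x. ennreal (std_normal_density x * x ^ (2 * k)) \<partial>lborel)"
    using std_normal_moment_even[of k]
    by (subst nn_integral_eq_integral) (auto simp: has_bochner_integral_iff)
  also have "\<dots> = ennreal \<bar>sqrt 2\<bar> * (\<integral>\<^sup>+x. ennreal (std_normal_density (0 + sqrt 2 * x) * (0 + sqrt 2 * x) ^ (2 * k)) \<partial>lborel)"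
    by (rule nn_integral_real_affine) auto
  also have "\<dots> = ennreal (sqrt 2) * (\<integral>\<^sup>+x. ennreal (2 ^ k / sqrt (2 * pi)) * ennreal (exp (- x\<^sup>2) * x ^ (2 * k)) \<partial>lborel)"
    unfolding add_0 std by (simp add: ennreal_mult[symmetric])
  also have "\<dots> = ennreal (sqrt 2) * (ennreal (2 ^ k / sqrt (2 * pi)) * (\<integral>\<^sup>+x. ennreal (exp (- x\<^sup>2) * x ^ (2 * k)) \<partial>lborel))"
    by (subst nn_integral_cmult) auto
  also have "\<dots> = ennreal (2 ^ k / sqrt pi) * (\<integral>\<^sup>+x. ennreal (exp (- x\<^sup>2) * x ^ (2 * k)) \<partial>lborel)"
    by (simp add: mult.assoc[symmetric] ennreal_mult[symmetric] real_sqrt_mult)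
  finally have eq: "ennreal (fact (2 * k) / (2 ^ k * fact k)) = ennreal (2 ^ k / sqrt pi) * (\<integral>\<^sup>+x. ennreal (exp (- x\<^sup>2) * x ^ (2 * k)) \<partial>lborel)" .
  have one: "ennreal (sqrt pi / 2 ^ k) * ennreal (2 ^ k / sqrt pi) = 1"
    by (simp add: ennreal_mult[symmetric])
  have "(\<integral>\<^sup>+x. ennreal (exp (- x\<^sup>2) * x ^ (2 * k)) \<partial>lborel) = ennreal (sqrt pi / 2 ^ k) * ennreal (fact (2 * k) / (2 ^ k * fact k))"
    unfolding eq mult.assoc[symmetric] one by simp
  also have "\<dots> = ennreal (sqrt pi / 2 ^ k * (fact (2 * k) / (2 ^ k * fact k)))"
    by (subst ennreal_mult) auto
  also have "sqrt pi / 2 ^ k * (fact (2 * k) / (2 ^ k * fact k)) = sqrt pi * pochhammer (1/2) k"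
    unfolding fact_double by (simp add: power_mult power2_eq_square power_mult_distrib[symmetric] mult_2 power_add)
  finally show ?thesis .
qed

lemma nn_integral_vec_prod:
  fixes h :: "'n::finite \<Rightarrow> real \<Rightarrow> real"
  assumes "\<And>i. h i \<in> borel_measurable borel" "\<And>i x. 0 \<le> h i x"
  shows "(\<integral>\<^sup>+x. ennreal (\<Prod>i\<in>UNIV. h i ((x::real^'n) $ i)) \<partial>lborel) = (\<Prod>i\<in>UNIV. \<integral>\<^sup>+x. ennreal (h i x) \<partial>lborel)"
proof -
  define ix :: "real^'n \<Rightarrow> 'n" where "ix = inv (\<lambda>i. axis i 1)"
  have inj: "inj (\<lambda>i. axis i (1::real) :: real^'n)"
    by (auto simp: inj_def axis_eq_axis)
  have ix: "ix (axis i 1) = i" for i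
    unfolding ix_def by (rule inv_f_f[OF inj])
  have basis: "(Basis :: (real^'n) set) = range (\<lambda>i. axis i 1)"
    by (auto simp: Basis_vec_def)
  have re: "(\<Prod>b\<in>(Basis :: (real^'n) set). F b) = (\<Prod>i\<in>UNIV. F (axis i 1))" for F :: "real^'n \<Rightarrow> ennreal"
    unfolding basis by (subst prod.reindex[OF inj]) simp
  have "(\<integral>\<^sup>+x. (\<Prod>b\<in>Basis. ennreal (h (ix b) ((x::real^'n) \<bullet> b))) \<partial>lborel) = (\<Prod>b\<in>(Basis::(real^'n) set). \<integral>\<^sup>+x. ennreal (h (ix b) x) \<partial>lborel)"
    using assms by (intro nn_integral_lborel_prod) auto
  then show ?thesis
    unfolding re ix using assms(2) by (simp add: inner_axis prod_ennreal)
qed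

lemma trace_power_multinomial:
  "trace_power k = form k (\<lambda>a. fact k / (\<Prod>i\<in>UNIV. fact (a i)))"
proof (induction k)
  case 0
  show ?case by (simp add: fun_eq_iff trace_power_def form_def exponents_0 monom_at_def)
next
  case (Suc k)
  define m :: "nat \<Rightarrow> ('a \<Rightarrow> nat) \<Rightarrow> real" where "m = (\<lambda>k a. fact k / (\<Prod>i\<in>UNIV. fact (a i)))"
  show ?case
  proof
    fix y :: "real^'a"
    have step: "y $ i * form k (m k) y = form (Suc k) (\<lambda>b. real (b i) * (m (Suc k) b / real (Suc k))) y" for i
    proof -
      let ?Q = "{b \<in> exponents (Suc k). b i > 0}"
      have "y $ i * form k (m k) y = (\<Sum>a\<in>exponents k. m k a * (y $ i * monom_at a y))"
        by (simp add: form_def sum_distrib_left algebra_simps)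
      also have "\<dots> = (\<Sum>b\<in>?Q. real (b i) * (m (Suc k) b / real (Suc k)) * monom_at b y)"
      proof (rule sum.reindex_bij_witness[where i = "\<lambda>b. b(i := b i - 1)" and j = "\<lambda>a. a(i := Suc (a i))"])
        fix a :: "'a \<Rightarrow> nat" assume a: "a \<in> exponents k"
        let ?b = "a(i := Suc (a i))"
        have rest: "sum ?b (UNIV - {i}) = sum a (UNIV - {i})"
          "(\<Prod>j\<in>UNIV - {i}. fact (?b j) :: real) = (\<Prod>j\<in>UNIV - {i}. fact (a j))"
          "(\<Prod>j\<in>UNIV - {i}. y $ j ^ ?b j) = (\<Prod>j\<in>UNIV - {i}. y $ j ^ a j)"
          by (auto intro!: sum.cong prod.cong)
        show "?b \<in> ?Q"
          using a rest(1) sum.remove[of UNIV i a] sum.remove[of UNIV i ?b] by (simp add: exponents_def)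
        show "?b(i := ?b i - 1) = a" by auto
        have "monom_at ?b y = y $ i * monom_at a y"
          unfolding monom_at_remove[of _ y i] rest(3) by simp
        moreover have "real (?b i) * (m (Suc k) ?b / real (Suc k)) = m k a"
        proof -
          have "(\<Prod>j\<in>UNIV. fact (?b j) :: real) = real (Suc (a i)) * (\<Prod>j\<in>UNIV. fact (a j))"
            using rest(2) prod.remove[of UNIV i "\<lambda>j. fact (?b j) :: real"] prod.remove[of UNIV i "\<lambda>j. fact (a j) :: real"]
            by simp
          then show ?thesis by (simp add: m_def del: of_nat_Suc)
        qed
        ultimately show "real (?b i) * (m (Suc k) ?b / real (Suc k)) * monom_at ?b y = m k a * (y $ i * monom_at a y)"
          by simp
      next
        fix b :: "'a \<Rightarrow> nat" assume b: "b \<in> ?Q"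
        then show "(b(i := b i - 1))(i := Suc ((b(i := b i - 1)) i)) = b" by auto
        have "sum (b(i := b i - 1)) (UNIV - {i}) = sum b (UNIV - {i})"
          by (intro sum.cong) auto
        then show "b(i := b i - 1) \<in> exponents k"
          using b sum.remove[of UNIV i b] sum.remove[of UNIV i "b(i := b i - 1)"] by (simp add: exponents_def)
      qed
      also have "\<dots> = form (Suc k) (\<lambda>b. real (b i) * (m (Suc k) b / real (Suc k))) y"
        unfolding form_def by (intro sum.mono_neutral_left) auto
      finally show ?thesis .
    qed
    have "trace_power (Suc k) y = (\<Sum>i\<in>UNIV. y $ i * form k (m k) y)"
      using Suc by (simp add: trace_power_def m_def sum_distrib_right fun_eq_iff)
    also have "\<dots> = form (Suc k) (\<lambda>b. \<Sum>i\<in>UNIV. real (b i) * (m (Suc k) b / real (Suc k))) y"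
      unfolding step form_sum ..
    also have "\<dots> = form (Suc k) (m (Suc k)) y"
    proof (rule fun_cong[OF form_cong])
      fix b :: "'a \<Rightarrow> nat" assume "b \<in> exponents (Suc k)"
      then have "(\<Sum>i\<in>UNIV. real (b i)) = real (Suc k)"
        by (simp add: exponents_def flip: of_nat_sum)
      then show "(\<Sum>i\<in>UNIV. real (b i) * (m (Suc k) b / real (Suc k))) = m (Suc k) b"
        unfolding sum_distrib_right[symmetric] by (simp del: of_nat_Suc)
    qed
    finally show "trace_power (Suc k) y = form (Suc k) (\<lambda>a. fact (Suc k) / (\<Prod>i\<in>UNIV. fact (a i))) y"
      by (simp add: m_def)
  qed
qed

text \<open>The multinomial theorem reduces this to one-dimensional moments \<open>(1/2)\<^sub>n\<close> (up to \<open>sqrt pi\<close>), which combine with the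
  multinomial coefficients to the coefficients of \<open>row_form\<close>.\<close>

lemma nn_integral_gaussian_diagonal:
  fixes y :: "real^'q"
  assumes y: "\<And>i. 0 \<le> y $ i"
  shows "(\<integral>\<^sup>+t. ennreal (exp (- (norm t)\<^sup>2) * (\<Sum>i\<in>UNIV. y $ i * (t $ i)\<^sup>2) ^ k) \<partial>lborel)
    = ennreal (sqrt pi ^ CARD('q) * fact k * row_form k y)"
proof -
  define m :: "('q \<Rightarrow> nat) \<Rightarrow> real" where "m = (\<lambda>a. fact k / (\<Prod>i\<in>UNIV. fact (a i)) * monom_at a y)"
  have m: "m a \<ge> 0" for a
    using y by (auto simp: m_def monom_at_def intro!: mult_nonneg_nonneg divide_nonneg_nonneg prod_nonneg)
  have expand: "exp (- (norm t)\<^sup>2) * (\<Sum>i\<in>UNIV. y $ i * (t $ i)\<^sup>2) ^ k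
      = (\<Sum>a\<in>exponents k. m a * (\<Prod>i\<in>UNIV. exp (- (t $ i)\<^sup>2) * (t $ i) ^ (2 * a i)))" for t :: "real^'q"
  proof -
    have "(\<Sum>i\<in>UNIV. y $ i * (t $ i)\<^sup>2) ^ k = trace_power k (\<chi> i. y $ i * (t $ i)\<^sup>2)"
      by (simp add: trace_power_def)
    also have "\<dots> = (\<Sum>a\<in>exponents k. m a * (\<Prod>i\<in>UNIV. (t $ i) ^ (2 * a i)))"
      unfolding trace_power_multinomial form_def m_def
      by (simp add: monom_at_def power_mult_distrib prod.distrib power_mult mult.assoc)
    finally have 1: "(\<Sum>i\<in>UNIV. y $ i * (t $ i)\<^sup>2) ^ k = \<dots>" .
    have "exp (- (norm t)\<^sup>2) = (\<Prod>i\<in>UNIV. exp (- (t $ i)\<^sup>2))"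
    proof -
      have "(norm t)\<^sup>2 = (\<Sum>i\<in>UNIV. (t $ i)\<^sup>2)"
        unfolding power2_norm_eq_inner by (simp add: inner_vec_def power2_eq_square)
      then show ?thesis by (simp add: exp_sum[symmetric] sum_negf)
    qed
    then show ?thesis
      unfolding 1 sum_distrib_left by (simp add: prod.distrib mult_ac)
  qed
  have trm: "(\<integral>\<^sup>+t. ennreal (m a * (\<Prod>i\<in>UNIV. exp (- (t $ i)\<^sup>2) * (t $ i) ^ (2 * a i))) \<partial>lborel)
      = ennreal (m a * (sqrt pi ^ CARD('q) * (\<Prod>i\<in>UNIV. pochhammer (1/2) (a i))))" for a
  proof -
    have nn: "0 \<le> exp (- x\<^sup>2) * x ^ (2 * n)" for x :: real and n
      by (intro mult_nonneg_nonneg) (auto simp: power_mult)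
    have "(\<integral>\<^sup>+t. ennreal (m a * (\<Prod>i\<in>UNIV. exp (- (t $ i)\<^sup>2) * (t $ i) ^ (2 * a i))) \<partial>lborel)
       = (\<integral>\<^sup>+t. ennreal (m a) * ennreal (\<Prod>i\<in>UNIV. exp (- (t $ i)\<^sup>2) * (t $ i) ^ (2 * a i)) \<partial>lborel)"
      by (intro nn_integral_cong ennreal_mult m prod_nonneg nn)
    also have "\<dots> = ennreal (m a) * (\<integral>\<^sup>+t. ennreal (\<Prod>i\<in>UNIV. exp (- (t $ i)\<^sup>2) * (t $ i) ^ (2 * a i)) \<partial>(lborel :: (real^'q) measure))"
      by (intro nn_integral_cmult) measurable
    also have "\<dots> = ennreal (m a) * (\<Prod>i\<in>UNIV. ennreal (sqrt pi * pochhammer (1/2) (a i)))"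
      by (subst nn_integral_vec_prod) (auto simp: nn nn_integral_gaussian_moment)
    also have "\<dots> = ennreal (m a) * ennreal (sqrt pi ^ CARD('q) * (\<Prod>i\<in>UNIV. pochhammer (1/2) (a i)))"
      by (subst prod_ennreal) (auto simp: prod.distrib pochhammer_nonneg)
    also have "\<dots> = ennreal (m a * (sqrt pi ^ CARD('q) * (\<Prod>i\<in>UNIV. pochhammer (1/2) (a i))))"
      by (intro ennreal_mult[symmetric] m mult_nonneg_nonneg prod_nonneg) (auto simp: pochhammer_nonneg)
    finally show ?thesis .
  qed
  have nnt: "0 \<le> m a * (\<Prod>i\<in>UNIV. exp (- (t $ i)\<^sup>2) * (t $ i) ^ (2 * a i))" for a and t :: "real^'q"
    by (intro mult_nonneg_nonneg m prod_nonneg) (auto simp: power_mult)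
  have "(\<integral>\<^sup>+t. ennreal (exp (- (norm t)\<^sup>2) * (\<Sum>i\<in>UNIV. y $ i * (t $ i)\<^sup>2) ^ k) \<partial>lborel)
      = (\<integral>\<^sup>+t. (\<Sum>a\<in>exponents k. ennreal (m a * (\<Prod>i\<in>UNIV. exp (- (t $ i)\<^sup>2) * (t $ i) ^ (2 * a i)))) \<partial>(lborel :: (real^'q) measure))"
    unfolding expand by (intro nn_integral_cong) (simp add: sum_ennreal nnt)
  also have "\<dots> = (\<Sum>a\<in>exponents k. ennreal (m a * (sqrt pi ^ CARD('q) * (\<Prod>i\<in>UNIV. pochhammer (1/2) (a i)))))"
    by (subst nn_integral_sum) (auto simp: trm)
  also have "\<dots> = ennreal (\<Sum>a\<in>exponents k. m a * (sqrt pi ^ CARD('q) * (\<Prod>i\<in>UNIV. pochhammer (1/2) (a i))))"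
    by (intro sum_ennreal mult_nonneg_nonneg m prod_nonneg) (auto simp: pochhammer_nonneg)
  also have "(\<Sum>a\<in>exponents k. m a * (sqrt pi ^ CARD('q) * (\<Prod>i\<in>UNIV. pochhammer (1/2) (a i)))) = sqrt pi ^ CARD('q) * fact k * row_form k y"
    unfolding row_form_def form_def m_def row_coeff_def
    by (simp add: sum_distrib_left prod_dividef mult_ac)
  finally show ?thesis .
qed

lemma nn_integral_translate:
  fixes f :: "'a::euclidean_space \<Rightarrow> ennreal"
  assumes [measurable]: "f \<in> borel_measurable borel"
  shows "(\<integral>\<^sup>+x. f (x + a) \<partial>lborel) = (\<integral>\<^sup>+x. f x \<partial>lborel)" "(\<integral>\<^sup>+x. f (a - x) \<partial>lborel) = (\<integral>\<^sup>+x. f x \<partial>lborel)"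
proof -
  have plus: "(\<integral>\<^sup>+x. f (a + x) \<partial>lborel) = (\<integral>\<^sup>+x. f x \<partial>lborel)"
    if [measurable]: "f \<in> borel_measurable borel" for f :: "'a \<Rightarrow> ennreal"
    by (subst (2) lborel_distr_plus[of a, symmetric], subst nn_integral_distr) auto
  show "(\<integral>\<^sup>+x. f (x + a) \<partial>lborel) = (\<integral>\<^sup>+x. f x \<partial>lborel)"
    using plus[of f] by (simp add: add.commute)
  have "(\<integral>\<^sup>+x. f x \<partial>lborel)
      = (\<integral>\<^sup>+x. f x \<partial>density (distr lborel borel (\<lambda>x. a + (- 1) *\<^sub>R x)) (\<lambda>x. ennreal (\<bar>- 1\<bar> ^ DIM('a))))"
    using lborel_affine[of "- 1" a] by simp
  also have "\<dots> = (\<integral>\<^sup>+x. f (a - x) \<partial>lborel)"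
    by (simp add: nn_integral_density nn_integral_distr)
  finally show "(\<integral>\<^sup>+x. f (a - x) \<partial>lborel) = (\<integral>\<^sup>+x. f x \<partial>lborel)" ..
qed

lemma orthogonal_borel_measurable:
  fixes T :: "real^'n \<Rightarrow> real^'n"
  assumes "orthogonal_transformation T"
  shows "T \<in> borel_measurable borel"
  using orthogonal_transformation_linear[OF assms]
  by (intro borel_measurable_continuous_onI linear_continuous_on) (simp add: linear_conv_bounded_linear)

text \<open>Uniqueness of Haar measure in miniature: in the double integral of \<open>f x\<close> times a Gaussian \<open>g\<close>, translations and
  Fubini's theorem move \<open>T\<close> from \<open>g\<close>, which is invariant, to \<open>f\<close>; finally the finite integral of \<open>g\<close>
  cancels.\<close>

lemma nn_integral_orthogonal:
  fixes T :: "real^'n \<Rightarrow> real^'n"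
  assumes T: "orthogonal_transformation T" and f [measurable]: "f \<in> borel_measurable borel"
  shows "(\<integral>\<^sup>+x. f (T x) \<partial>lborel) = (\<integral>\<^sup>+x. f x \<partial>lborel)"
proof -
  note [measurable] = orthogonal_borel_measurable[OF T]
  have lin: "linear T" using T by (rule orthogonal_transformation_linear)
  have surj: "surj T" using T by (rule orthogonal_transformation_surj)
  define g :: "real^'n \<Rightarrow> ennreal" where "g = (\<lambda>x. ennreal (exp (- (norm x)\<^sup>2)))"
  have g [measurable]: "g \<in> borel_measurable borel" by (simp add: g_def)
  have gT: "g (T x) = g x" for x
    using orthogonal_transformation_norm[OF T, of x] by (simp add: g_def)
  have G: "(\<integral>\<^sup>+x. g x \<partial>lborel) = ennreal (sqrt pi ^ CARD('n))"
    using nn_integral_gaussian_diagonal[of "axis_point undefined :: real^'n" 0]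
    by (simp add: g_def axis_point_def row_form_def form_def exponents_0 monom_at_def row_coeff_def)
  have "(\<integral>\<^sup>+x. f x \<partial>lborel) * (\<integral>\<^sup>+y. g y \<partial>lborel) = (\<integral>\<^sup>+y. (\<integral>\<^sup>+x. f x \<partial>lborel) * g (T y) \<partial>lborel)"
    by (simp add: nn_integral_cmult gT)
  also have "\<dots> = (\<integral>\<^sup>+y. (\<integral>\<^sup>+x. f (x + T y) * g (T y) \<partial>lborel) \<partial>lborel)"
    by (simp add: nn_integral_multc nn_integral_translate(1))
  also have "\<dots> = (\<integral>\<^sup>+x. (\<integral>\<^sup>+y. f (x + T y) * g (T y) \<partial>lborel) \<partial>lborel)"
    by (rule lborel_pair.Fubini') measurable
  also have "\<dots> = (\<integral>\<^sup>+x. (\<integral>\<^sup>+y. f (T y) * g (T y - x) \<partial>lborel) \<partial>lborel)"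
  proof (rule nn_integral_cong)
    fix x :: "real^'n"
    obtain x' where x': "x = T x'" using surj by (metis surjD)
    have "(\<integral>\<^sup>+y. f (T y) * g (T y - x) \<partial>lborel) = (\<integral>\<^sup>+y. f (T (y + x')) * g (T (y + x') - x) \<partial>lborel)"
      by (rule nn_integral_translate(1)[symmetric]) measurable
    also have "\<dots> = (\<integral>\<^sup>+y. f (x + T y) * g (T y) \<partial>lborel)"
      by (simp add: linear_add[OF lin] x' add.commute)
    finally show "(\<integral>\<^sup>+y. f (x + T y) * g (T y) \<partial>lborel) = (\<integral>\<^sup>+y. f (T y) * g (T y - x) \<partial>lborel)" ..
  qed
  also have "\<dots> = (\<integral>\<^sup>+y. (\<integral>\<^sup>+x. f (T y) * g (T y - x) \<partial>lborel) \<partial>lborel)"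
    by (rule lborel_pair.Fubini') measurable
  also have "\<dots> = (\<integral>\<^sup>+y. f (T y) \<partial>lborel) * (\<integral>\<^sup>+x. g x \<partial>lborel)"
    by (simp add: nn_integral_cmult nn_integral_translate(2) nn_integral_multc)
  finally have "ennreal (sqrt pi ^ CARD('n)) * (\<integral>\<^sup>+x. f x \<partial>lborel) = ennreal (sqrt pi ^ CARD('n)) * (\<integral>\<^sup>+y. f (T y) \<partial>lborel)"
    by (simp add: G mult.commute)
  moreover have "sqrt pi ^ CARD('n) > 0" by simp
  ultimately show ?thesis
    by (simp add: ennreal_mult_cancel_left ennreal_eq_0_iff not_le del: zero_less_power_eq)
qed

lemma nn_integral_Gamma:
  assumes "a > 0" "c > 0"
  shows "(\<integral>\<^sup>+t. ennreal (indicator {0..} t * t powr (a - 1) * exp (- c * t)) \<partial>lborel) = ennreal (Gamma a / c powr a)"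
proof -
  let ?I = "\<integral>\<^sup>+t. ennreal (indicator {0..} t * t powr (a - 1) * exp (- c * t)) \<partial>lborel"
  have "ennreal (Gamma a) = (\<integral>\<^sup>+t. ennreal (indicat_real {0..} t * (t powr (a - 1) / exp t)) \<partial>lborel)"
    by (rule nn_integral_has_integral_lebesgue[OF _ Gamma_integral_real[OF assms(1)], symmetric]) simp
  also have "\<dots> = ennreal \<bar>c\<bar> * (\<integral>\<^sup>+t. ennreal (indicat_real {0..} (0 + c * t) * ((0 + c * t) powr (a - 1) / exp (0 + c * t))) \<partial>lborel)"
    using assms(2) by (intro nn_integral_real_affine) auto
  also have "\<dots> = ennreal c * (\<integral>\<^sup>+t. ennreal (c powr (a - 1)) * ennreal (indicator {0..} t * t powr (a - 1) * exp (- c * t)) \<partial>lborel)"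
  proof -
    have "indicat_real {0..} (0 + c * t) * ((0 + c * t) powr (a - 1) / exp (0 + c * t))
        = c powr (a - 1) * (indicator {0..} t * t powr (a - 1) * exp (- c * t))" for t
      using assms(2) by (auto simp: indicator_def powr_mult exp_minus field_simps zero_le_mult_iff)
    then show ?thesis using assms(2) by (simp add: ennreal_mult[symmetric])
  qed
  also have "\<dots> = ennreal c * (ennreal (c powr (a - 1)) * ?I)"
    by (subst nn_integral_cmult) auto
  also have "\<dots> = ennreal (c powr a) * ?I"
  proof -
    have "c * c powr (a - 1) = c powr a" using assms(2) by (simp add: powr_mult_base)
    then show ?thesis using assms(2) by (simp add: mult.assoc[symmetric] ennreal_mult[symmetric])
  qed
  finally have eq: "ennreal (Gamma a) = ennreal (c powr a) * ?I" .
  have "?I = ennreal (1 / c powr a) * ennreal (c powr a) * ?I"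
    using assms(2) by (simp add: ennreal_mult[symmetric])
  also have "\<dots> = ennreal (1 / c powr a) * ennreal (Gamma a)"
    by (simp add: eq mult.assoc)
  also have "\<dots> = ennreal (Gamma a / c powr a)"
    using assms by (simp add: ennreal_mult[symmetric] Gamma_real_nonneg)
  finally show ?thesis .
qed

text \<open>With \<open>a = (p + 1)/2\<close> and \<open>b = k + p/2\<close>, write \<open>\<Gamma>(a) |x|^(-2a)\<close> as the integral of \<open>l^(a-1) exp (-l |x|^2)\<close> over
  \<open>l > 0\<close>.  Scaling \<open>x\<close> by \<open>(1 + l)^(-1/2)\<close> extracts \<open>(1 + l)^(-b)\<close> from the integral over \<open>x\<close>, and what remains is
  the beta integral of \<open>l^(a-1) (1 + l)^(-b)\<close>, which converges for \<open>b - a = k - 1/2 > 0\<close>.\<close>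

lemma nn_integral_radial:
  fixes h :: "real^'p \<Rightarrow> real"
  assumes h [measurable]: "h \<in> borel_measurable borel" and nonneg: "\<And>x. 0 \<le> h x"
    and homogeneous: "\<And>c x. c > 0 \<Longrightarrow> h (c *\<^sub>R x) = c ^ (2 * k) * h x" and k: "k \<ge> 1"
  shows "(\<integral>\<^sup>+x. ennreal (exp (- (norm x)\<^sup>2) * h x / norm x ^ (CARD('p) + 1)) \<partial>lborel)
    = ennreal (Gamma (real k - 1/2) / Gamma (real k + real CARD('p) / 2)) * (\<integral>\<^sup>+x. ennreal (exp (- (norm x)\<^sup>2) * h x) \<partial>lborel)"
proof -
  define a where "a = (real CARD('p) + 1) / 2"
  define b where "b = real k + real CARD('p) / 2"
  define w :: "real \<Rightarrow> real \<Rightarrow> real" where "w = (\<lambda>a t. indicator {0..} t * t powr (a - 1))"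
  have a: "a > 0" by (simp add: a_def)
  have b: "b > 0" using k by (simp add: b_def add_pos_nonneg)
  have ba: "b - a = real k - 1/2" "b - a > 0" using k by (auto simp: a_def b_def field_simps)
  have w0: "0 \<le> w a t" for a t by (simp add: w_def)
  have w_meas [measurable]: "(\<lambda>t. w c t) \<in> borel_measurable borel" for c
    unfolding w_def by measurable
  have Gam: "(\<integral>\<^sup>+t. ennreal (w d t * exp (- c * t)) \<partial>lborel) = ennreal (Gamma d / c powr d)" if "d > 0" "c > 0" for c d
    using nn_integral_Gamma[OF that] by (simp add: w_def)
  define L where "L = (\<integral>\<^sup>+x. ennreal (exp (- (norm x)\<^sup>2) * h x / norm x ^ (CARD('p) + 1)) \<partial>lborel)"
  define H where "H = (\<integral>\<^sup>+x. ennreal (exp (- (norm x)\<^sup>2) * h x) \<partial>lborel)"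
  define B where "B = (\<integral>\<^sup>+l. ennreal (w a l * (1 + l) powr (- b)) \<partial>lborel)"
  have scaled: "(\<integral>\<^sup>+x. ennreal (exp (- (1 + l) * (norm x)\<^sup>2) * h x) \<partial>lborel) = ennreal ((1 + l) powr (- b)) * H"
    if l: "l \<ge> 0" for l
  proof -
    define c where "c = (1 + l) powr (- (1/2))"
    have c: "c > 0" using l by (simp add: c_def)
    have c2: "(1 + l) * c\<^sup>2 = 1"
    proof -
      have "c\<^sup>2 = (1 + l) powr (- (1/2) * real 2)"
        using l unfolding c_def by (subst powr_power) auto
      also have "- (1/2) * real 2 = - 1" by simp
      also have "(1 + l) powr - 1 = 1 / (1 + l)" using l by (simp add: powr_minus_divide)
      finally show ?thesis using l by simp
    qed
    have cb: "c ^ CARD('p) * c ^ (2 * k) = (1 + l) powr (- b)"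
    proof -
      have "c ^ CARD('p) * c ^ (2 * k) = ((1 + l) powr (- (1/2))) ^ (CARD('p) + 2 * k)"
        by (simp add: c_def power_add)
      also have "\<dots> = (1 + l) powr (- (1/2) * real (CARD('p) + 2 * k))"
        using l by (subst powr_power) auto
      also have "- (1/2) * real (CARD('p) + 2 * k) = - b"
        by (simp add: b_def field_simps)
      finally show ?thesis .
    qed
    have "(\<integral>\<^sup>+x. ennreal (exp (- (1 + l) * (norm x)\<^sup>2) * h x) \<partial>lborel)
        = ennreal (c ^ DIM(real^'p)) * (\<integral>\<^sup>+x. ennreal (exp (- (1 + l) * (norm (c *\<^sub>R x))\<^sup>2) * h (c *\<^sub>R x)) \<partial>lborel)"
      by (rule nn_integral_scale[OF _ c]) measurable
    also have "\<dots> = ennreal (c ^ CARD('p)) * (\<integral>\<^sup>+x. ennreal (c ^ (2 * k)) * ennreal (exp (- (norm (x::real^'p))\<^sup>2) * h x) \<partial>lborel)"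
    proof -
      have "exp (- (1 + l) * (norm (c *\<^sub>R x))\<^sup>2) * h (c *\<^sub>R x) = c ^ (2 * k) * (exp (- (norm x)\<^sup>2) * h x)" for x
      proof -
        have "(1 + l) * (norm (c *\<^sub>R x))\<^sup>2 = ((1 + l) * c\<^sup>2) * (norm x)\<^sup>2"
          using c by (simp add: power_mult_distrib)
        then have "- (1 + l) * (norm (c *\<^sub>R x))\<^sup>2 = - (norm x)\<^sup>2"
          unfolding c2 mult_minus_left by (simp only: mult_1_left)
        then show ?thesis unfolding homogeneous[OF c] by (simp only: mult.left_commute)
      qed
      then show ?thesis using c nonneg by (simp add: ennreal_mult[symmetric])
    qed
    also have "\<dots> = ennreal (c ^ CARD('p)) * (ennreal (c ^ (2 * k)) * H)"
      unfolding H_def by (subst nn_integral_cmult) auto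
    also have "\<dots> = ennreal ((1 + l) powr (- b)) * H"
      using c by (simp add: cb[symmetric] ennreal_mult mult.assoc)
    finally show ?thesis .
  qed
  have "ennreal (Gamma a) * L = (\<integral>\<^sup>+x. ennreal (Gamma a) * ennreal (exp (- (norm x)\<^sup>2) * h x / norm x ^ (CARD('p) + 1)) \<partial>lborel)"
    unfolding L_def by (subst nn_integral_cmult) auto
  also have "\<dots> = (\<integral>\<^sup>+x. (\<integral>\<^sup>+l. ennreal (w a l * exp (- (norm x)\<^sup>2 * l)) * ennreal (exp (- (norm x)\<^sup>2) * h x) \<partial>lborel) \<partial>lborel)"
  proof (rule nn_integral_cong_AE)
    have "AE x::real^'p in lborel. x \<noteq> 0" by (rule AE_lborel_singleton)
    then show "AE x::real^'p in lborel. ennreal (Gamma a) * ennreal (exp (- (norm x)\<^sup>2) * h x / norm x ^ (CARD('p) + 1))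
        = (\<integral>\<^sup>+l. ennreal (w a l * exp (- (norm x)\<^sup>2 * l)) * ennreal (exp (- (norm x)\<^sup>2) * h x) \<partial>lborel)"
    proof eventually_elim
      fix x :: "real^'p" assume x: "x \<noteq> 0"
      have "((norm x)\<^sup>2) powr a = norm x ^ (CARD('p) + 1)"
      proof -
        have "((norm x)\<^sup>2) powr a = norm x powr (2 * a)"
          using x by (simp add: powr_powr[symmetric] flip: powr_numeral)
        also have "2 * a = real (CARD('p) + 1)" by (simp add: a_def)
        also have "norm x powr real (CARD('p) + 1) = norm x ^ (CARD('p) + 1)"
          using x by (intro powr_realpow) simp
        finally show ?thesis .
      qed
      then have "(\<integral>\<^sup>+l. ennreal (w a l * exp (- (norm x)\<^sup>2 * l)) \<partial>lborel) = ennreal (Gamma a / norm x ^ (CARD('p) + 1))"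
        using Gam[of a "(norm x)\<^sup>2"] a x by simp
      then show "ennreal (Gamma a) * ennreal (exp (- (norm x)\<^sup>2) * h x / norm x ^ (CARD('p) + 1))
        = (\<integral>\<^sup>+l. ennreal (w a l * exp (- (norm x)\<^sup>2 * l)) * ennreal (exp (- (norm x)\<^sup>2) * h x) \<partial>lborel)"
        using a nonneg[of x] by (subst nn_integral_multc) (auto simp: ennreal_mult[symmetric] Gamma_real_nonneg)
    qed
  qed
  also have "\<dots> = (\<integral>\<^sup>+l. (\<integral>\<^sup>+x. ennreal (w a l * exp (- (norm x)\<^sup>2 * l)) * ennreal (exp (- (norm x)\<^sup>2) * h x) \<partial>lborel) \<partial>lborel)"
    by (rule lborel_pair.Fubini') measurable
  also have "\<dots> = (\<integral>\<^sup>+l. ennreal (w a l * (1 + l) powr (- b)) * H \<partial>lborel)"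
  proof (rule nn_integral_cong)
    fix l :: real
    show "(\<integral>\<^sup>+x. ennreal (w a l * exp (- (norm x)\<^sup>2 * l)) * ennreal (exp (- (norm x)\<^sup>2) * h x) \<partial>lborel) = ennreal (w a l * (1 + l) powr (- b)) * H"
    proof (cases "l \<ge> 0")
      case True
      have "ennreal (w a l * exp (- (norm x)\<^sup>2 * l)) * ennreal (exp (- (norm x)\<^sup>2) * h x)
          = ennreal (w a l) * ennreal (exp (- (1 + l) * (norm x)\<^sup>2) * h x)" for x
      proof -
        have "exp (- (norm x)\<^sup>2 * l) * exp (- (norm x)\<^sup>2) = exp (- (1 + l) * (norm x)\<^sup>2)"
          by (simp add: exp_add[symmetric] algebra_simps)
        then have "w a l * exp (- (norm x)\<^sup>2 * l) * (exp (- (norm x)\<^sup>2) * h x) = w a l * (exp (- (1 + l) * (norm x)\<^sup>2) * h x)"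
          by (metis mult.assoc)
        then show ?thesis using w0[of a l] nonneg[of x] by (simp add: ennreal_mult[symmetric])
      qed
      then have "(\<integral>\<^sup>+x. ennreal (w a l * exp (- (norm x)\<^sup>2 * l)) * ennreal (exp (- (norm x)\<^sup>2) * h x) \<partial>lborel)
          = ennreal (w a l) * (\<integral>\<^sup>+x. ennreal (exp (- (1 + l) * (norm x)\<^sup>2) * h x) \<partial>lborel)"
        by (simp only:) (intro nn_integral_cmult, measurable)
      then show ?thesis
        unfolding scaled[OF True] using w0[of a l] by (simp add: ennreal_mult mult.assoc)
    next
      case False
      then have "w a l = 0" by (simp add: w_def)
      then show ?thesis by simp
    qed
  qed
  also have "\<dots> = B * H"
    unfolding B_def by (rule nn_integral_multc) measurable
  finally have LB: "ennreal (Gamma a) * L = B * H" .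
  have "ennreal (Gamma b) * B = (\<integral>\<^sup>+l. ennreal (Gamma b) * ennreal (w a l * (1 + l) powr (- b)) \<partial>lborel)"
    unfolding B_def by (subst nn_integral_cmult) auto
  also have "\<dots> = (\<integral>\<^sup>+l. (\<integral>\<^sup>+x. ennreal (w a l) * ennreal (w b x * exp (- (1 + l) * x)) \<partial>lborel) \<partial>lborel)"
  proof (rule nn_integral_cong)
    fix l :: real
    show "ennreal (Gamma b) * ennreal (w a l * (1 + l) powr (- b)) = (\<integral>\<^sup>+x. ennreal (w a l) * ennreal (w b x * exp (- (1 + l) * x)) \<partial>lborel)"
    proof (cases "l \<ge> 0")
      case True
      then have "(\<integral>\<^sup>+x. ennreal (w b x * exp (- (1 + l) * x)) \<partial>lborel) = ennreal (Gamma b / (1 + l) powr b)"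
        using Gam[OF b, of "1 + l"] by simp
      then show ?thesis
        using b w0[of a l] by (subst nn_integral_cmult) (auto simp: ennreal_mult[symmetric] Gamma_real_nonneg powr_minus divide_inverse mult_ac)
    next
      case False
      then have "w a l = 0" by (simp add: w_def)
      then show ?thesis by simp
    qed
  qed
  also have "\<dots> = (\<integral>\<^sup>+x. (\<integral>\<^sup>+l. ennreal (w a l) * ennreal (w b x * exp (- (1 + l) * x)) \<partial>lborel) \<partial>lborel)"
    by (rule lborel_pair.Fubini') measurable
  also have "\<dots> = (\<integral>\<^sup>+x. ennreal (Gamma a) * ennreal (w (b - a) x * exp (- 1 * x)) \<partial>lborel)"
  proof (rule nn_integral_cong)
    fix x :: real
    show "(\<integral>\<^sup>+l. ennreal (w a l) * ennreal (w b x * exp (- (1 + l) * x)) \<partial>lborel) = ennreal (Gamma a) * ennreal (w (b - a) x * exp (- 1 * x))"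
    proof (cases "x > 0")
      case True
      have "ennreal (w a l) * ennreal (w b x * exp (- (1 + l) * x)) = ennreal (w b x * exp (- x)) * ennreal (w a l * exp (- x * l))" for l
      proof -
        have "exp (- (1 + l) * x) = exp (- x) * exp (- x * l)"
          by (simp add: exp_add[symmetric] algebra_simps)
        then show ?thesis using w0[of a l] w0[of b x] by (simp add: ennreal_mult[symmetric] mult_ac)
      qed
      then have "(\<integral>\<^sup>+l. ennreal (w a l) * ennreal (w b x * exp (- (1 + l) * x)) \<partial>lborel)
          = ennreal (w b x * exp (- x)) * (\<integral>\<^sup>+l. ennreal (w a l * exp (- x * l)) \<partial>lborel)"
        by (simp only:) (intro nn_integral_cmult, measurable)
      also have "\<dots> = ennreal (w b x * exp (- x)) * ennreal (Gamma a / x powr a)"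
        using Gam[OF a True] by simp
      also have "\<dots> = ennreal (Gamma a) * ennreal (w (b - a) x * exp (- 1 * x))"
      proof -
        have ratio: "x powr (b - 1) / x powr a = x powr (b - a - 1)"
          using True by (simp add: powr_diff[symmetric] algebra_simps)
        have left: "w b x * exp (- x) * (Gamma a / x powr a) = Gamma a * exp (- x) * (x powr (b - 1) / x powr a)"
          using True by (simp add: w_def)
        have right: "Gamma a * (w (b - a) x * exp (- 1 * x)) = Gamma a * exp (- x) * x powr (b - a - 1)"
          using True by (simp add: w_def)
        have "w b x * exp (- x) * (Gamma a / x powr a) = Gamma a * (w (b - a) x * exp (- 1 * x))"
          unfolding left right ratio ..
        then show ?thesis using w0 a by (simp add: ennreal_mult[symmetric] Gamma_real_nonneg)
      qed
      finally show ?thesis .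
    next
      case False
      then have "w b x = 0" "w (b - a) x = 0" by (auto simp: w_def indicator_def)
      then show ?thesis by simp
    qed
  qed
  also have "\<dots> = ennreal (Gamma a) * ennreal (Gamma (b - a))"
    using Gam[OF ba(2), of 1] by (subst nn_integral_cmult) auto
  finally have GB: "ennreal (Gamma b) * B = ennreal (Gamma a) * ennreal (Gamma (b - a))" .
  have Ga: "Gamma a > 0" and Gb: "Gamma b > 0" and Gba: "Gamma (b - a) > 0"
    using a b ba by (auto intro: Gamma_real_pos)
  have "ennreal (Gamma a) * (ennreal (Gamma b) * L) = ennreal (Gamma b) * (B * H)"
    using LB by (metis mult.left_commute)
  also have "\<dots> = ennreal (Gamma a) * (ennreal (Gamma (b - a)) * H)"
    using GB by (metis mult.assoc)
  finally have "ennreal (Gamma b) * L = ennreal (Gamma (b - a)) * H"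
    using Ga by (simp add: ennreal_mult_cancel_left ennreal_eq_0_iff not_le)
  then have "ennreal (1 / Gamma b) * (ennreal (Gamma b) * L) = ennreal (1 / Gamma b) * (ennreal (Gamma (b - a)) * H)"
    by simp
  then have "L = ennreal (Gamma (b - a) / Gamma b) * H"
    using Gb Gba by (simp add: mult.assoc[symmetric] ennreal_mult[symmetric])
  then have "L = ennreal (Gamma (real k - 1/2) / Gamma b) * H"
    by (simp only: ba(1))
  then show ?thesis
    unfolding L_def H_def b_def .
qed

lemma nn_integral_gaussian_quadratic:
  fixes S :: "real^'q^'q"
  assumes S: "eigenvalue_vec S y" and psd: "\<And>x. 0 \<le> x \<bullet> (S *v x)"
  shows "(\<integral>\<^sup>+t. ennreal (exp (- (norm t)\<^sup>2) * (t \<bullet> (S *v t)) ^ k) \<partial>lborel)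
    = ennreal (sqrt pi ^ CARD('q) * fact k * row_form k y)" and "0 \<le> y $ i" and "\<And>c. (\<And>x. x \<bullet> (S *v x) \<le> c * (x \<bullet> x)) \<Longrightarrow> y $ i \<le> c"
proof -
  obtain Q where Q: "orthogonal_matrix Q" "S = Q ** diag_matrix (\<lambda>i. y $ i) ** transpose Q"
    using S by (auto simp: eigenvalue_vec_def diag_matrix_def)
  have eig: "(Q *v axis i 1) \<bullet> (S *v (Q *v axis i 1)) = y $ i" "(Q *v axis i 1) \<bullet> (Q *v axis i 1) = 1" for i
  proof -
    have tx: "transpose Q *v (Q *v axis i 1) = axis i 1"
      using Q(1) by (simp add: matrix_vector_mul_assoc orthogonal_matrix_def)
    show "(Q *v axis i 1) \<bullet> (S *v (Q *v axis i 1)) = y $ i"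
      unfolding Q(2) conj_diag_quadratic tx by (simp add: axis_def if_distrib[of "\<lambda>x. _ * x"] if_distrib[of "\<lambda>x. x\<^sup>2"] cong: if_cong)
    show "(Q *v axis i 1) \<bullet> (Q *v axis i 1) = 1"
      unfolding dot_matrix_vector[of "Q *v axis i 1" Q] tx by (simp add: inner_axis_axis)
  qed
  have y0: "0 \<le> y $ i" for i using psd[of "Q *v axis i 1"] by (simp only: eig)
  then show "0 \<le> y $ i" .
  show "y $ i \<le> c" if "\<And>x. x \<bullet> (S *v x) \<le> c * (x \<bullet> x)" for c
    using that[of "Q *v axis i 1"] by (simp only: eig mult_1_right)
  have orth: "orthogonal_transformation (\<lambda>t. transpose Q *v t)"
    unfolding orthogonal_transformation_matrix
    by (rule conjI[OF matrix_vector_mul_linear]) (simp only: matrix_of_matrix_vector_mul orthogonal_matrix_transpose Q(1))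
  have norm: "norm (transpose Q *v t) = norm t" for t
    by (rule orthogonal_transformation_norm[OF orth])
  have "(\<integral>\<^sup>+t. ennreal (exp (- (norm t)\<^sup>2) * (t \<bullet> (S *v t)) ^ k) \<partial>lborel)
      = (\<integral>\<^sup>+t. ennreal (exp (- (norm (transpose Q *v t))\<^sup>2) * (\<Sum>i\<in>UNIV. y $ i * ((transpose Q *v t) $ i)\<^sup>2) ^ k) \<partial>lborel)"
    unfolding norm Q(2) conj_diag_quadratic ..
  also have "\<dots> = (\<integral>\<^sup>+t. ennreal (exp (- (norm t)\<^sup>2) * (\<Sum>i\<in>UNIV. y $ i * (t $ i)\<^sup>2) ^ k) \<partial>lborel)"
    by (rule nn_integral_orthogonal[OF orth, of "\<lambda>t. ennreal (exp (- (norm t)\<^sup>2) * (\<Sum>i\<in>UNIV. y $ i * (t $ i)\<^sup>2) ^ k)"]) measurable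
  also have "\<dots> = ennreal (sqrt pi ^ CARD('q) * fact k * row_form k y)"
    by (rule nn_integral_gaussian_diagonal[OF y0])
  finally show "(\<integral>\<^sup>+t. ennreal (exp (- (norm t)\<^sup>2) * (t \<bullet> (S *v t)) ^ k) \<partial>lborel)
    = ennreal (sqrt pi ^ CARD('q) * fact k * row_form k y)" .
qed

lemma nn_integral_gaussian_linear:
  fixes v :: "real^'p"
  shows "(\<integral>\<^sup>+s. ennreal (exp (- (norm s)\<^sup>2) * (s \<bullet> v) ^ (2 * k)) \<partial>lborel)
    = ennreal (sqrt pi ^ CARD('p) * pochhammer (1/2) k * norm v ^ (2 * k))"
proof -
  fix i :: 'p
  have "norm v = norm (norm v *\<^sub>R axis i 1 :: real^'p)" by simp
  then have "\<exists>T :: real^'p \<Rightarrow> real^'p. orthogonal_transformation T \<and> T v = norm v *\<^sub>R axis i 1"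
    by (rule orthogonal_transformation_exists) blast
  then obtain T :: "real^'p \<Rightarrow> real^'p" where T: "orthogonal_transformation T" "T v = norm v *\<^sub>R axis i 1" by blast
  have eq: "(s \<bullet> v) ^ (2 * k) = norm v ^ (2 * k) * (\<Sum>j\<in>UNIV. axis_point i $ j * (T s $ j)\<^sup>2) ^ k" for s
  proof -
    have "s \<bullet> v = T s \<bullet> T v" using T(1) by (simp add: orthogonal_transformation_def)
    also have "\<dots> = norm v * T s $ i" by (simp add: T(2) inner_axis)
    finally have "(s \<bullet> v) ^ (2 * k) = norm v ^ (2 * k) * ((T s $ i)\<^sup>2) ^ k"
      by (simp add: power_mult_distrib power_mult)
    moreover have "(\<Sum>j\<in>UNIV. axis_point i $ j * (T s $ j)\<^sup>2) = (T s $ i)\<^sup>2"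
      by (simp add: axis_point_def if_distrib[of "\<lambda>x. x * _"] cong: if_cong)
    ultimately show ?thesis by simp
  qed
  have "(\<integral>\<^sup>+s. ennreal (exp (- (norm s)\<^sup>2) * (s \<bullet> v) ^ (2 * k)) \<partial>lborel)
      = (\<integral>\<^sup>+s. ennreal (norm v ^ (2 * k)) * ennreal (exp (- (norm (T s))\<^sup>2) * (\<Sum>j\<in>UNIV. axis_point i $ j * (T s $ j)\<^sup>2) ^ k) \<partial>lborel)"
    unfolding eq orthogonal_transformation_norm[OF T(1)]
    by (intro nn_integral_cong) (simp add: ennreal_mult'[symmetric] mult_ac)
  also have "\<dots> = (\<integral>\<^sup>+s. ennreal (norm v ^ (2 * k)) * ennreal (exp (- (norm s)\<^sup>2) * (\<Sum>j\<in>UNIV. axis_point i $ j * (s $ j)\<^sup>2) ^ k) \<partial>lborel)"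
    by (rule nn_integral_orthogonal[OF T(1), of "\<lambda>s. ennreal (norm v ^ (2 * k)) * ennreal (exp (- (norm s)\<^sup>2) * (\<Sum>j\<in>UNIV. axis_point i $ j * (s $ j)\<^sup>2) ^ k)"]) measurable
  also have "\<dots> = ennreal (norm v ^ (2 * k)) * (\<integral>\<^sup>+s. ennreal (exp (- (norm s)\<^sup>2) * (\<Sum>j\<in>UNIV. axis_point i $ j * (s $ j)\<^sup>2) ^ k) \<partial>(lborel :: (real^'p) measure))"
    by (intro nn_integral_cmult) measurable
  also have "\<dots> = ennreal (norm v ^ (2 * k)) * ennreal (sqrt pi ^ CARD('p) * fact k * row_form k (axis_point i :: real^'p))"
    by (subst nn_integral_gaussian_diagonal) (auto simp: axis_point_def)
  also have "\<dots> = ennreal (sqrt pi ^ CARD('p) * pochhammer (1/2) k * norm v ^ (2 * k))"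
    by (simp add: row_form_axis_point row_coeff_def ennreal_mult'[symmetric] mult_ac)
  finally show ?thesis .
qed

lemma nn_integral_distance_term:
  fixes R :: "real^'q^'p"
  assumes y: "eigenvalue_vec (transpose R ** R) y" and k: "k \<ge> 1"
  shows "(\<integral>\<^sup>+z. ennreal (exp (- (norm (fst z))\<^sup>2) * exp (- (norm (snd z))\<^sup>2) * (fst z \<bullet> (R *v snd z)) ^ (2 * k)
       / (norm (fst z) ^ (CARD('p) + 1) * norm (snd z) ^ (CARD('q) + 1))) \<partial>(lborel :: ((real^'p) \<times> (real^'q)) measure))
    = ennreal (Gamma (real k - 1/2) / Gamma (real k + real CARD('p) / 2) * (Gamma (real k - 1/2) / Gamma (real k + real CARD('q) / 2))
       * sqrt pi ^ CARD('p) * sqrt pi ^ CARD('q) * pochhammer (1/2) k * fact k * row_form k y)"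
proof -
  define gp where "gp = Gamma (real k - 1/2) / Gamma (real k + real CARD('p) / 2)"
  define gq where "gq = Gamma (real k - 1/2) / Gamma (real k + real CARD('q) / 2)"
  have gp: "gp \<ge> 0" and gq: "gq \<ge> 0"
    using k by (auto simp: gp_def gq_def intro!: divide_nonneg_nonneg Gamma_real_nonneg add_pos_nonneg)
  have quad: "t \<bullet> ((transpose R ** R) *v t) = (norm (R *v t))\<^sup>2" for t
    using dot_matrix_vector[of "R *v t" R t] by (simp add: power2_norm_eq_inner matrix_vector_mul_assoc[symmetric] inner_commute del: matrix_vector_mul_assoc)
  have cont [measurable]: "(\<lambda>t. R *v t) \<in> borel_measurable borel"
    by (intro borel_measurable_continuous_onI linear_continuous_on) simp
  define F where "F = (\<lambda>(s::real^'p) (t::real^'q). exp (- (norm s)\<^sup>2) * exp (- (norm t)\<^sup>2) * (s \<bullet> (R *v t)) ^ (2 * k)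
       / (norm s ^ (CARD('p) + 1) * norm t ^ (CARD('q) + 1)))"
  have inner: "(\<integral>\<^sup>+s. ennreal (F s t) \<partial>lborel)
      = ennreal (gp * sqrt pi ^ CARD('p) * pochhammer (1/2) k) * ennreal (exp (- (norm t)\<^sup>2) * (t \<bullet> ((transpose R ** R) *v t)) ^ k / norm t ^ (CARD('q) + 1))" for t
  proof -
    define e where "e = exp (- (norm t)\<^sup>2) / norm t ^ (CARD('q) + 1)"
    have e: "e \<ge> 0" by (simp add: e_def)
    have "(\<integral>\<^sup>+s. ennreal (F s t) \<partial>lborel)
        = (\<integral>\<^sup>+s. ennreal e * ennreal (exp (- (norm s)\<^sup>2) * (s \<bullet> (R *v t)) ^ (2 * k) / norm s ^ (CARD('p) + 1)) \<partial>lborel)"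
      unfolding F_def by (intro nn_integral_cong) (simp add: e_def ennreal_mult'[symmetric] mult_ac)
    also have "\<dots> = ennreal e * (\<integral>\<^sup>+s. ennreal (exp (- (norm s)\<^sup>2) * (s \<bullet> (R *v t)) ^ (2 * k) / norm s ^ (CARD('p) + 1)) \<partial>lborel)"
      by (intro nn_integral_cmult) measurable
    also have "(\<integral>\<^sup>+s. ennreal (exp (- (norm s)\<^sup>2) * (s \<bullet> (R *v t)) ^ (2 * k) / norm s ^ (CARD('p) + 1)) \<partial>(lborel :: (real^'p) measure))
        = ennreal gp * ennreal (sqrt pi ^ CARD('p) * pochhammer (1/2) k * norm (R *v t) ^ (2 * k))"
      unfolding gp_def nn_integral_gaussian_linear[symmetric]
      by (rule nn_integral_radial[OF _ _ _ k]) (auto simp: power_mult power_mult_distrib)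
    also have "ennreal e * (ennreal gp * ennreal (sqrt pi ^ CARD('p) * pochhammer (1/2) k * norm (R *v t) ^ (2 * k)))
        = ennreal (e * (gp * (sqrt pi ^ CARD('p) * pochhammer (1/2) k * norm (R *v t) ^ (2 * k))))"
      using e gp by (simp add: ennreal_mult')
    also have "e * (gp * (sqrt pi ^ CARD('p) * pochhammer (1/2) k * norm (R *v t) ^ (2 * k)))
        = (gp * sqrt pi ^ CARD('p) * pochhammer (1/2) k) * (exp (- (norm t)\<^sup>2) * (t \<bullet> ((transpose R ** R) *v t)) ^ k / norm t ^ (CARD('q) + 1))"
      unfolding quad e_def by (simp add: power_mult)
    also have "ennreal \<dots> = ennreal (gp * sqrt pi ^ CARD('p) * pochhammer (1/2) k) * ennreal (exp (- (norm t)\<^sup>2) * (t \<bullet> ((transpose R ** R) *v t)) ^ k / norm t ^ (CARD('q) + 1))"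
      using gp by (intro ennreal_mult') (simp add: pochhammer_nonneg)
    finally show ?thesis .
  qed
  have meas: "(\<lambda>z. ennreal (F (fst z) (snd z))) \<in> borel_measurable (lborel \<Otimes>\<^sub>M lborel)"
    unfolding F_def by measurable
  have "(\<integral>\<^sup>+z. ennreal (F (fst z) (snd z)) \<partial>lborel) = (\<integral>\<^sup>+t. (\<integral>\<^sup>+s. ennreal (F s t) \<partial>lborel) \<partial>lborel)"
    using lborel_pair.nn_integral_snd[OF meas] by (simp add: lborel_prod)
  also have "\<dots> = ennreal (gp * sqrt pi ^ CARD('p) * pochhammer (1/2) k)
      * (\<integral>\<^sup>+t. ennreal (exp (- (norm t)\<^sup>2) * (t \<bullet> ((transpose R ** R) *v t)) ^ k / norm t ^ (CARD('q) + 1)) \<partial>lborel)"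
    unfolding inner quad by (intro nn_integral_cmult) measurable
  also have "(\<integral>\<^sup>+t. ennreal (exp (- (norm t)\<^sup>2) * (t \<bullet> ((transpose R ** R) *v t)) ^ k / norm t ^ (CARD('q) + 1)) \<partial>lborel)
      = ennreal gq * ennreal (sqrt pi ^ CARD('q) * fact k * row_form k y)"
    unfolding gq_def nn_integral_gaussian_quadratic(1)[OF y, symmetric, unfolded quad, OF zero_le_power2] quad
    by (rule nn_integral_radial[OF _ _ _ k])
       (auto simp: matrix_vector_mult_scaleR power_mult_distrib power_mult power2_eq_square)
  also have "ennreal (gp * sqrt pi ^ CARD('p) * pochhammer (1/2) k) * (ennreal gq * ennreal (sqrt pi ^ CARD('q) * fact k * row_form k y))
      = ennreal (gp * sqrt pi ^ CARD('p) * pochhammer (1/2) k * (gq * (sqrt pi ^ CARD('q) * fact k * row_form k y)))"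
    using gp gq by (simp add: ennreal_mult' pochhammer_nonneg)
  finally show ?thesis
    unfolding F_def gp_def gq_def by (simp add: mult_ac)
qed

section \<open>Normal random vectors\<close>

lemma normal_law_eq_distr:
  assumes "v \<ge> 0"
  shows "normal_law m v = distr std_normal_distribution borel (\<lambda>x. m + sqrt v * x)"
proof (cases "v = 0")
  case True
  interpret prob_space std_normal_distribution by (rule prob_space_normal_density) simp
  have "distr std_normal_distribution borel (\<lambda>x. m) = return borel m"
    by (rule distr_const) simp
  then show ?thesis using True by (simp add: normal_law_def)
next
  case False
  interpret prob_space std_normal_distribution by (rule prob_space_normal_density) simp
  have "distributed std_normal_distribution lborel (\<lambda>x. x) (\<lambda>x. ennreal (std_normal_density x))"
    unfolding distributed_def by (auto simp: distr_id2)
  from normal_density_affine[OF this, of "sqrt v" m] False assms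
  have "distributed std_normal_distribution lborel (\<lambda>x. m + sqrt v * x) (\<lambda>x. ennreal (normal_density m (sqrt v) x))"
    by simp
  then have "distr std_normal_distribution lborel (\<lambda>x. m + sqrt v * x) = density lborel (\<lambda>x. ennreal (normal_density m (sqrt v) x))"
    by (simp add: distributed_def)
  moreover have "distr std_normal_distribution lborel (\<lambda>x. m + sqrt v * x) = distr std_normal_distribution borel (\<lambda>x. m + sqrt v * x)"
    by (rule distr_cong) auto
  ultimately show ?thesis using False by (simp add: normal_law_def)
qed

lemma std_normal_moments:
  "integrable std_normal_distribution (\<lambda>x. x)" "(LINT x|std_normal_distribution. x) = 0"
  "integrable std_normal_distribution (\<lambda>x. x\<^sup>2)" "(LINT x|std_normal_distribution. x\<^sup>2) = 1"
  using integrable_std_normal_distribution_moment[of 1] integral_std_normal_distribution_moment_odd[of 1]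
    std_normal_distribution_even_moments[of 1]
  by (simp_all add: fact_numeral)

context
  fixes M :: "'a measure" and Z :: "'a \<Rightarrow> real^'n" and \<mu> :: "real^'n" and \<Sigma> :: "real^'n^'n"
  assumes M: "prob_space M" and Z: "multivariate_normal M Z \<mu> \<Sigma>"
begin

lemma mvn_measurable: "(\<lambda>\<omega>. a \<bullet> Z \<omega>) \<in> borel_measurable M"
  using Z by (auto simp: multivariate_normal_def)

lemma mvn_distr: "distr M borel (\<lambda>\<omega>. a \<bullet> Z \<omega>)
    = distr std_normal_distribution borel (\<lambda>x. a \<bullet> \<mu> + sqrt (a \<bullet> (\<Sigma> *v a)) * x)"
  using Z normal_law_eq_distr[of "a \<bullet> (\<Sigma> *v a)" "a \<bullet> \<mu>"] by (simp add: multivariate_normal_def)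

lemma mvn_integral:
  fixes f :: "real \<Rightarrow> 'b::{banach, second_countable_topology}"
  assumes f: "f \<in> borel_measurable borel"
  shows "(LINT \<omega>|M. f (a \<bullet> Z \<omega>)) = (LINT x|std_normal_distribution. f (a \<bullet> \<mu> + sqrt (a \<bullet> (\<Sigma> *v a)) * x))"
    and "integrable M (\<lambda>\<omega>. f (a \<bullet> Z \<omega>)) \<longleftrightarrow> integrable std_normal_distribution (\<lambda>x. f (a \<bullet> \<mu> + sqrt (a \<bullet> (\<Sigma> *v a)) * x))"
proof -
  have g: "(\<lambda>x. a \<bullet> \<mu> + sqrt (a \<bullet> (\<Sigma> *v a)) * x) \<in> borel_measurable std_normal_distribution" by simp
  show "(LINT \<omega>|M. f (a \<bullet> Z \<omega>)) = (LINT x|std_normal_distribution. f (a \<bullet> \<mu> + sqrt (a \<bullet> (\<Sigma> *v a)) * x))"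
    using integral_distr[OF mvn_measurable f, of a] integral_distr[OF g f] by (simp add: mvn_distr)
  show "integrable M (\<lambda>\<omega>. f (a \<bullet> Z \<omega>)) \<longleftrightarrow> integrable std_normal_distribution (\<lambda>x. f (a \<bullet> \<mu> + sqrt (a \<bullet> (\<Sigma> *v a)) * x))"
    using integrable_distr_eq[OF mvn_measurable f, of a] integrable_distr_eq[OF g f] by (simp add: mvn_distr)
qed

lemma mvn_mean: "(LINT \<omega>|M. a \<bullet> Z \<omega>) = a \<bullet> \<mu>"
proof -
  interpret N: prob_space std_normal_distribution by (rule prob_space_normal_density) simp
  have "(LINT \<omega>|M. a \<bullet> Z \<omega>) = (LINT x|std_normal_distribution. a \<bullet> \<mu> + sqrt (a \<bullet> (\<Sigma> *v a)) * x)"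
    using mvn_integral(1)[of "\<lambda>x. x" a] by simp
  also have "\<dots> = a \<bullet> \<mu>"
    using std_normal_moments N.prob_space by simp
  finally show ?thesis .
qed

lemma mvn_variance:
  "integrable M (\<lambda>\<omega>. (a \<bullet> Z \<omega> - a \<bullet> \<mu>)\<^sup>2)" "(LINT \<omega>|M. (a \<bullet> Z \<omega> - a \<bullet> \<mu>)\<^sup>2) = a \<bullet> (\<Sigma> *v a)"
proof -
  have nn: "a \<bullet> (\<Sigma> *v a) \<ge> 0" using Z by (simp add: multivariate_normal_def)
  have eq: "(sqrt (a \<bullet> (\<Sigma> *v a)) * x)\<^sup>2 = a \<bullet> (\<Sigma> *v a) * x\<^sup>2" for x
    using nn by (simp add: power_mult_distrib)
  show "integrable M (\<lambda>\<omega>. (a \<bullet> Z \<omega> - a \<bullet> \<mu>)\<^sup>2)"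
    using mvn_integral(2)[of "\<lambda>x. (x - a \<bullet> \<mu>)\<^sup>2" a] std_normal_moments(3) by (simp add: eq)
  show "(LINT \<omega>|M. (a \<bullet> Z \<omega> - a \<bullet> \<mu>)\<^sup>2) = a \<bullet> (\<Sigma> *v a)"
    using mvn_integral(1)[of "\<lambda>x. (x - a \<bullet> \<mu>)\<^sup>2" a] std_normal_moments(4) by (simp add: eq)
qed

lemma mvn_char:
  "(LINT \<omega>|M. exp (\<i> * complex_of_real (a \<bullet> Z \<omega>)))
    = exp (\<i> * complex_of_real (a \<bullet> \<mu>)) * complex_of_real (exp (- (a \<bullet> (\<Sigma> *v a)) / 2))"
proof -
  have nn: "a \<bullet> (\<Sigma> *v a) \<ge> 0" using Z by (simp add: multivariate_normal_def)
  let ?s = "sqrt (a \<bullet> (\<Sigma> *v a))"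
  have "(LINT \<omega>|M. exp (\<i> * complex_of_real (a \<bullet> Z \<omega>)))
      = (LINT x|std_normal_distribution. exp (\<i> * complex_of_real (a \<bullet> \<mu> + ?s * x)))"
    by (rule mvn_integral(1)) simp
  also have "\<dots> = (LINT x|std_normal_distribution. exp (\<i> * complex_of_real (a \<bullet> \<mu>)) * exp (\<i> * complex_of_real (?s * x)))"
    by (simp add: exp_add[symmetric] algebra_simps)
  also have "\<dots> = exp (\<i> * complex_of_real (a \<bullet> \<mu>)) * char std_normal_distribution ?s"
    by (simp add: char_def)
  also have "\<dots> = exp (\<i> * complex_of_real (a \<bullet> \<mu>)) * complex_of_real (exp (- (a \<bullet> (\<Sigma> *v a)) / 2))"
    using nn by (simp add: char_std_normal_distribution)
  finally show ?thesis .
qed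

text \<open>The entries off the diagonal come from the variances of sums of two coordinates.\<close>

lemma mvn_covariance: "covariance_matrix M Z = \<Sigma>"
proof -
  have sym: "transpose \<Sigma> = \<Sigma>" using Z by (simp add: multivariate_normal_def)
  have mean: "(LINT \<omega>|M. Z \<omega> $ i) = \<mu> $ i" for i
    using mvn_mean[of "axis i 1"] by (simp add: inner_axis')
  have entry: "axis i 1 \<bullet> (\<Sigma> *v axis j 1) = \<Sigma> $ i $ j" for i j
    by (simp add: inner_axis' matrix_vector_mult_basis column_def)
  have "covariance_matrix M Z $ i $ j = \<Sigma> $ i $ j" for i j
  proof -
    define U where "U = (\<lambda>i \<omega>. Z \<omega> $ i - \<mu> $ i)"
    have sq: "integrable M (\<lambda>\<omega>. (U i \<omega>)\<^sup>2)" "(LINT \<omega>|M. (U i \<omega>)\<^sup>2) = \<Sigma> $ i $ i" for i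
      using mvn_variance[of "axis i 1"] by (simp_all add: U_def inner_axis' matrix_vector_mult_basis column_def)
    have sum: "integrable M (\<lambda>\<omega>. (U i \<omega> + U j \<omega>)\<^sup>2)"
      "(LINT \<omega>|M. (U i \<omega> + U j \<omega>)\<^sup>2) = \<Sigma> $ i $ i + \<Sigma> $ i $ j + \<Sigma> $ j $ i + \<Sigma> $ j $ j"
    proof -
      have "(axis i 1 + axis j 1) \<bullet> Z \<omega> - (axis i 1 + axis j 1) \<bullet> \<mu> = U i \<omega> + U j \<omega>" for \<omega>
        by (simp add: inner_add_left inner_axis' U_def)
      moreover have "(axis i 1 + axis j 1) \<bullet> (\<Sigma> *v (axis i 1 + axis j 1)) = \<Sigma> $ i $ i + \<Sigma> $ i $ j + \<Sigma> $ j $ i + \<Sigma> $ j $ j"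
        by (simp add: matrix_vector_right_distrib inner_add_left inner_add_right entry)
      ultimately show "integrable M (\<lambda>\<omega>. (U i \<omega> + U j \<omega>)\<^sup>2)"
        "(LINT \<omega>|M. (U i \<omega> + U j \<omega>)\<^sup>2) = \<Sigma> $ i $ i + \<Sigma> $ i $ j + \<Sigma> $ j $ i + \<Sigma> $ j $ j"
        using mvn_variance[of "axis i 1 + axis j 1"] by simp_all
    qed
    have "(LINT \<omega>|M. U i \<omega> * U j \<omega>) = (LINT \<omega>|M. ((U i \<omega> + U j \<omega>)\<^sup>2 - (U i \<omega>)\<^sup>2 - (U j \<omega>)\<^sup>2) / 2)"
      by (intro Bochner_Integration.integral_cong) (auto simp: power2_eq_square algebra_simps)
    also have "\<dots> = (\<Sigma> $ i $ j + \<Sigma> $ j $ i) / 2"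
      using sq[of i] sq[of j] sum by simp
    also have "\<Sigma> $ j $ i = \<Sigma> $ i $ j"
      using sym by (metis transpose_def vec_lambda_beta Finite_Cartesian_Product.transpose_def)
    finally show ?thesis by (simp add: covariance_matrix_def mean U_def)
  qed
  then show ?thesis by (simp add: vec_eq_iff)
qed

end

lemma sum_UNIV_Plus:
  fixes f :: "'p::finite + 'q::finite \<Rightarrow> 'b::comm_monoid_add"
  shows "(\<Sum>k\<in>UNIV. f k) = (\<Sum>i\<in>UNIV. f (Inl i)) + (\<Sum>j\<in>UNIV. f (Inr j))"
  using sum.Plus[of "UNIV :: 'p set" "UNIV :: 'q set" f] by (simp add: UNIV_Plus_UNIV)

lemma inner_join_vec: "join_vec a b \<bullet> join_vec x y = a \<bullet> x + b \<bullet> y"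
  by (simp add: inner_vec_def sum_UNIV_Plus join_vec_def)

lemma block_matrix_join_vec: "block_matrix A B C D *v join_vec x y = join_vec (A *v x + B *v y) (C *v x + D *v y)"
  by (simp add: vec_eq_iff matrix_vector_mult_def sum_UNIV_Plus join_vec_def block_matrix_def split: sum.split)

lemma mvn_linear_image:
  fixes f :: "real^'m \<Rightarrow> real^'n" and g :: "real^'n \<Rightarrow> real^'m"
  assumes Z: "multivariate_normal M Z \<mu> \<Sigma>"
    and adj: "\<And>a z. a \<bullet> f z = g a \<bullet> z" and f: "continuous_on UNIV f"
    and S: "transpose S = S" "\<And>a. a \<bullet> (S *v a) = g a \<bullet> (\<Sigma> *v g a)"
  shows "multivariate_normal M (\<lambda>\<omega>. f (Z \<omega>)) (f \<mu>) S"
  unfolding multivariate_normal_def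
proof (intro conjI allI)
  show "(\<lambda>\<omega>. f (Z \<omega>)) \<in> borel_measurable M"
    using Z borel_measurable_continuous_onI[OF f] by (auto simp: multivariate_normal_def intro: measurable_compose)
  show "transpose S = S" by (rule S)
  show "0 \<le> a \<bullet> (S *v a)" for a using Z by (simp add: S(2) multivariate_normal_def)
  show "distr M borel (\<lambda>\<omega>. a \<bullet> f (Z \<omega>)) = normal_law (a \<bullet> f \<mu>) (a \<bullet> (S *v a))" for a
    using Z by (simp add: adj S(2) multivariate_normal_def)
qed

text \<open>A zero of a nonnegative quadratic form minimizes it, so it lies in the kernel of the matrix.\<close>

lemma positive_definite_psd_invertible:
  fixes S :: "real^'n^'n"
  assumes sym: "transpose S = S" and psd: "\<And>x. 0 \<le> x \<bullet> (S *v x)" and "invertible S"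
  shows "positive_definite S"
  unfolding positive_definite_def
proof (intro conjI allI impI sym)
  fix x :: "real^'n" assume x: "x \<noteq> 0"
  have "x \<bullet> (S *v x) \<noteq> 0"
  proof
    assume 0: "x \<bullet> (S *v x) = 0"
    define y where "y = S *v x"
    have "2 * t * (- (y \<bullet> y)) + t\<^sup>2 * (- (y \<bullet> (S *v y))) \<le> 0" for t
    proof -
      have "(x + t *\<^sub>R y) \<bullet> (S *v (x + t *\<^sub>R y)) = 2 * t * (y \<bullet> y) + t\<^sup>2 * (y \<bullet> (S *v y))"
        using 0 symmetric_dot[OF sym, of x y]
        by (simp add: matrix_vector_right_distrib matrix_vector_mult_scaleR inner_add_left inner_add_right
            y_def[symmetric] power2_eq_square algebra_simps)
      then show ?thesis using psd[of "x + t *\<^sub>R y"] by simp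
    qed
    from linear_coeff_zero_of_quadratic[OF this] have "S *v x = 0" by (simp add: y_def)
    moreover obtain B where "B ** S = mat 1" using \<open>invertible S\<close> by (auto simp: invertible_def)
    ultimately have "x = 0"
      by (metis matrix_vector_mul_assoc matrix_vector_mul_lid matrix_vector_mult_0_right)
    with x show False by contradiction
  qed
  then show "0 < x \<bullet> (S *v x)" using psd[of x] by simp
qed

lemma mvn_blocks:
  fixes X :: "'a \<Rightarrow> real^'p" and Y :: "'a \<Rightarrow> real^'q"
  assumes Z: "multivariate_normal M (\<lambda>\<omega>. join_vec (X \<omega>) (Y \<omega>)) \<mu> (block_matrix A B (transpose B) D)"
  shows "multivariate_normal M X (\<chi> i. \<mu> $ Inl i) A" "multivariate_normal M Y (\<chi> j. \<mu> $ Inr j) D"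
proof -
  have sym: "transpose (block_matrix A B (transpose B) D) = block_matrix A B (transpose B) D"
    using Z by (simp add: multivariate_normal_def)
  have A: "transpose A = A"
  proof -
    have "A $ i $ j = A $ j $ i" for i j
      using arg_cong[OF sym, of "\<lambda>T. T $ Inl i $ Inl j"] by (simp add: Finite_Cartesian_Product.transpose_def block_matrix_def)
    then show ?thesis by (simp add: Finite_Cartesian_Product.transpose_def vec_eq_iff)
  qed
  have D: "transpose D = D"
  proof -
    have "D $ i $ j = D $ j $ i" for i j
      using arg_cong[OF sym, of "\<lambda>T. T $ Inr i $ Inr j"] by (simp add: Finite_Cartesian_Product.transpose_def block_matrix_def)
    then show ?thesis by (simp add: Finite_Cartesian_Product.transpose_def vec_eq_iff)
  qed
  have split: "z = join_vec (\<chi> i. z $ Inl i) (\<chi> j. z $ Inr j)" for z :: "real^('p + 'q)"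
    by (auto simp: join_vec_def vec_eq_iff split: sum.split)
  have "multivariate_normal M (\<lambda>\<omega>. (\<lambda>z. \<chi> i. z $ Inl i) (join_vec (X \<omega>) (Y \<omega>))) ((\<lambda>z. \<chi> i. z $ Inl i) \<mu>) A"
  proof (rule mvn_linear_image[OF Z, where g = "\<lambda>a. join_vec a 0"])
    show "a \<bullet> (\<chi> i. z $ Inl i) = join_vec a 0 \<bullet> z" for a :: "real^'p" and z :: "real^('p + 'q)"
      by (subst (2) split) (simp add: inner_join_vec)
    show "continuous_on UNIV (\<lambda>z::real^('p + 'q). \<chi> i. z $ Inl i)"
      by (intro continuous_intros)
  qed (simp_all add: A block_matrix_join_vec inner_join_vec)
  then show "multivariate_normal M X (\<chi> i. \<mu> $ Inl i) A" by (simp add: join_vec_def)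
  have "multivariate_normal M (\<lambda>\<omega>. (\<lambda>z. \<chi> j. z $ Inr j) (join_vec (X \<omega>) (Y \<omega>))) ((\<lambda>z. \<chi> j. z $ Inr j) \<mu>) D"
  proof (rule mvn_linear_image[OF Z, where g = "\<lambda>b. join_vec 0 b"])
    show "b \<bullet> (\<chi> j. z $ Inr j) = join_vec 0 b \<bullet> z" for b :: "real^'q" and z :: "real^('p + 'q)"
      by (subst (2) split) (simp add: inner_join_vec)
    show "continuous_on UNIV (\<lambda>z::real^('p + 'q). \<chi> j. z $ Inr j)"
      by (intro continuous_intros)
  qed (simp_all add: D block_matrix_join_vec inner_join_vec)
  then show "multivariate_normal M Y (\<chi> j. \<mu> $ Inr j) D" by (simp add: join_vec_def)
qed

lemma block_quadratic:
  "join_vec a b \<bullet> (block_matrix A B (transpose B) D *v join_vec a b) = a \<bullet> (A *v a) + 2 * (a \<bullet> (B *v b)) + b \<bullet> (D *v b)"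
  using dot_matrix_vector[of a B b]
  by (simp add: block_matrix_join_vec inner_join_vec inner_add_right inner_commute[of b])

context
  fixes M :: "'a measure" and X :: "'a \<Rightarrow> real^'p" and Y :: "'a \<Rightarrow> real^'q"
    and \<mu> :: "real^('p + 'q)" and A :: "real^'p^'p" and B :: "real^'q^'p" and D :: "real^'q^'q"
  assumes M: "prob_space M"
    and Z: "multivariate_normal M (\<lambda>\<omega>. join_vec (X \<omega>) (Y \<omega>)) \<mu> (block_matrix A B (transpose B) D)"
    and inv: "invertible A" "invertible D"
begin

text \<open>The cross-covariance of the standardized vectors.\<close>

definition standard_cross :: "real^'q^'p" where
  "standard_cross = inv_sqrt_matrix A ** B ** inv_sqrt_matrix D"

lemma blocks_positive_definite: "positive_definite A" "positive_definite D"
  using mvn_blocks[OF Z] inv by (auto simp: multivariate_normal_def intro: positive_definite_psd_invertible)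

lemma inv_sqrt_quadratic:
  fixes S :: "real^'n^'n"
  assumes "positive_definite S"
  shows "(inv_sqrt_matrix S *v s) \<bullet> (S *v (inv_sqrt_matrix S *v s)) = (norm s)\<^sup>2"
proof -
  have sym: "transpose (inv_sqrt_matrix S) = inv_sqrt_matrix S"
    using inv_sqrt_matrix(1)[OF assms] by (simp add: positive_definite_def)
  have "(inv_sqrt_matrix S *v s) \<bullet> (S *v (inv_sqrt_matrix S *v s)) = s \<bullet> ((inv_sqrt_matrix S ** S ** inv_sqrt_matrix S) *v s)"
    using symmetric_dot[OF sym, of s "S *v (inv_sqrt_matrix S *v s)"] by (simp add: matrix_vector_mul_assoc matrix_mul_assoc)
  then show ?thesis
    unfolding inv_sqrt_matrix(3)[OF assms] by (simp add: power2_norm_eq_inner)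
qed

lemma inv_sqrt_symmetric:
  "transpose (inv_sqrt_matrix A) = inv_sqrt_matrix A" "transpose (inv_sqrt_matrix D) = inv_sqrt_matrix D"
  using inv_sqrt_matrix(1)[OF blocks_positive_definite(1)] inv_sqrt_matrix(1)[OF blocks_positive_definite(2)]
  by (auto simp: positive_definite_def)

lemma standardized_quadratic:
  "join_vec (inv_sqrt_matrix A *v s) (inv_sqrt_matrix D *v t) \<bullet>
     (block_matrix A B (transpose B) D *v join_vec (inv_sqrt_matrix A *v s) (inv_sqrt_matrix D *v t))
   = (norm s)\<^sup>2 + 2 * (s \<bullet> (standard_cross *v t)) + (norm t)\<^sup>2"
proof -
  have "(inv_sqrt_matrix A *v s) \<bullet> (B *v (inv_sqrt_matrix D *v t)) = s \<bullet> (standard_cross *v t)"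
    using symmetric_dot[OF inv_sqrt_symmetric(1), of s "B *v (inv_sqrt_matrix D *v t)"]
    by (simp add: standard_cross_def matrix_vector_mul_assoc matrix_mul_assoc)
  then show ?thesis
    unfolding block_quadratic inv_sqrt_quadratic[OF blocks_positive_definite(1)]
      inv_sqrt_quadratic[OF blocks_positive_definite(2)] by simp
qed

text \<open>The joint covariance of the standardized vectors is nonnegative at the pair of \<open>- standard_cross *v t\<close> and \<open>t\<close>.\<close>

lemma standard_cross_contraction: "norm (standard_cross *v t) \<le> norm t"
proof -
  let ?s = "- (standard_cross *v t)"
  have "0 \<le> (norm ?s)\<^sup>2 + 2 * (?s \<bullet> (standard_cross *v t)) + (norm t)\<^sup>2"
    unfolding standardized_quadratic[symmetric] using Z by (simp add: multivariate_normal_def)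
  then have "(norm (standard_cross *v t))\<^sup>2 \<le> (norm t)\<^sup>2"
    by (simp add: power2_norm_eq_inner)
  then show ?thesis by (simp add: power2_le_iff_abs_le)
qed

lemma standard_cross_gram:
  "transpose standard_cross ** standard_cross
    = inv_sqrt_matrix D ** transpose B ** matrix_inv A ** B ** inv_sqrt_matrix D"
proof -
  have "transpose standard_cross ** standard_cross
      = inv_sqrt_matrix D ** transpose B ** (inv_sqrt_matrix A ** inv_sqrt_matrix A) ** B ** inv_sqrt_matrix D"
    by (simp add: standard_cross_def matrix_transpose_mul inv_sqrt_symmetric matrix_mul_assoc)
  then show ?thesis unfolding inv_sqrt_matrix(2)[OF blocks_positive_definite(1)] .
qed

text \<open>The means enter only through a factor of modulus one.\<close>

lemma joint_char_standardized:
  "\<exists>\<theta>. joint_char M (\<lambda>\<omega>. inv_sqrt_matrix A *v X \<omega>) (\<lambda>\<omega>. inv_sqrt_matrix D *v Y \<omega>) s t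
      - joint_char M (\<lambda>\<omega>. inv_sqrt_matrix A *v X \<omega>) (\<lambda>\<omega>. inv_sqrt_matrix D *v Y \<omega>) s 0
        * joint_char M (\<lambda>\<omega>. inv_sqrt_matrix A *v X \<omega>) (\<lambda>\<omega>. inv_sqrt_matrix D *v Y \<omega>) 0 t
    = exp (\<i> * complex_of_real \<theta>) * complex_of_real (exp (- ((norm s)\<^sup>2 + (norm t)\<^sup>2) / 2) * (exp (- (s \<bullet> (standard_cross *v t))) - 1))"
proof -
  define m where "m = (\<lambda>s t. join_vec (inv_sqrt_matrix A *v s) (inv_sqrt_matrix D *v t) \<bullet> \<mu>)"
  have char: "joint_char M (\<lambda>\<omega>. inv_sqrt_matrix A *v X \<omega>) (\<lambda>\<omega>. inv_sqrt_matrix D *v Y \<omega>) s t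
      = exp (\<i> * complex_of_real (m s t)) * complex_of_real (exp (- ((norm s)\<^sup>2 + 2 * (s \<bullet> (standard_cross *v t)) + (norm t)\<^sup>2) / 2))" for s t
  proof -
    have lin: "s \<bullet> (inv_sqrt_matrix A *v X \<omega>) + t \<bullet> (inv_sqrt_matrix D *v Y \<omega>)
        = join_vec (inv_sqrt_matrix A *v s) (inv_sqrt_matrix D *v t) \<bullet> join_vec (X \<omega>) (Y \<omega>)" for \<omega>
      unfolding inner_join_vec using symmetric_dot[OF inv_sqrt_symmetric(1)] symmetric_dot[OF inv_sqrt_symmetric(2)] by simp
    have "joint_char M (\<lambda>\<omega>. inv_sqrt_matrix A *v X \<omega>) (\<lambda>\<omega>. inv_sqrt_matrix D *v Y \<omega>) s t
        = (LINT \<omega>|M. exp (\<i> * complex_of_real (s \<bullet> (inv_sqrt_matrix A *v X \<omega>) + t \<bullet> (inv_sqrt_matrix D *v Y \<omega>))))"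
      by (simp add: joint_char_def distrib_left)
    then show ?thesis
      unfolding lin mvn_char[OF M Z] standardized_quadratic m_def .
  qed
  have m: "m s t = m s 0 + m 0 t"
    using inner_add_left[of "join_vec (inv_sqrt_matrix A *v s) 0" "join_vec 0 (inv_sqrt_matrix D *v t)" \<mu>]
  proof -
    have "join_vec (inv_sqrt_matrix A *v s) (inv_sqrt_matrix D *v t)
        = join_vec (inv_sqrt_matrix A *v s) 0 + join_vec 0 (inv_sqrt_matrix D *v t)"
      by (auto simp: join_vec_def vec_eq_iff split: sum.split)
    then show ?thesis by (simp add: m_def inner_add_left)
  qed
  have e1: "exp (\<i> * complex_of_real (m s 0)) * exp (\<i> * complex_of_real (m 0 t)) = exp (\<i> * complex_of_real (m s t))"
    by (simp add: m exp_add[symmetric] algebra_simps)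
  have e2: "exp (- ((norm s)\<^sup>2 + 2 * (s \<bullet> (standard_cross *v t)) + (norm t)\<^sup>2) / 2)
      = exp (- ((norm s)\<^sup>2 + (norm t)\<^sup>2) / 2) * exp (- (s \<bullet> (standard_cross *v t)))"
    by (simp add: exp_add[symmetric] field_simps)
  have e3: "exp (- (norm s)\<^sup>2 / 2) * exp (- (norm t)\<^sup>2 / 2) = exp (- ((norm s)\<^sup>2 + (norm t)\<^sup>2) / 2)"
    by (simp add: exp_add[symmetric] field_simps)
  show ?thesis
  proof (rule exI[of _ "m s t"])
    have prod: "exp (\<i> * complex_of_real (m s 0)) * complex_of_real (exp (- (norm s)\<^sup>2 / 2))
        * (exp (\<i> * complex_of_real (m 0 t)) * complex_of_real (exp (- (norm t)\<^sup>2 / 2)))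
        = exp (\<i> * complex_of_real (m s t)) * complex_of_real (exp (- ((norm s)\<^sup>2 + (norm t)\<^sup>2) / 2))"
      unfolding e1[symmetric] e3[symmetric] of_real_mult by (simp only: mult_ac)
    show "joint_char M (\<lambda>\<omega>. inv_sqrt_matrix A *v X \<omega>) (\<lambda>\<omega>. inv_sqrt_matrix D *v Y \<omega>) s t
      - joint_char M (\<lambda>\<omega>. inv_sqrt_matrix A *v X \<omega>) (\<lambda>\<omega>. inv_sqrt_matrix D *v Y \<omega>) s 0
        * joint_char M (\<lambda>\<omega>. inv_sqrt_matrix A *v X \<omega>) (\<lambda>\<omega>. inv_sqrt_matrix D *v Y \<omega>) 0 t
      = exp (\<i> * complex_of_real (m s t)) * complex_of_real (exp (- ((norm s)\<^sup>2 + (norm t)\<^sup>2) / 2) * (exp (- (s \<bullet> (standard_cross *v t))) - 1))"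
      unfolding char e2 using prod by (simp add: algebra_simps)
  qed
qed

end

section \<open>The hypergeometric series\<close>

text \<open>The coefficient of \<open>x^k\<close> in \<open>(1 - x)^(-q/2)\<close>.  The recursion in \<open>k\<close> comes from weighting each exponent vector by its
  degree and removing one unit from each index in turn.\<close>

lemma row_form_ones: "row_form k (\<chi> i. 1 :: real^'q) = pochhammer (real CARD('q) / 2) k / fact k"
proof (induction k)
  case 0
  show ?case by (simp add: row_form_def form_def monom_at_def row_coeff_def exponents_0)
next
  case (Suc k)
  define w where "w = (\<lambda>a :: 'q \<Rightarrow> nat. \<Prod>i\<in>UNIV. row_coeff (a i))"
  have S: "row_form k (\<chi> i. 1 :: real^'q) = (\<Sum>a\<in>exponents k. w a)" for k
    by (simp add: row_form_def form_def monom_at_def w_def)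
  have up: "(\<Sum>a\<in>exponents (Suc k). real (a i) * w a) = (\<Sum>b\<in>exponents k. (real (b i) + 1/2) * w b)" for i
  proof -
    have deg: "(\<Sum>j\<in>UNIV. a j) = a i + (\<Sum>j\<in>UNIV - {i}. a j)" for a :: "'q \<Rightarrow> nat"
      by (rule sum.remove) auto
    have upd: "(\<Sum>j\<in>UNIV - {i}. (a(i := n)) j) = (\<Sum>j\<in>UNIV - {i}. a j)" for a :: "'q \<Rightarrow> nat" and n
      by (intro sum.cong) auto
    have w: "w a = row_coeff (a i) * (\<Prod>j\<in>UNIV - {i}. row_coeff (a j))" for a
      unfolding w_def by (rule prod.remove) auto
    have w_upd: "real (Suc (b i)) * w (b(i := Suc (b i))) = (real (b i) + 1/2) * w b" for b
    proof -
      have "(\<Prod>j\<in>UNIV - {i}. row_coeff ((b(i := Suc (b i))) j)) = (\<Prod>j\<in>UNIV - {i}. row_coeff (b j))"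
        by (intro prod.cong) auto
      then show ?thesis
        unfolding w[of "b(i := Suc (b i))"] w[of b] using row_coeff_Suc[of "b i"] by (simp del: of_nat_Suc)
    qed
    have "(\<Sum>a\<in>exponents (Suc k). real (a i) * w a) = (\<Sum>a\<in>{a \<in> exponents (Suc k). 0 < a i}. real (a i) * w a)"
      by (rule sum.mono_neutral_right) auto
    also have "\<dots> = (\<Sum>b\<in>exponents k. (real (b i) + 1/2) * w b)"
    proof (rule sum.reindex_bij_witness[where i = "\<lambda>b. b(i := Suc (b i))" and j = "\<lambda>a. a(i := a i - 1)"])
      fix a :: "'q \<Rightarrow> nat" assume a: "a \<in> {a \<in> exponents (Suc k). 0 < a i}"
      show "(a(i := a i - 1))(i := Suc ((a(i := a i - 1)) i)) = a" using a by (auto simp: fun_eq_iff)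
      show "a(i := a i - 1) \<in> exponents k"
        using a deg[of a] deg[of "a(i := a i - 1)"] unfolding upd by (simp add: exponents_def)
      show "(real ((a(i := a i - 1)) i) + 1/2) * w (a(i := a i - 1)) = real (a i) * w a"
        using w_upd[of "a(i := a i - 1)"] a by simp
    next
      fix b :: "'q \<Rightarrow> nat" assume b: "b \<in> exponents k"
      show "(b(i := Suc (b i)))(i := (b(i := Suc (b i))) i - 1) = b" by simp
      show "b(i := Suc (b i)) \<in> {a \<in> exponents (Suc k). 0 < a i}"
        using b deg[of b] deg[of "b(i := Suc (b i))"] unfolding upd by (simp add: exponents_def)
    qed
    finally show ?thesis .
  qed
  have "real (Suc k) * (\<Sum>a\<in>exponents (Suc k). w a) = (\<Sum>a\<in>exponents (Suc k). (\<Sum>i\<in>UNIV. real (a i)) * w a)"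
    unfolding sum_distrib_left
    by (intro sum.cong refl) (simp add: exponents_def of_nat_sum[symmetric] del: of_nat_sum of_nat_Suc)
  also have "\<dots> = (\<Sum>i\<in>UNIV. \<Sum>a\<in>exponents (Suc k). real (a i) * w a)"
    unfolding sum_distrib_right by (rule sum.swap)
  also have "\<dots> = (\<Sum>b\<in>exponents k. (\<Sum>i\<in>UNIV. real (b i) + 1/2) * w b)"
    unfolding up sum_distrib_right by (rule sum.swap)
  also have "\<dots> = (\<Sum>b\<in>exponents k. (real CARD('q) / 2 + real k) * w b)"
  proof (intro sum.cong refl)
    fix b :: "'q \<Rightarrow> nat" assume b: "b \<in> exponents k"
    have "(\<Sum>i\<in>UNIV. real (b i)) = real k"
      using b by (simp add: exponents_def of_nat_sum[symmetric] del: of_nat_sum)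
    then show "(\<Sum>i\<in>UNIV. real (b i) + 1/2) * w b = (real CARD('q) / 2 + real k) * w b"
      by (simp add: sum.distrib)
  qed
  also have "\<dots> = (real CARD('q) / 2 + real k) * (pochhammer (real CARD('q) / 2) k / fact k)"
    unfolding sum_distrib_left[symmetric] S[symmetric] Suc ..
  finally show ?case
    unfolding S[symmetric] pochhammer_Suc fact_Suc by (simp add: field_simps del: of_nat_Suc)
qed

lemma row_form_nonneg: "(\<And>i. 0 \<le> y $ i) \<Longrightarrow> 0 \<le> row_form k y"
  unfolding row_form_def form_def monom_at_def
  by (intro sum_nonneg mult_nonneg_nonneg prod_nonneg) (auto simp: less_imp_le[OF row_coeff_pos])

lemma row_form_le:
  fixes y :: "real^'q"
  assumes "\<And>i. 0 \<le> y $ i" "\<And>i. y $ i \<le> 1"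
  shows "row_form k y \<le> pochhammer (real CARD('q) / 2) k / fact k"
  unfolding row_form_ones[symmetric] row_form_def form_def monom_at_def
  by (intro sum_mono mult_left_mono prod_mono prod_nonneg)
     (auto simp: assms power_le_one less_imp_le[OF row_coeff_pos])

lemma row_form_0: "row_form 0 y = 1"
  by (simp add: row_form_def form_def monom_at_def row_coeff_def exponents_0)

definition row_term :: "real \<Rightarrow> real^'q::finite \<Rightarrow> nat \<Rightarrow> real" where
  "row_term b y k = (pochhammer (-1/2) k)\<^sup>2 * row_form k y / (pochhammer b k * pochhammer (real CARD('q) / 2) k)"

lemma part_pochhammer_row: "part_pochhammer \<alpha> (row_partition q k) = pochhammer \<alpha> k"
  by (simp add: part_pochhammer_def row_partition_def prod.lessThan_Suc_shift del: prod.lessThan_Suc)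

text \<open>The second part of the partition is positive and contributes the rising factorial of \<open>1/2 - 1/2\<close>.\<close>

lemma part_pochhammer_half_eq_0:
  assumes "\<kappa> \<in> partitions_of q k" "\<kappa> \<noteq> row_partition q k" "q > 0"
  shows "part_pochhammer (1/2 :: real) \<kappa> = 0"
proof -
  have \<kappa>: "length \<kappa> = q" "sum_list \<kappa> = k" "sorted_wrt (\<ge>) \<kappa>"
    using assms(1) by (auto simp: partitions_of_def)
  have less: "sum_list (take 1 \<kappa>) < k"
    using row_partition_unique[OF assms(1) _ assms(3)] assms(2) by force
  obtain x xs where xs: "\<kappa> = x # xs" using \<kappa>(1) assms(3) by (cases \<kappa>) auto
  have "sum_list xs > 0" using less \<kappa>(2) by (simp add: xs)
  then obtain z zs where zs: "xs = z # zs" by (cases xs) auto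
  have "z > 0"
  proof (rule ccontr)
    assume "\<not> z > 0"
    then have "\<forall>n\<in>set xs. n = 0" using \<kappa>(3) by (auto simp: xs zs)
    then show False using \<open>sum_list xs > 0\<close> sum_list_eq_0_iff[of xs] by (metis less_numeral_extra(3))
  qed
  then have "pochhammer (1/2 - of_nat 1 / 2 :: real) (\<kappa> ! 1) = 0"
    by (simp add: xs zs pochhammer_0_left)
  moreover have "1 < length \<kappa>" by (simp add: xs zs)
  ultimately show ?thesis
    unfolding part_pochhammer_def by (intro prod_zero) (auto intro!: bexI[of _ 1])
qed

lemma hypergeometric_rows:
  fixes S :: "real^'q^'q"
  shows "hypergeometric_matrix [1/2, -1/2, -1/2] [b, real CARD('q) / 2] S
    = (\<Sum>k. row_term b (SOME y. eigenvalue_vec S y) k)"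
  unfolding hypergeometric_matrix_def
proof (rule arg_cong[of _ _ suminf], rule ext)
  fix k
  define T where "T = (\<lambda>\<kappa>. (\<Prod>\<alpha>\<leftarrow>[1/2, -1/2, -1/2]. part_pochhammer \<alpha> \<kappa>)
      / (\<Prod>\<beta>\<leftarrow>[b, real CARD('q) / 2]. part_pochhammer \<beta> \<kappa>) * of_real (zonal \<kappa> S))"
  have "(\<Sum>\<kappa>\<in>partitions_of CARD('q) k. T \<kappa>) = (\<Sum>\<kappa>\<in>{row_partition CARD('q) k}. T \<kappa>)"
  proof (rule sum.mono_neutral_right)
    show "\<forall>\<kappa>\<in>partitions_of CARD('q) k - {row_partition CARD('q) k}. T \<kappa> = 0"
      using part_pochhammer_half_eq_0 by (auto simp: T_def)
  qed (auto simp: finite_partitions_of row_partition)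
  also have "1 / fact k * \<dots> = row_term b (SOME y. eigenvalue_vec S y) k"
    using row_coeff_pos[of k] pochhammer_pos[of "1/2 :: real" k]
    by (simp add: T_def part_pochhammer_row zonal_def zonal_eig_row row_term_def row_coeff_def power2_eq_square)
  finally show "1 / fact k * (\<Sum>\<kappa>\<in>partitions_of CARD('q) k. T \<kappa>) = row_term b (SOME y. eigenvalue_vec S y) k" .
qed

lemma pochhammer_minus_half: "(2 * real k - 1) * pochhammer (-1/2) k = - pochhammer (1/2) k"
proof (induction k)
  case (Suc k)
  have "(2 * real (Suc k) - 1) * pochhammer (-1/2) (Suc k) = (real k + 1/2) * ((2 * real k - 1) * pochhammer (-1/2) k)"
    by (simp add: pochhammer_Suc field_simps)
  also have "\<dots> = - pochhammer (1/2) (Suc k)"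
    unfolding Suc by (simp add: pochhammer_Suc field_simps)
  finally show ?case .
qed simp

lemma pochhammer_mono: "0 \<le> a \<Longrightarrow> a \<le> b \<Longrightarrow> pochhammer a k \<le> pochhammer (b :: real) k"
  unfolding pochhammer_prod by (intro prod_mono) auto

text \<open>Quadratic decay, even with eigenvalue \<open>1\<close>, comes from \<open>(-1/2)\<^sub>k = - (1/2)\<^sub>k / (2k - 1)\<close>.\<close>

lemma row_term_bounds:
  fixes y :: "real^'q"
  assumes b: "1/2 \<le> b" and y: "\<And>i. 0 \<le> y $ i" "\<And>i. y $ i \<le> 1" and k: "k \<ge> 1"
  shows "0 \<le> row_term b y k" "row_term b y k \<le> inverse (real k ^ 2)"
proof -
  define h q where "h = pochhammer (1/2 :: real) k" and "q = pochhammer (real CARD('q) / 2) k"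
  have pos: "0 < h" "0 < pochhammer b k" "0 < q" "0 < real k" "0 < 2 * real k - 1"
    using b k by (auto simp: h_def q_def intro!: pochhammer_pos)
  show "0 \<le> row_term b y k"
    using pos row_form_nonneg[OF y(1)] by (simp add: row_term_def q_def)
  have P: "pochhammer (-1/2) k = - h / (2 * real k - 1)"
    using pochhammer_minus_half[of k] pos(5) by (simp add: field_simps h_def)
  have "row_term b y k = h\<^sup>2 / (2 * real k - 1)\<^sup>2 * row_form k y / (pochhammer b k * q)"
    unfolding row_term_def P q_def by (simp add: power_divide)
  also have "\<dots> \<le> h\<^sup>2 / (2 * real k - 1)\<^sup>2 * (q / fact k) / (pochhammer b k * q)"
    using pos row_form_le[OF y] by (intro divide_right_mono mult_left_mono) (auto simp: q_def)
  also have "\<dots> = h / pochhammer b k * (h / fact k) * inverse ((2 * real k - 1)\<^sup>2)"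
  proof -
    have "h\<^sup>2 / D * (q / f) / (B * q) = h / B * (h / f) * inverse D" for D f B
      using pos(3) by (simp add: power2_eq_square divide_inverse)
    then show ?thesis .
  qed
  also have "\<dots> \<le> 1 * 1 * inverse ((real k)\<^sup>2)"
  proof (intro mult_mono le_imp_inverse_le power_mono)
    show "h / pochhammer b k \<le> 1" using pos pochhammer_mono[of "1/2" b k] b by (simp add: h_def)
    show "h / fact k \<le> 1" using pochhammer_mono[of "1/2" 1 k] by (simp add: h_def pochhammer_fact[symmetric])
  qed (use pos k in auto)
  finally show "row_term b y k \<le> inverse (real k ^ 2)" by simp
qed

lemma row_term_summable:
  fixes y :: "real^'q"
  assumes "1/2 \<le> b" "\<And>i. 0 \<le> y $ i" "\<And>i. y $ i \<le> 1"
  shows "summable (row_term b y)"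
proof (rule summable_comparison_test'[of "\<lambda>k. inverse (real k ^ 2)" 1])
  show "summable (\<lambda>k. inverse (real k ^ 2))" by (rule inverse_power_summable) simp
  show "norm (row_term b y k) \<le> inverse (real k ^ 2)" if "1 \<le> k" for k
    using row_term_bounds[OF assms that] by simp
qed

text \<open>The two vectors of eigenvalues are unrelated choices, possibly listed in different orders; but the value of \<open>row_form\<close>
  is a Gaussian integral of the quadratic form of the matrix.\<close>

lemma row_form_scaled_matrix:
  fixes S :: "real^'q^'q"
  assumes y: "eigenvalue_vec S y" "eigenvalue_vec (c *\<^sub>R S) y'" and c: "0 \<le> c" and psd: "\<And>x. 0 \<le> x \<bullet> (S *v x)"
  shows "row_form k y' = c ^ k * row_form k y"
proof -
  have quad: "x \<bullet> ((c *\<^sub>R S) *v x) = c * (x \<bullet> (S *v x))" for x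
    by (simp add: scaleR_matrix_vector_assoc[symmetric])
  have psd': "0 \<le> x \<bullet> ((c *\<^sub>R S) *v x)" for x
    unfolding quad using c psd by simp
  have [measurable]: "(\<lambda>t. S *v t) \<in> borel_measurable borel"
    by (intro borel_measurable_continuous_onI linear_continuous_on) simp
  have nonneg: "0 \<le> row_form k y" "0 \<le> row_form k y'"
    using nn_integral_gaussian_quadratic(2)[OF y(1) psd] nn_integral_gaussian_quadratic(2)[OF y(2) psd']
    by (auto intro: row_form_nonneg)
  have "ennreal (sqrt pi ^ CARD('q) * fact k * row_form k y')
      = (\<integral>\<^sup>+t. ennreal (c ^ k) * ennreal (exp (- (norm t)\<^sup>2) * (t \<bullet> (S *v t)) ^ k) \<partial>lborel)"
    unfolding nn_integral_gaussian_quadratic(1)[OF y(2) psd', symmetric] quad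
    using c by (intro nn_integral_cong) (simp add: ennreal_mult'[symmetric] power_mult_distrib mult_ac)
  also have "\<dots> = ennreal (c ^ k) * ennreal (sqrt pi ^ CARD('q) * fact k * row_form k y)"
    unfolding nn_integral_gaussian_quadratic(1)[OF y(1) psd, symmetric] by (intro nn_integral_cmult) measurable
  also have "\<dots> = ennreal (sqrt pi ^ CARD('q) * fact k * (c ^ k * row_form k y))"
    using c by (simp add: ennreal_mult'[symmetric] mult_ac)
  finally have "sqrt pi ^ CARD('q) * fact k * row_form k y' = sqrt pi ^ CARD('q) * fact k * (c ^ k * row_form k y)"
    by (subst (asm) ennreal_inj) (use nonneg c in auto)
  then show ?thesis by simp
qed

section \<open>The distance covariance integral\<close>

text \<open>The Taylor coefficients at even powers of \<open>1 - 2 cosh u + cosh (2 u)\<close>, the even part of \<open>(exp (- u) - 1)\<^sup>2\<close>.\<close>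

definition even_coeff :: "nat \<Rightarrow> real" where
  "even_coeff k = (4 ^ k - 2) / fact (2 * k) + (if k = 0 then 1 else 0)"

lemma even_coeff_0: "even_coeff 0 = 0"
  by (simp add: even_coeff_def)

lemma even_coeff_nonneg: "0 \<le> even_coeff k"
proof (cases k)
  case (Suc n)
  have "(1::real) \<le> 4 ^ n" by simp
  then have "(0::real) \<le> 4 ^ k - 2" unfolding Suc power_Suc by linarith
  then show ?thesis unfolding even_coeff_def by (intro add_nonneg_nonneg divide_nonneg_nonneg) auto
qed (simp add: even_coeff_def)

lemma cosh_even_series: "(\<lambda>k. u ^ (2 * k) / fact (2 * k)) sums cosh (u :: real)"
proof -
  have "(\<lambda>k. (\<lambda>n. if even n then u ^ n /\<^sub>R fact n else 0) (2 * k)) sums cosh u"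
    by (subst sums_mono_reindex[of "\<lambda>k. 2 * k"]) (auto simp: strict_mono_def cosh_converges elim!: evenE)
  then show ?thesis by (simp add: divide_inverse mult.commute)
qed

lemma even_part_sums:
  "(\<lambda>k. 2 * even_coeff k * u ^ (2 * k)) sums ((exp (- u) - 1)\<^sup>2 + (exp u - 1)\<^sup>2)" for u :: real
proof -
  have one: "(\<lambda>k. if k = 0 then 1 else 0 :: real) sums 1"
    using sums_single[of 0 "\<lambda>_. 1 :: real"] by simp
  have four: "(4::real) ^ k = (2 ^ k)\<^sup>2" for k
    by (simp add: power2_eq_square power_mult_distrib[symmetric])
  have "(\<lambda>k. 2 * ((2 * u) ^ (2 * k) / fact (2 * k) - 2 * (u ^ (2 * k) / fact (2 * k)) + (if k = 0 then 1 else 0)))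
      sums (2 * (cosh (2 * u) - 2 * cosh u + 1))"
    by (intro sums_mult sums_add sums_diff cosh_even_series one)
  also have "(\<lambda>k. 2 * ((2 * u) ^ (2 * k) / fact (2 * k) - 2 * (u ^ (2 * k) / fact (2 * k)) + (if k = 0 then 1 else 0)))
      = (\<lambda>k. 2 * even_coeff k * u ^ (2 * k))"
    by (auto simp: even_coeff_def fun_eq_iff field_simps power_mult_distrib power_mult four)
  also have "2 * (cosh (2 * u) - 2 * cosh u + 1) = (exp (- u) - 1)\<^sup>2 + (exp u - 1)\<^sup>2"
    by (simp add: cosh_def power2_eq_square algebra_simps exp_add[symmetric])
  finally show ?thesis .
qed

definition distance_weight :: "(real^'p) \<times> (real^'q) \<Rightarrow> real" where
  "distance_weight z = exp (- (norm (fst z))\<^sup>2) * exp (- (norm (snd z))\<^sup>2)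
     / (norm (fst z) ^ (CARD('p) + 1) * norm (snd z) ^ (CARD('q) + 1))"

lemma distance_weight_nonneg: "0 \<le> distance_weight z"
  by (simp add: distance_weight_def)

lemma distance_weight_measurable [measurable]: "distance_weight \<in> borel_measurable borel"
  unfolding distance_weight_def borel_prod[symmetric] by measurable

lemma nn_integral_flip_fst:
  fixes f :: "(real^'p) \<times> (real^'q) \<Rightarrow> ennreal"
  assumes [measurable]: "f \<in> borel_measurable borel"
  shows "(\<integral>\<^sup>+z. f (- fst z, snd z) \<partial>lborel) = (\<integral>\<^sup>+z. f z \<partial>lborel)"
proof -
  have iter: "(\<integral>\<^sup>+z. g z \<partial>lborel) = (\<integral>\<^sup>+t. (\<integral>\<^sup>+s. g (s, t) \<partial>lborel) \<partial>lborel)"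
    if "g \<in> borel_measurable borel" for g :: "(real^'p) \<times> (real^'q) \<Rightarrow> ennreal"
    using lborel_pair.nn_integral_snd[of g] that by (simp add: lborel_prod)
  have flip: "(\<integral>\<^sup>+s. f (- s, t) \<partial>lborel) = (\<integral>\<^sup>+s. f (s, t) \<partial>lborel)" for t
    using nn_integral_translate(2)[of "\<lambda>s. f (s, t)" 0] by simp
  have "(\<lambda>z :: (real^'p) \<times> (real^'q). (- fst z, snd z)) \<in> borel \<rightarrow>\<^sub>M borel"
    by (intro borel_measurable_continuous_onI continuous_intros)
  then have "(\<lambda>z. f (- fst z, snd z)) \<in> borel_measurable borel"
    by (rule measurable_compose) (rule assms)
  then show ?thesis
    by (simp add: iter assms flip)
qed

lemma fact_double_half: "fact (2 * k) = 4 ^ k * pochhammer (1/2) k * (fact k :: real)"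
  using fact_double[of k, where ?'a = real] by (simp add: power_mult)

lemma minus_half_nonpos_Ints: "(-1/2 :: real) \<notin> \<int>\<^sub>\<le>\<^sub>0"
proof
  assume "(-1/2 :: real) \<in> \<int>\<^sub>\<le>\<^sub>0"
  then obtain n :: int where "-1/2 = real_of_int n" by (auto simp: nonpos_Ints_def)
  then have "real_of_int (2 * n) = real_of_int (-1)" by simp
  then have "2 * n = -1" by (simp only: of_int_eq_iff)
  then show False by presburger
qed

lemma Gamma_shift_ratio:
  assumes "b > 0"
  shows "Gamma (real k - 1/2) / Gamma (real k + b) = Gamma (-1/2) / Gamma b * (pochhammer (-1/2) k / pochhammer b k)"
proof -
  have b: "b \<notin> \<int>\<^sub>\<le>\<^sub>0" using assms by (auto simp: nonpos_Ints_def)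
  have "Gamma (real k - 1/2) = Gamma (-1/2) * pochhammer (-1/2) k"
    using pochhammer_Gamma[OF minus_half_nonpos_Ints, of k] minus_half_nonpos_Ints
    by (simp add: Gamma_eq_zero_iff add.commute)
  moreover have "Gamma (real k + b) = Gamma b * pochhammer b k"
    using pochhammer_Gamma[OF b, of k] b by (simp add: Gamma_eq_zero_iff add.commute)
  ultimately show ?thesis by simp
qed

lemma Gamma_minus_half: "(Gamma (-1/2 :: real))\<^sup>2 = 4 * pi"
proof -
  have "Gamma (-1/2 + 1 :: real) = (-1/2) * Gamma (-1/2)"
    by (rule Gamma_plus1) (rule minus_half_nonpos_Ints)
  then have "Gamma (-1/2 :: real) = -2 * sqrt pi"
    by (simp add: Gamma_one_half_real)
  then show ?thesis by (simp add: power_mult_distrib)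
qed

lemma Gamma_half_CARD_pos: "0 < Gamma (real CARD('p::finite) / 2)"
  by (intro Gamma_real_pos) simp

text \<open>The factor common to all terms of the series; \<open>4 * pi\<close> is the square of the value of the Gamma function at \<open>-1/2\<close>.\<close>

definition distance_const :: "nat \<Rightarrow> nat \<Rightarrow> real" where
  "distance_const p q = 4 * pi * sqrt pi ^ p * sqrt pi ^ q / (Gamma (real p / 2) * Gamma (real q / 2))"

definition signed_term :: "real \<Rightarrow> real^'q::finite \<Rightarrow> nat \<Rightarrow> real" where
  "signed_term b y k = row_term b y k - 2 * (row_term b y k / 4 ^ k) + (if k = 0 then 1 else 0)"

lemma even_coeff_distance_term:
  fixes R :: "real^'q^'p"
  assumes y: "eigenvalue_vec (transpose R ** R) y"
  shows "ennreal (2 * even_coeff k) * (\<integral>\<^sup>+z. ennreal (distance_weight z * (fst z \<bullet> (R *v snd z)) ^ (2 * k)) \<partial>(lborel :: ((real^'p) \<times> (real^'q)) measure))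
    = ennreal (2 * (distance_const CARD('p) CARD('q) * signed_term (real CARD('p) / 2) y k))"
proof (cases "k = 0")
  case True
  then show ?thesis by (simp add: even_coeff_0 signed_term_def row_term_def row_form_0)
next
  case False
  define h where "h = pochhammer (1/2 :: real) k"
  have h: "h > 0" by (simp add: h_def pochhammer_pos)
  have coeff: "even_coeff k * (h * fact k) = 1 - 2 / 4 ^ k"
  proof -
    have "even_coeff k = (4 ^ k - 2) / (4 ^ k * (h * fact k))"
      using False unfolding even_coeff_def fact_double_half h_def by (simp add: mult.assoc)
    then show ?thesis using h by (simp add: field_simps)
  qed
  have "(\<integral>\<^sup>+z. ennreal (distance_weight z * (fst z \<bullet> (R *v snd z)) ^ (2 * k)) \<partial>(lborel :: ((real^'p) \<times> (real^'q)) measure))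
      = ennreal (Gamma (real k - 1/2) / Gamma (real k + real CARD('p) / 2) * (Gamma (real k - 1/2) / Gamma (real k + real CARD('q) / 2))
       * sqrt pi ^ CARD('p) * sqrt pi ^ CARD('q) * h * fact k * row_form k y)"
    unfolding h_def using nn_integral_distance_term[OF y, of k] False
    by (simp add: distance_weight_def)
  also have "ennreal (2 * even_coeff k) * \<dots> = ennreal (2 * even_coeff k * (Gamma (real k - 1/2) / Gamma (real k + real CARD('p) / 2) * (Gamma (real k - 1/2) / Gamma (real k + real CARD('q) / 2))
       * sqrt pi ^ CARD('p) * sqrt pi ^ CARD('q) * h * fact k * row_form k y))"
    using even_coeff_nonneg[of k] by (intro ennreal_mult'[symmetric]) simp
  also have "2 * even_coeff k * (Gamma (real k - 1/2) / Gamma (real k + real CARD('p) / 2) * (Gamma (real k - 1/2) / Gamma (real k + real CARD('q) / 2))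
       * sqrt pi ^ CARD('p) * sqrt pi ^ CARD('q) * h * fact k * row_form k y)
     = 2 * ((even_coeff k * (h * fact k)) * ((Gamma (-1/2))\<^sup>2 * sqrt pi ^ CARD('p) * sqrt pi ^ CARD('q) / (Gamma (real CARD('p) / 2) * Gamma (real CARD('q) / 2)))
        * row_term (real CARD('p) / 2) y k)"
    by (simp add: Gamma_shift_ratio row_term_def power2_eq_square mult_ac)
  also have "\<dots> = 2 * (distance_const CARD('p) CARD('q) * signed_term (real CARD('p) / 2) y k)"
    unfolding coeff Gamma_minus_half using False by (simp add: distance_const_def signed_term_def algebra_simps)
  finally show ?thesis .
qed

lemma signed_term_nonneg:
  fixes y :: "real^'q"
  assumes "1/2 \<le> b" "\<And>i. 0 \<le> y $ i" "\<And>i. y $ i \<le> 1"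
  shows "0 \<le> signed_term b y k"
proof (cases k)
  case 0
  then show ?thesis by (simp add: signed_term_def row_term_def row_form_0)
next
  case (Suc n)
  have "(4::real) ^ 1 \<le> 4 ^ k" by (rule power_increasing) (auto simp: Suc)
  then have "(2::real) \<le> 4 ^ k" by simp
  moreover have "0 \<le> row_term b y k" using row_term_bounds(1)[OF assms] Suc by simp
  ultimately have "row_term b y k * 2 \<le> row_term b y k * 4 ^ k" by (rule mult_left_mono)
  then have "2 * (row_term b y k / 4 ^ k) \<le> row_term b y k"
    by (simp add: pos_divide_le_eq mult.commute)
  then show ?thesis using Suc by (simp add: signed_term_def)
qed

lemma signed_term_sums:
  fixes y :: "real^'q"
  assumes "1/2 \<le> b" "\<And>i. 0 \<le> y $ i" "\<And>i. y $ i \<le> 1"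
  shows "signed_term b y sums ((\<Sum>k. row_term b y k) - 2 * (\<Sum>k. row_term b y k / 4 ^ k) + 1)"
proof -
  have s: "summable (row_term b y)" by (rule row_term_summable[OF assms])
  have "summable (\<lambda>k. row_term b y k / 4 ^ k)"
  proof (rule summable_comparison_test'[OF s, of 1])
    show "norm (row_term b y k / 4 ^ k) \<le> row_term b y k" if "1 \<le> k" for k
    proof -
      have "row_term b y k * 1 \<le> row_term b y k * 4 ^ k"
        using row_term_bounds(1)[OF assms that] by (intro mult_left_mono) auto
      then show ?thesis using row_term_bounds(1)[OF assms that] by (simp add: field_simps)
    qed
  qed
  moreover have "(\<lambda>k. if k = 0 then 1 else 0 :: real) sums 1"
    using sums_single[of 0 "\<lambda>_. 1 :: real"] by simp
  ultimately show ?thesis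
    unfolding signed_term_def[abs_def] using s by (intro sums_add sums_diff sums_mult) (auto simp: summable_sums)
qed

text \<open>Adding the integrand reflected in \<open>s\<close> doubles the integral and leaves a series of nonnegative terms.\<close>

lemma nn_integral_distance:
  fixes R :: "real^'q^'p"
  assumes y: "eigenvalue_vec (transpose R ** R) y" "\<And>i. 0 \<le> y $ i" "\<And>i. y $ i \<le> 1"
  shows "(\<integral>\<^sup>+z. ennreal (distance_weight z * (exp (- (fst z \<bullet> (R *v snd z))) - 1)\<^sup>2) \<partial>(lborel :: ((real^'p) \<times> (real^'q)) measure))
    = ennreal (distance_const CARD('p) CARD('q) *
        ((\<Sum>k. row_term (real CARD('p) / 2) y k) - 2 * (\<Sum>k. row_term (real CARD('p) / 2) y k / 4 ^ k) + 1))"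
proof -
  let ?b = "real CARD('p) / 2"
  define u where "u = (\<lambda>z :: (real^'p) \<times> (real^'q). fst z \<bullet> (R *v snd z))"
  define \<Phi> where "\<Phi> = (\<lambda>z. ennreal (distance_weight z * (exp (- u z) - 1)\<^sup>2))"
  define T where "T = (\<Sum>k. row_term ?b y k) - 2 * (\<Sum>k. row_term ?b y k / 4 ^ k) + 1"
  have b: "1/2 \<le> ?b" by (simp add: Suc_le_eq)
  have [measurable]: "(\<lambda>t. R *v t) \<in> borel_measurable borel"
    by (intro borel_measurable_continuous_onI linear_continuous_on) simp
  have [measurable]: "u \<in> borel_measurable borel" unfolding u_def borel_prod[symmetric] by measurable
  have [measurable]: "\<Phi> \<in> borel_measurable borel" unfolding \<Phi>_def by measurable
  have flip: "\<Phi> (- fst z, snd z) = ennreal (distance_weight z * (exp (u z) - 1)\<^sup>2)" for z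
    by (simp add: \<Phi>_def u_def distance_weight_def)
  have C: "0 \<le> distance_const CARD('p) CARD('q)"
    using Gamma_half_CARD_pos[where ?'p = 'p] Gamma_half_CARD_pos[where ?'p = 'q] by (simp add: distance_const_def)
  have series: "ennreal (distance_weight z * (exp (- u z) - 1)\<^sup>2) + ennreal (distance_weight z * (exp (u z) - 1)\<^sup>2)
      = (\<Sum>k. ennreal (2 * even_coeff k) * ennreal (distance_weight z * u z ^ (2 * k)))" for z
  proof -
    have nn: "0 \<le> distance_weight z * (2 * even_coeff k * u z ^ (2 * k))" for k
      by (simp add: distance_weight_nonneg even_coeff_nonneg power_mult)
    have "(\<lambda>k. distance_weight z * (2 * even_coeff k * u z ^ (2 * k)))
        sums (distance_weight z * ((exp (- u z) - 1)\<^sup>2 + (exp (u z) - 1)\<^sup>2))"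
      by (intro sums_mult even_part_sums)
    from suminf_ennreal_eq[OF nn this]
    have "(\<Sum>k. ennreal (distance_weight z * (2 * even_coeff k * u z ^ (2 * k))))
        = ennreal (distance_weight z * ((exp (- u z) - 1)\<^sup>2 + (exp (u z) - 1)\<^sup>2))" .
    moreover have "ennreal (distance_weight z * (2 * even_coeff k * u z ^ (2 * k)))
        = ennreal (2 * even_coeff k) * ennreal (distance_weight z * u z ^ (2 * k))" for k
      by (subst ennreal_mult'[symmetric]) (auto simp: even_coeff_nonneg mult_ac)
    ultimately show ?thesis
      by (simp add: ennreal_plus[symmetric] distance_weight_nonneg distrib_left del: ennreal_plus)
  qed
  have "2 * (\<integral>\<^sup>+z. \<Phi> z \<partial>lborel) = (\<integral>\<^sup>+z. \<Phi> z \<partial>lborel) + (\<integral>\<^sup>+z. \<Phi> (- fst z, snd z) \<partial>lborel)"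
    unfolding nn_integral_flip_fst[OF \<open>\<Phi> \<in> borel_measurable borel\<close>] by (rule mult_2)
  also have "\<dots> = (\<integral>\<^sup>+z. \<Phi> z + \<Phi> (- fst z, snd z) \<partial>lborel)"
    unfolding flip by (intro nn_integral_add[symmetric]) measurable
  also have "\<dots> = (\<integral>\<^sup>+z. (\<Sum>k. ennreal (2 * even_coeff k) * ennreal (distance_weight z * u z ^ (2 * k))) \<partial>lborel)"
    unfolding flip unfolding \<Phi>_def series ..
  also have "\<dots> = (\<Sum>k. \<integral>\<^sup>+z. ennreal (2 * even_coeff k) * ennreal (distance_weight z * u z ^ (2 * k)) \<partial>lborel)"
    by (intro nn_integral_suminf) measurable
  also have "\<dots> = (\<Sum>k. ennreal (2 * even_coeff k) * (\<integral>\<^sup>+z. ennreal (distance_weight z * u z ^ (2 * k)) \<partial>lborel))"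
    by (intro suminf_cong nn_integral_cmult) measurable
  also have "\<dots> = (\<Sum>k. ennreal (2 * (distance_const CARD('p) CARD('q) * signed_term ?b y k)))"
    unfolding u_def even_coeff_distance_term[OF y(1)] ..
  also have "\<dots> = ennreal (2 * (distance_const CARD('p) CARD('q) * T))"
    unfolding T_def
    by (intro suminf_ennreal_eq sums_mult signed_term_sums[OF b y(2,3)])
       (simp add: C signed_term_nonneg[OF b y(2,3)])
  also have "\<dots> = 2 * ennreal (distance_const CARD('p) CARD('q) * T)"
    by (subst ennreal_mult') auto
  finally have "2 * (\<integral>\<^sup>+z. \<Phi> z \<partial>lborel) = 2 * ennreal (distance_const CARD('p) CARD('q) * T)" .
  then have "(\<integral>\<^sup>+z. \<Phi> z \<partial>lborel) = ennreal (distance_const CARD('p) CARD('q) * T)"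
    by (simp add: ennreal_mult_cancel_left)
  then show ?thesis unfolding \<Phi>_def u_def T_def .
qed

lemma dcov_standardized:
  fixes X :: "'a \<Rightarrow> real^'p" and Y :: "'a \<Rightarrow> real^'q"
  assumes M: "prob_space M"
    and Z: "multivariate_normal M (\<lambda>\<omega>. join_vec (X \<omega>) (Y \<omega>)) \<mu> (block_matrix A B (transpose B) D)"
    and inv: "invertible A" "invertible D"
    and y: "eigenvalue_vec (transpose (standard_cross A B D) ** standard_cross A B D) y"
      "\<And>i. 0 \<le> y $ i" "\<And>i. y $ i \<le> 1"
  shows "(dcov M (\<lambda>\<omega>. inv_sqrt_matrix A *v X \<omega>) (\<lambda>\<omega>. inv_sqrt_matrix D *v Y \<omega>))\<^sup>2
    = distance_const CARD('p) CARD('q) / (dcov_const CARD('p) * dcov_const CARD('q)) *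
        ((\<Sum>k. row_term (real CARD('p) / 2) y k) - 2 * (\<Sum>k. row_term (real CARD('p) / 2) y k / 4 ^ k) + 1)"
proof -
  let ?R = "standard_cross A B D"
  let ?U = "\<lambda>\<omega>. inv_sqrt_matrix A *v X \<omega>" and ?V = "\<lambda>\<omega>. inv_sqrt_matrix D *v Y \<omega>"
  define v where "v = distance_const CARD('p) CARD('q) *
      ((\<Sum>k. row_term (real CARD('p) / 2) y k) - 2 * (\<Sum>k. row_term (real CARD('p) / 2) y k / 4 ^ k) + 1)"
  define f where "f = (\<lambda>z :: (real^'p) \<times> (real^'q). distance_weight z * (exp (- (fst z \<bullet> (?R *v snd z))) - 1)\<^sup>2)"
  have b: "1/2 \<le> real CARD('p) / 2" by (simp add: Suc_le_eq)
  have v: "0 \<le> v"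
    unfolding v_def sums_unique[OF signed_term_sums[OF b y(2,3)]]
  proof (intro mult_nonneg_nonneg suminf_nonneg sums_summable[OF signed_term_sums[OF b y(2,3)]])
    show "0 \<le> distance_const CARD('p) CARD('q)"
      using Gamma_half_CARD_pos[where ?'p = 'p] Gamma_half_CARD_pos[where ?'p = 'q] by (simp add: distance_const_def)
  qed (rule signed_term_nonneg[OF b y(2,3)])
  have char: "(cmod (joint_char M ?U ?V s t - joint_char M ?U ?V s 0 * joint_char M ?U ?V 0 t))\<^sup>2
        / (norm s ^ (CARD('p) + 1) * norm t ^ (CARD('q) + 1)) = f (s, t)" for s t
  proof -
    obtain \<theta> where th: "joint_char M ?U ?V s t - joint_char M ?U ?V s 0 * joint_char M ?U ?V 0 t
        = exp (\<i> * complex_of_real \<theta>) * complex_of_real (exp (- ((norm s)\<^sup>2 + (norm t)\<^sup>2) / 2) * (exp (- (s \<bullet> (?R *v t))) - 1))"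
      using joint_char_standardized[OF M Z inv, of s t] by blast
    have half: "(exp (- ((norm s)\<^sup>2 + (norm t)\<^sup>2) / 2))\<^sup>2 = exp (- (norm s)\<^sup>2) * exp (- (norm t)\<^sup>2)"
      by (simp add: power2_eq_square exp_add[symmetric] field_simps)
    have "(cmod (joint_char M ?U ?V s t - joint_char M ?U ?V s 0 * joint_char M ?U ?V 0 t))\<^sup>2
        = (exp (- ((norm s)\<^sup>2 + (norm t)\<^sup>2) / 2))\<^sup>2 * (exp (- (s \<bullet> (?R *v t))) - 1)\<^sup>2"
      unfolding th norm_mult norm_exp_i_times norm_of_real by (simp only: abs_mult power_mult_distrib power2_abs mult_1_left)
    then show ?thesis
      unfolding half by (simp add: f_def distance_weight_def)
  qed
  have [measurable]: "(\<lambda>t. ?R *v t) \<in> borel_measurable borel"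
    by (intro borel_measurable_continuous_onI linear_continuous_on) simp
  have meas: "f \<in> borel_measurable lborel"
  proof -
    have "(\<lambda>z :: (real^'p) \<times> (real^'q). (exp (- (fst z \<bullet> (?R *v snd z))) - 1)\<^sup>2) \<in> borel_measurable borel"
      unfolding borel_prod[symmetric] by measurable
    then show ?thesis unfolding f_def by (simp add: borel_measurable_times)
  qed
  have "(LINT z|lborel. f z) = enn2real (\<integral>\<^sup>+z. ennreal (f z) \<partial>lborel)"
    by (rule integral_eq_nn_integral[OF meas]) (simp add: f_def distance_weight_nonneg)
  also have "\<dots> = v"
    unfolding f_def nn_integral_distance[OF y] v_def[symmetric] using v by simp
  finally have int: "(LINT z|lborel. f z) = v" .
  have "0 < dcov_const n" for n :: nat
    by (auto simp: dcov_const_def intro!: divide_pos_pos Gamma_real_pos)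
  then have "0 \<le> 1 / (dcov_const CARD('p) * dcov_const CARD('q)) * v"
    using v by (simp add: less_imp_le)
  then show ?thesis
    unfolding dcov_def char case_prod_eta int by (simp add: v_def)
qed

lemma dcov_const_pred: "dcov_const (CARD('n::finite) - 1) = sqrt pi ^ CARD('n) / Gamma (real CARD('n) / 2)"
proof -
  have "sqrt pi ^ CARD('n) = pi powr (real CARD('n) / 2)"
    by (simp add: powr_half_sqrt[symmetric] powr_realpow[symmetric] powr_powr)
  moreover have "real (CARD('n) - 1) + 1 = real CARD('n)"
    by (simp add: of_nat_diff Suc_le_eq)
  ultimately show ?thesis unfolding dcov_const_def by simp
qed

lemma distance_const_eq:
  "distance_const CARD('p::finite) CARD('q::finite) / (dcov_const CARD('p) * dcov_const CARD('q))
    = 4 * pi * (dcov_const (CARD('p) - 1) / dcov_const CARD('p)) * (dcov_const (CARD('q) - 1) / dcov_const CARD('q))"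
  unfolding dcov_const_pred by (simp add: distance_const_def)

theorem corollary3p2:
  fixes M :: "'a measure"
    and X :: "'a \<Rightarrow> real^'p" and Y :: "'a \<Rightarrow> real^'q"
    and \<mu> :: "real^('p + 'q)"
    and \<Sigma>\<^sub>X :: "real^'p^'p" and \<Sigma>\<^sub>X\<^sub>Y :: "real^'q^'p" and \<Sigma>\<^sub>Y :: "real^'q^'q"
    and \<Lambda> :: "real^'q^'q"
  assumes "prob_space M"
    and "multivariate_normal M (\<lambda>\<omega>. join_vec (X \<omega>) (Y \<omega>)) \<mu>
           (block_matrix \<Sigma>\<^sub>X \<Sigma>\<^sub>X\<^sub>Y (transpose \<Sigma>\<^sub>X\<^sub>Y) \<Sigma>\<^sub>Y)"
    and "invertible \<Sigma>\<^sub>X" and "invertible \<Sigma>\<^sub>Y"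
    and "\<Lambda> = inv_sqrt_matrix \<Sigma>\<^sub>Y ** transpose \<Sigma>\<^sub>X\<^sub>Y ** matrix_inv \<Sigma>\<^sub>X ** \<Sigma>\<^sub>X\<^sub>Y ** inv_sqrt_matrix \<Sigma>\<^sub>Y"
  shows "(affine_dcov M X Y)\<^sup>2 =
    4 * pi * (dcov_const (CARD('p) - 1) / dcov_const CARD('p))
           * (dcov_const (CARD('q) - 1) / dcov_const CARD('q)) *
    (hypergeometric_matrix [1/2, -1/2, -1/2] [real CARD('p) / 2, real CARD('q) / 2] \<Lambda>
     - 2 * hypergeometric_matrix [1/2, -1/2, -1/2] [real CARD('p) / 2, real CARD('q) / 2] ((1/4) *\<^sub>R \<Lambda>)
     + 1)"
proof -
  note context_facts = assms(1-4)
  let ?R = "standard_cross \<Sigma>\<^sub>X \<Sigma>\<^sub>X\<^sub>Y \<Sigma>\<^sub>Y"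
  define y where "y = (SOME y. eigenvalue_vec \<Lambda> y)"
  define y' where "y' = (SOME y. eigenvalue_vec ((1/4) *\<^sub>R \<Lambda>) y)"
  have gram: "\<Lambda> = transpose ?R ** ?R"
    unfolding assms(5) standard_cross_gram[OF context_facts] ..
  have sym: "transpose \<Lambda> = \<Lambda>" by (simp add: gram matrix_transpose_mul)
  have "eigenvalue_vec \<Lambda> y"
    unfolding y_def by (rule someI_ex[OF eigenvalue_vec_exists[OF sym]])
  moreover have "transpose ((1/4) *\<^sub>R \<Lambda>) = (1/4) *\<^sub>R \<Lambda>"
    using sym by (simp add: Finite_Cartesian_Product.transpose_def vec_eq_iff)
  then have "eigenvalue_vec ((1/4) *\<^sub>R \<Lambda>) y'"
    unfolding y'_def by (intro someI_ex[OF eigenvalue_vec_exists])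
  ultimately have y: "eigenvalue_vec \<Lambda> y" "eigenvalue_vec ((1/4) *\<^sub>R \<Lambda>) y'" .
  have quad: "t \<bullet> (\<Lambda> *v t) = (norm (?R *v t))\<^sup>2" for t
    using dot_matrix_vector[of "?R *v t" ?R t]
    by (simp add: gram power2_norm_eq_inner matrix_vector_mul_assoc[symmetric] inner_commute del: matrix_vector_mul_assoc)
  have psd: "0 \<le> t \<bullet> (\<Lambda> *v t)" for t unfolding quad by simp
  have contraction: "t \<bullet> (\<Lambda> *v t) \<le> 1 * (t \<bullet> t)" for t
    using power_mono[OF standard_cross_contraction[OF context_facts, of t], of 2]
    unfolding quad by (simp add: power2_norm_eq_inner)
  have y0: "0 \<le> y $ i" for i by (rule nn_integral_gaussian_quadratic(2)[OF y(1) psd])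
  have y1: "y $ i \<le> 1" for i by (rule nn_integral_gaussian_quadratic(3)[OF y(1) psd contraction])
  have quarter: "row_term b y' = (\<lambda>k. row_term b y k / 4 ^ k)" for b
    using row_form_scaled_matrix[OF y _ psd] by (simp add: row_term_def fun_eq_iff power_one_over)
  have "covariance_matrix M X = \<Sigma>\<^sub>X" "covariance_matrix M Y = \<Sigma>\<^sub>Y"
    using mvn_covariance[OF assms(1) mvn_blocks(1)[OF assms(2)]]
      mvn_covariance[OF assms(1) mvn_blocks(2)[OF assms(2)]] .
  then show ?thesis
    unfolding affine_dcov_def hypergeometric_rows y_def[symmetric] y'_def[symmetric] quarter
      distance_const_eq[symmetric]
    using dcov_standardized[OF context_facts y(1)[unfolded gram] y0 y1] by simp
qed

end
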